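(* Let $\alpha\in(1,2)$ and $\beta\in[-1,1]$, and let $Z\sim S_\alpha(1,\beta)$, with density $p_Z$. Then $\eta_{\alpha,\beta}:=\mathrm{Beta}\big(\tfrac2\alpha,1-\tfrac1\alpha\big)\int_{\mathbb{R}}|p_Z'(y)|\,dy<\infty$, and for any integrable random variable $X$, \[ d_W(\mathcal{L}(X),\mathcal{L}(Z))\leqslant \sup_{\substack{\phi\in C^2(\mathbb{R}):\ \|\phi'\|_\infty\leqslant\alpha,\\ \|\phi''\|_\infty\leqslant\eta_{\alpha,\beta}}}\Big|\mathbb{E}[(\mathcal{L}^{\alpha,\beta}\phi)(X)]-\frac1\alpha\mathbb{E}[X\phi'(X)]\Big|. \]
   Context: For $\alpha\in(1,2)$, $\sigma>0$, $\beta\in[-1,1]$, $Z\sim S_\alpha(\sigma,\beta)$ means $\mathbb{E}[e^{itZ}]=\exp\{-\sigma^\alpha|t|^\alpha(1-i\beta\,\mathrm{sign}(t)\tan\frac{\pi\alpha}{2})\}$ for all $t\in\mathbb{R}$; this law has a smooth density. For $\phi\in C^2(\mathbb{R})$ with $\|\phi''\|_\infty<\infty$, \[ (\mathcal{L}^{\alpha,\beta}\phi)(x)=d_\alpha\int_{\mathbb{R}}\frac{\phi(u+x)-\phi(x)-u\phi'(x)}{2|u|^{1+\alpha}}\big[(1+\beta)\mathbf{1}_{(0,\infty)}(u)+(1-\beta)\mathbf{1}_{(-\infty,0)}(u)\big]du, \] where $d_\alpha=\big(\int_0^\infty\frac{1-\cos y}{y^{1+\alpha}}dy\big)^{-1}$.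 The Wasserstein distance is $d_W(\mathcal{L}(X),\mathcal{L}(Y))=\sup|\mathbb{E}[h(X)]-\mathbb{E}[h(Y)]|$, the supremum over all $1$-Lipschitz $h:\mathbb{R}\to\mathbb{R}$. $\mathrm{Beta}$ denotes the Euler Beta function. *)

theory Defs
  imports "HOL-Probability.Probability"
begin

definition stable_cf :: "real \<Rightarrow> real \<Rightarrow> real \<Rightarrow> real \<Rightarrow> complex" where
  "stable_cf \<alpha> \<sigma> \<beta> t =
     exp (- complex_of_real ((\<sigma> powr \<alpha>) * (\<bar>t\<bar> powr \<alpha>))
          * (1 - \<i> * complex_of_real (\<beta> * sgn t * tan (pi * \<alpha> / 2))))"

definition is_stable_law :: "real \<Rightarrow> real \<Rightarrow> real \<Rightarrow> real measure \<Rightarrow> bool" where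
  "is_stable_law \<alpha> \<sigma> \<beta> \<mu> \<longleftrightarrow>
     real_distribution \<mu> \<and> (\<forall>t. char \<mu> t = stable_cf \<alpha> \<sigma> \<beta> t)"

definition d_const :: "real \<Rightarrow> real" where
  "d_const \<alpha> = 1 / (LBINT y:{0<..}. (1 - cos y) / y powr (1 + \<alpha>))"

definition stable_gen :: "real \<Rightarrow> real \<Rightarrow> (real \<Rightarrow> real) \<Rightarrow> real \<Rightarrow> real" where
  "stable_gen \<alpha> \<beta> \<phi> x = d_const \<alpha> *
     (LINT u|lborel. (\<phi> (u + x) - \<phi> x - u * deriv \<phi> x) / (2 * \<bar>u\<bar> powr (1 + \<alpha>))
        * ((1 + \<beta>) * indicator {0<..} u + (1 - \<beta>) * indicator {..<0} u))"

definition C2 :: "(real \<Rightarrow> real) \<Rightarrow> bool" where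
  "C2 \<phi> \<longleftrightarrow> (\<forall>x. \<phi> differentiable (at x)) \<and> (\<forall>x. deriv \<phi> differentiable (at x))
      \<and> continuous_on UNIV (deriv (deriv \<phi>))"

definition wasserstein :: "real measure \<Rightarrow> real measure \<Rightarrow> ereal" where
  "wasserstein \<mu> \<nu> = (SUP h\<in>{h. lipschitz_on 1 UNIV h}.
      ereal \<bar>(\<integral>x. h x \<partial>\<mu>) - (\<integral>x. h x \<partial>\<nu>)\<bar>)"

end

theory Submission
  imports Defs
begin

text \<open>
  Let \<open>\<psi>\<close> be the characteristic exponent of \<open>Z\<close>. The Stein equation \<open>L \<phi> - x \<phi>' / \<alpha> = h - E h(Z)\<close> is solved
  explicitly for \<open>h(x) = exp (i s x)\<close> by
  \<open>\<phi>(x) = - \<alpha> \<integral>\<^sub>0\<^sup>1 (exp (i s r x) - 1) / r * exp ((1 - r\<^sup>\<alpha>) \<psi>(s)) dr\<close>,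
  the Ornstein--Uhlenbeck semigroup formula with \<open>r = exp (- t / \<alpha>)\<close>: since \<open>L exp (i k x) = \<psi>(k) exp (i k x)\<close> and \<open>\<psi>\<close> is
  homogeneous of degree \<open>\<alpha>\<close>, the left hand side is \<open>\<integral>\<^sub>0\<^sup>1 d/dr [exp (i s r x) exp ((1 - r\<^sup>\<alpha>) \<psi>(s))] dr\<close>.
  For a trigonometric polynomial \<open>h\<close> linearity gives \<open>\<phi>'(x) = - \<alpha> \<integral>\<^sub>0\<^sup>1 E h'(r x + c\<^sub>r Z) dr\<close> with
  \<open>c\<^sub>r = (1 - r\<^sup>\<alpha>)\<^sup>1\<^sup>/\<^sup>\<alpha>\<close>, hence \<open>\<bar>\<phi>'\<bar> \<le> \<alpha>\<close>; integrating \<open>E h''(r x + c\<^sub>r Z)\<close> by parts against the density bounds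
  \<open>\<bar>\<phi>''\<bar>\<close> by \<open>\<alpha> \<integral>\<^sub>0\<^sup>1 r / c\<^sub>r dr \<integral> \<bar>p'\<bar>\<close>, a Beta integral. Trigonometric polynomials with \<open>\<bar>h'\<bar> \<le> 1\<close> approximate
  every 1-Lipschitz function pointwise with a common linear bound, and \<open>Z\<close> is integrable, so the inequality passes to the limit.
\<close>

section \<open>Differentiation under the integral and exponential remainders\<close>

text \<open>The law of Z enters only through its characteristic function and a density
  \<open>p\<close> with derivative \<open>p'\<close>. Its first moment, the decay of
  \<open>p\<close> and the integrability of \<open>p'\<close> must therefore be recovered by Fourier
  analysis. The obstacle is the origin: for \<alpha> < 2 the exponent \<psi> is C^1 but has no
  second derivative at 0, whereas a bound of order 1 / x^2 on \<open>p'\<close> costs two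
  derivatives of t exp(\<psi>(t)), its Fourier transform up to a constant factor. These two
  derivatives exist nevertheless, because Euler's relation t \<psi>'(t) = \<alpha> \<psi>(t) removes
  \<psi>' from the first one. That L has symbol \<psi> rests on one integral, that of (exp(i y) - 1
  - i y) y powr (-1 - \<alpha>) over the half line. Rotating the ray determines it up to a real
  factor, and its real part is minus the reciprocal of \<open>d_const\<close>, so no value of the
  Gamma function enters. Exponentials are bounded eigenfunctions of L, so the Stein solution is an
  absolutely convergent integral and no semigroup theory is required.\<close>

lemma has_vector_derivative_iff_slope:
  fixes f :: "real \<Rightarrow> 'b::real_normed_vector"
  shows "(f has_vector_derivative f') (at x within S) \<longleftrightarrow>
    ((\<lambda>t. (f t - f x) /\<^sub>R (t - x)) \<longlongrightarrow> f') (at x within S)"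
proof -
  have "norm (f t - f x - (t - x) *\<^sub>R f') / norm (t - x) = norm ((f t - f x) /\<^sub>R (t - x) - f')" if "t \<noteq> x" for t
  proof -
    have "(f t - f x) /\<^sub>R (t - x) - f' = (f t - f x - (t - x) *\<^sub>R f') /\<^sub>R (t - x)"
      using that by (simp add: scaleR_diff_right)
    then show ?thesis by (simp add: divide_inverse mult.commute)
  qed
  then have "((\<lambda>t. norm (f t - f x - (t - x) *\<^sub>R f') / norm (t - x)) \<longlongrightarrow> 0) (at x within S) \<longleftrightarrow>
     ((\<lambda>t. norm ((f t - f x) /\<^sub>R (t - x) - f')) \<longlongrightarrow> 0) (at x within S)"
    by (intro tendsto_cong) (auto simp: eventually_at_filter)
  also have "\<dots> \<longleftrightarrow> ((\<lambda>t. (f t - f x) /\<^sub>R (t - x)) \<longlongrightarrow> f') (at x within S)"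
    unfolding tendsto_norm_zero_iff by (rule Lim_null[symmetric])
  finally show ?thesis
    by (simp add: has_vector_derivative_def has_derivative_iff_norm bounded_linear_scaleR_left)
qed

lemma has_vector_derivative_lebesgue_integral:
  fixes f :: "real \<Rightarrow> 'a \<Rightarrow> 'b::{banach, second_countable_topology}"
  assumes S: "convex S" "x \<in> S"
    and int: "\<And>t. t \<in> S \<Longrightarrow> integrable M (f t)"
    and deriv: "\<And>t y. t \<in> S \<Longrightarrow> y \<in> space M \<Longrightarrow> ((\<lambda>t. f t y) has_vector_derivative f' t y) (at t within S)"
    and meas: "f' x \<in> borel_measurable M"
    and bound: "\<And>t y. t \<in> S \<Longrightarrow> y \<in> space M \<Longrightarrow> norm (f' t y) \<le> w y"
    and w: "integrable M w"
  shows "((\<lambda>t. LINT y|M. f t y) has_vector_derivative (LINT y|M. f' x y)) (at x within S)"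
proof -
  have "((\<lambda>t. ((LINT y|M. f t y) - (LINT y|M. f x y)) /\<^sub>R (t - x)) \<longlongrightarrow> (LINT y|M. f' x y)) (at x within S)"
    unfolding tendsto_at_iff_sequentially comp_def
  proof (intro allI impI)
    fix X :: "nat \<Rightarrow> real"
    assume X: "\<forall>i. X i \<in> S - {x}" "X \<longlonglongrightarrow> x"
    have "(\<lambda>i. LINT y|M. (f (X i) y - f x y) /\<^sub>R (X i - x)) \<longlonglongrightarrow> (LINT y|M. f' x y)"
    proof (rule integral_dominated_convergence[where w = w])
      show "(\<lambda>y. (f (X i) y - f x y) /\<^sub>R (X i - x)) \<in> borel_measurable M" for i
        using X int[of "X i"] int[of x] S by auto
      show "AE y in M. (\<lambda>i. (f (X i) y - f x y) /\<^sub>R (X i - x)) \<longlonglongrightarrow> f' x y"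
      proof (rule AE_I2)
        fix y assume "y \<in> space M"
        from deriv[OF S(2) this] have "((\<lambda>t. (f t y - f x y) /\<^sub>R (t - x)) \<longlongrightarrow> f' x y) (at x within S)"
          by (simp add: has_vector_derivative_iff_slope)
        then show "(\<lambda>i. (f (X i) y - f x y) /\<^sub>R (X i - x)) \<longlonglongrightarrow> f' x y"
          using X unfolding tendsto_at_iff_sequentially comp_def by blast
      qed
      show "AE y in M. norm ((f (X i) y - f x y) /\<^sub>R (X i - x)) \<le> w y" for i
      proof (rule AE_I2)
        fix y assume y: "y \<in> space M"
        have "norm (f (X i) y - f x y) \<le> w y * norm (X i - x)"
        proof (rule differentiable_bound[where f' = "\<lambda>t h. h *\<^sub>R f' t y" and S = S])
          show "onorm (\<lambda>h. h *\<^sub>R f' t y) \<le> w y" if "t \<in> S" for t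
          proof -
            have "onorm (\<lambda>h. h *\<^sub>R f' t y) \<le> norm (f' t y)"
              by (rule onorm_le) (simp add: mult.commute)
            also have "\<dots> \<le> w y" using bound that y by blast
            finally show ?thesis .
          qed
        qed (use X S deriv[OF _ y] in \<open>auto simp: has_vector_derivative_def\<close>)
        moreover have "X i \<noteq> x" using X by auto
        ultimately show "norm ((f (X i) y - f x y) /\<^sub>R (X i - x)) \<le> w y"
          by (simp add: divide_simps)
      qed
    qed (use meas w in auto)
    moreover have "(LINT y|M. (f (X i) y - f x y) /\<^sub>R (X i - x)) =
        ((LINT y|M. f (X i) y) - (LINT y|M. f x y)) /\<^sub>R (X i - x)" for i
      using X int[of "X i"] int[of x] S by simp
    ultimately show "(\<lambda>i. ((LINT y|M. f (X i) y) - (LINT y|M. f x y)) /\<^sub>R (X i - x)) \<longlonglongrightarrow> (LINT y|M. f' x y)"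
      by (simp only:)
  qed
  then show ?thesis
    by (simp add: has_vector_derivative_iff_slope)
qed

lemma norm_exp_minus_1_le:
  fixes z :: complex
  assumes "Re z \<le> 0"
  shows "norm (exp z - 1) \<le> norm z"
proof -
  have "norm (exp z - exp 0) \<le> 1 * norm (z - 0)"
    by (rule field_differentiable_bound[where S = "{z. Re z \<le> 0}" and f' = exp])
       (use assms in \<open>auto intro!: derivative_eq_intros convex_halfspace_Re_le\<close>)
  then show ?thesis by simp
qed

text \<open>The derivative of exp(w) - w is exp(w) - 1, of size at most |w|; the mean value
  inequality on the half disc of radius |z| gives the quadratic bound. The linear alternative
  controls large arguments.\<close>

lemma norm_exp_minus_1_minus_le:
  fixes z :: complex
  assumes "Re z \<le> 0"
  shows "norm (exp z - 1 - z) \<le> min (2 * norm z) ((norm z)\<^sup>2)"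
proof -
  have "norm ((exp z - z) - (exp 0 - 0)) \<le> norm z * norm (z - 0)"
    by (rule field_differentiable_bound[where S = "{w. Re w \<le> 0} \<inter> cball 0 (norm z)" and f' = "\<lambda>w. exp w - 1"])
       (use assms in \<open>auto intro!: derivative_eq_intros convex_Int convex_halfspace_Re_le
          order_trans[OF norm_exp_minus_1_le]\<close>)
  then have "norm (exp z - 1 - z) \<le> (norm z)\<^sup>2" by (simp add: power2_eq_square algebra_simps)
  moreover have "norm (exp z - 1 - z) \<le> 2 * norm z"
    using norm_triangle_ineq4[of "exp z - 1" z] norm_exp_minus_1_le[OF assms] by linarith
  ultimately show ?thesis by simp
qed

text \<open>Common envelope of all remainders below: quadratic at the origin, linear at infinity. It
  leaves y powr (1 - a) near 0, integrable because a < 2, and y powr (- a) near infinity, integrable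
  because a > 1.\<close>

lemma integrable_powr_cutoff:
  fixes a :: real
  assumes "1 < a" "a < 2"
  shows "set_integrable lborel {0<..} (\<lambda>y. min y (y\<^sup>2) / y powr (1 + a))"
proof -
  have 1: "set_integrable lborel {0<..1} (\<lambda>y. y powr (1 - a))"
  proof -
    have "(\<lambda>y. y powr (1 - a)) integrable_on {0..1}"
      using assms by (intro integrable_on_powr_from_0) auto
    then have "(\<lambda>y. y powr (1 - a)) absolutely_integrable_on {0..1}"
      by (intro nonnegative_absolutely_integrable_1) auto
    then have "set_integrable lborel {0..1} (\<lambda>y. y powr (1 - a))"
      unfolding set_integrable_def
      by (subst (asm) integrable_completion) auto
    then show ?thesis by (rule set_integrable_subset) auto
  qed
  have 2: "set_integrable lborel {1<..} (\<lambda>y. y powr (- a))"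
  proof -
    have "(\<lambda>y. y powr (- a)) integrable_on {1..}"
      by (rule has_integral_integrable[OF has_integral_powr_to_inf]) (use assms in auto)
    then have "(\<lambda>y. y powr (- a)) absolutely_integrable_on {1..}"
      by (intro nonnegative_absolutely_integrable_1) auto
    then have "set_integrable lborel {1..} (\<lambda>y. y powr (- a))"
      unfolding set_integrable_def
      by (subst (asm) integrable_completion) auto
    then show ?thesis by (rule set_integrable_subset) auto
  qed
  have "set_integrable lborel ({0<..1} \<union> {1<..}) (\<lambda>y. min y (y\<^sup>2) / y powr (1 + a))"
  proof (rule set_integrable_Un)
    have "min y (y\<^sup>2) / y powr (1 + a) = y powr (1 - a)" if "y \<in> {0<..1}" for y
    proof -
      have "y\<^sup>2 \<le> y" using that by (simp add: power2_eq_square mult_left_le)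
      moreover have "y powr 2 / y powr (1 + a) = y powr (1 - a)" by (simp only: powr_diff[symmetric]) simp
      ultimately show ?thesis using that by (simp add: min_absorb2)
    qed
    then show "set_integrable lborel {0<..1} (\<lambda>y. min y (y\<^sup>2) / y powr (1 + a))"
      by (intro iffD2[OF set_integrable_cong 1]) simp_all
    have "min y (y\<^sup>2) / y powr (1 + a) = y powr (- a)" if "y \<in> {1<..}" for y
    proof -
      have "y \<le> y\<^sup>2" using that by (simp add: power2_eq_square)
      moreover have "y powr 1 / y powr (1 + a) = y powr (- a)" by (simp only: powr_diff[symmetric]) simp
      ultimately show ?thesis using that by (simp add: min_absorb1)
    qed
    then show "set_integrable lborel {1<..} (\<lambda>y. min y (y\<^sup>2) / y powr (1 + a))"
      by (intro iffD2[OF set_integrable_cong 2]) simp_all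
  qed auto
  also have "{0<..1} \<union> {1<..} = ({0<..} :: real set)" by auto
  finally show ?thesis .
qed

section \<open>Exponential remainders integrated against y powr (-1 - a)\<close>

context
  fixes a :: real
  assumes a: "1 < a" "a < 2"
begin

lemma norm_exp_remainder_powr_le:
  fixes z :: complex
  assumes "Re z \<ge> 0" "0 < y"
  shows "norm ((exp (- (z * y)) - 1 + z * y) / complex_of_real (y powr (1 + a))) \<le> (2 * norm z + (norm z)\<^sup>2) * (min y (y\<^sup>2) / y powr (1 + a))"
proof -
  have "norm (exp (- (z * y)) - 1 + z * y) \<le> min (2 * (norm z * y)) ((norm z * y)\<^sup>2)"
    using norm_exp_minus_1_minus_le[of "- (z * y)"] assms by (simp add: norm_mult)
  also have "\<dots> \<le> (2 * norm z + (norm z)\<^sup>2) * min y (y\<^sup>2)"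
  proof (cases "y \<le> y\<^sup>2")
    case True
    have "2 * (norm z * y) \<le> (2 * norm z + (norm z)\<^sup>2) * y"
      using assms by (simp add: algebra_simps)
    then show ?thesis using True by (auto simp: min_def)
  next
    case False
    have "(norm z * y)\<^sup>2 \<le> (2 * norm z + (norm z)\<^sup>2) * y\<^sup>2"
      using assms by (simp add: algebra_simps power_mult_distrib)
    then show ?thesis using False by (auto simp: min_def)
  qed
  finally show ?thesis
    using assms by (simp add: norm_divide divide_right_mono)
qed

lemma integrable_exp_remainder_powr:
  fixes z :: complex
  assumes "Re z \<ge> 0"
  shows "set_integrable lborel {0<..} (\<lambda>y. (exp (- (z * y)) - 1 + z * y) / complex_of_real (y powr (1 + a)))"
proof (rule set_integrable_bound)
  show "set_integrable lborel {0<..} (\<lambda>y. (2 * norm z + (norm z)\<^sup>2) * (min y (y\<^sup>2) / y powr (1 + a)))"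
    using integrable_powr_cutoff[OF a] by (rule set_integrable_mult_right)
  have "norm ((exp (- (z * y)) - 1 + z * y) / complex_of_real (y powr (1 + a))) \<le> norm ((2 * norm z + (norm z)\<^sup>2) * (min y (y\<^sup>2) / y powr (1 + a)))" if "0 < y" for y
    using norm_exp_remainder_powr_le[OF assms that]
      abs_ge_self[of "(2 * norm z + (norm z)\<^sup>2) * (min y (y\<^sup>2) / y powr (1 + a))"]
    unfolding real_norm_def by linarith
  then show "AE y in lborel. y \<in> {0<..} \<longrightarrow> norm ((exp (- (z * y)) - 1 + z * y) / complex_of_real (y powr (1 + a))) \<le> norm ((2 * norm z + (norm z)\<^sup>2) * (min y (y\<^sup>2) / y powr (1 + a)))"
    by simp
qed (auto simp: set_borel_measurable_def)

text \<open>The integral I(z) of the remainder is homogeneous of degree a in z, and the equation is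
  Euler's relation z I'(z) = a I(z). Partial integration proves it on the closed half plane,
  including the imaginary axis that is needed later.\<close>

lemma exp_remainder_powr_by_parts:
  fixes z :: complex
  assumes z: "Re z \<ge> 0"
  shows "set_integrable lborel {0<..} (\<lambda>y. z * y * (1 - exp (- (z * y))) / complex_of_real (y powr (1 + a)))"
    and "(LBINT y:{0<..}. z * y * (1 - exp (- (z * y))) / complex_of_real (y powr (1 + a))) =
      a * (LBINT y:{0<..}. (exp (- (z * y)) - 1 + z * y) / complex_of_real (y powr (1 + a)))"
proof -
  let ?g = "\<lambda>y::real. z * y * (1 - exp (- (z * y))) / complex_of_real (y powr (1 + a))"
  let ?f = "\<lambda>y::real. (exp (- (z * y)) - 1 + z * y) / complex_of_real (y powr (1 + a))"
  let ?F = "\<lambda>y::real. (exp (- (z * y)) - 1 + z * y) * complex_of_real (y powr - a)"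
  show g: "set_integrable lborel {0<..} ?g"
  proof (rule set_integrable_bound)
    show "set_integrable lborel {0<..} (\<lambda>y. (2 * norm z + (norm z)\<^sup>2) * (min y (y\<^sup>2) / y powr (1 + a)))"
      using integrable_powr_cutoff[OF a] by (rule set_integrable_mult_right)
    have "norm (?g y) \<le> norm ((2 * norm z + (norm z)\<^sup>2) * (min y (y\<^sup>2) / y powr (1 + a)))" if "y > 0" for y
    proof -
      have 1: "norm (1 - exp (- (z * y))) \<le> norm z * y"
        using norm_exp_minus_1_le[of "- (z * y)"] z that by (simp add: norm_mult norm_minus_commute)
      have 2: "norm (1 - exp (- (z * y))) \<le> 2"
        by (rule order_trans[OF norm_triangle_ineq4]) (use z that in simp)
      have "norm (z * y * (1 - exp (- (z * y)))) = norm z * y * norm (1 - exp (- (z * y)))"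
        using that by (simp add: norm_mult)
      also have "\<dots> \<le> (2 * norm z + (norm z)\<^sup>2) * min y (y\<^sup>2)"
      proof (cases "y \<le> y\<^sup>2")
        case True
        have "norm z * y * norm (1 - exp (- (z * y))) \<le> norm z * y * 2"
          using 2 that by (intro mult_left_mono) auto
        also have "\<dots> \<le> (2 * norm z + (norm z)\<^sup>2) * y" using that by (simp add: algebra_simps)
        finally show ?thesis using True by (auto simp: min_def)
      next
        case False
        have "norm z * y * norm (1 - exp (- (z * y))) \<le> norm z * y * (norm z * y)"
          using 1 that by (intro mult_left_mono) auto
        also have "\<dots> \<le> (2 * norm z + (norm z)\<^sup>2) * y\<^sup>2"
          using that by (simp add: algebra_simps power2_eq_square)
        finally show ?thesis using False by (auto simp: min_def)
      qed
      finally show ?thesis using that by (simp add: norm_divide divide_right_mono)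
    qed
    then show "AE y in lborel. y \<in> {0<..} \<longrightarrow> norm (?g y) \<le> norm ((2 * norm z + (norm z)\<^sup>2) * (min y (y\<^sup>2) / y powr (1 + a)))"
      by simp
  qed (auto simp: set_borel_measurable_def)
  note f = integrable_exp_remainder_powr[OF z]
  \<comment> \<open>The two halves of the remainder bound make \<open>?F\<close> of order y powr (2
    - a) at 0 and y powr (1 - a) at infinity, so both boundary terms vanish for 1 < a < 2.\<close>
  have norm_F: "norm (?F y) \<le> (norm z)\<^sup>2 * y powr (2 - a)" "norm (?F y) \<le> 2 * norm z * y powr (1 - a)" if "y > 0" for y
  proof -
    have "norm (?F y) = norm (exp (- (z * y)) - 1 + z * y) * y powr - a"
      by (simp add: norm_mult)
    moreover have "norm (exp (- (z * y)) - 1 + z * y) \<le> (norm z * y)\<^sup>2" 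
      "norm (exp (- (z * y)) - 1 + z * y) \<le> 2 * (norm z * y)"
      using norm_exp_minus_1_minus_le[of "- (z * y)"] z that by (simp_all add: norm_mult)
    moreover have "y powr (2 - a) = y\<^sup>2 * y powr - a" "y powr (1 - a) = y * y powr - a"
      using that by (simp_all add: powr_diff powr_minus field_simps)
    ultimately show "norm (?F y) \<le> (norm z)\<^sup>2 * y powr (2 - a)" "norm (?F y) \<le> 2 * norm z * y powr (1 - a)"
      using mult_right_mono[of "norm (exp (- (z * y)) - 1 + z * y)" "(norm z * y)\<^sup>2" "y powr - a"]
        mult_right_mono[of "norm (exp (- (z * y)) - 1 + z * y)" "2 * (norm z * y)" "y powr - a"]
      by (simp_all add: power_mult_distrib mult.assoc)
  qed
  have "(LBINT y=ereal 0..\<infinity>. ?g y - a * ?f y) = 0 - 0"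
  proof (rule interval_integral_FTC_integrable[where F = ?F])
    show "(?F has_vector_derivative ?g y - a * ?f y) (at y)" if "ereal 0 < ereal y" for y
    proof -
      have y: "y > 0" using that by simp
      have 1: "((\<lambda>y. exp (- (z * y)) - 1 + z * y) has_vector_derivative z - z * exp (- (z * y))) (at y)"
        by (rule has_vector_derivative_real_field) (auto intro!: derivative_eq_intros)
      have "((\<lambda>y. y powr - a) has_real_derivative - a * y powr (- a - 1)) (at y)"
        using y by (auto intro!: derivative_eq_intros)
      then have 2: "((\<lambda>y. complex_of_real (y powr - a)) has_vector_derivative complex_of_real (- a * y powr (- a - 1))) (at y)"
        by (intro has_vector_derivative_of_real) (simp add: has_real_derivative_iff_has_vector_derivative)
      have "(?F has_vector_derivative ((exp (- (z * y)) - 1 + z * y) * complex_of_real (- a * y powr (- a - 1))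
        + (z - z * exp (- (z * y))) * complex_of_real (y powr - a))) (at y)"
        by (rule has_vector_derivative_mult[OF 1 2])
      also have "(exp (- (z * y)) - 1 + z * y) * complex_of_real (- a * y powr (- a - 1))
        + (z - z * exp (- (z * y))) * complex_of_real (y powr - a) = ?g y - a * ?f y"
      proof -
        have 3: "y powr (- a - 1) = inverse (y powr (1 + a))"
        proof -
          have "- a - 1 = - (1 + a)" by simp
          then show ?thesis by (simp only: powr_minus)
        qed
        have 4: "y powr - a = y * inverse (y powr (1 + a))"
          using powr_mult_base[of y "- a - 1"] y by (simp add: 3)
        show ?thesis unfolding 3 4 divide_inverse of_real_mult of_real_inverse of_real_minus
          by algebra
      qed
      finally show ?thesis .
    qed
    show "isCont (\<lambda>y. ?g y - a * ?f y) y" if "ereal 0 < ereal y" for y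
      using that by (intro continuous_intros) auto
    show "set_integrable lborel (einterval (ereal 0) \<infinity>) (\<lambda>y. ?g y - a * ?f y)"
      using set_integral_diff(1)[OF g set_integrable_mult_right[OF f, of a]] 
      by (simp only: einterval_eq)
    have "(?F \<longlongrightarrow> 0) (at_right 0)"
    proof (rule Lim_null_comparison)
      show "((\<lambda>y. (norm z)\<^sup>2 * y powr (2 - a)) \<longlongrightarrow> 0) (at_right 0)"
        using a by (intro tendsto_mult_right_zero tendsto_zero_powrI[where b = "2 - a"]) (auto simp: eventually_at_filter)
    qed (use norm_F(1) in \<open>auto simp: eventually_at_filter\<close>)
    then show "((?F \<circ> real_of_ereal) \<longlongrightarrow> 0) (at_right (ereal 0))"
      by (simp only: ereal_tendsto_simps)
    have "(?F \<longlongrightarrow> 0) at_top"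
    proof (rule Lim_null_comparison)
      show "((\<lambda>y. 2 * norm z * y powr (1 - a)) \<longlongrightarrow> 0) at_top"
        using a by (intro tendsto_mult_right_zero tendsto_neg_powr filterlim_ident) auto
      show "\<forall>\<^sub>F y in at_top. norm (?F y) \<le> 2 * norm z * y powr (1 - a)"
        by (rule eventually_mono[OF eventually_gt_at_top[of 0]]) (rule norm_F(2))
    qed 
    then show "((?F \<circ> real_of_ereal) \<longlongrightarrow> 0) (at_left \<infinity>)"
      by (simp add: ereal_tendsto_simps)
  qed auto
  then have "(LBINT y:{0<..}. ?g y - a * ?f y) = 0"
    unfolding interval_integral_to_infinity_eq by simp
  also have "(LBINT y:{0<..}. ?g y - a * ?f y) = (LBINT y:{0<..}. ?g y) - (LBINT y:{0<..}. a * ?f y)"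
    by (rule set_integral_diff(2)[OF g]) (rule set_integrable_mult_right[OF f, of a])
  also have "(LBINT y:{0<..}. a * ?f y) = a * (LBINT y:{0<..}. ?f y)"
    by (rule set_integral_mult_right)
  finally show "(LBINT y:{0<..}. ?g y) = a * (LBINT y:{0<..}. ?f y)"
    by simp
qed

end

section \<open>Evaluation of the half-line integral by rotating the ray\<close>

context
  fixes a :: real
  assumes a: "1 < a" "a < 2"
begin

text \<open>Replaces a contour shift by a differential equation: moving the angle multiplies the
  point \<open>cis \<theta>\<close> by i, so Euler's relation gives G' = i a G and hence
  \<open>G \<theta>\<close> = \<open>cis (a * \<theta>) * G 0\<close>. At \<theta> = - pi / 2 the
  real exponential exp(- y) has become exp(i y). All angles in between keep Re z >= 0, where the
  exponential stays bounded.\<close>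

lemma iexp_remainder_powr_rotation:
  "(LBINT y:{0<..}. (exp (\<i> * y) - 1 - \<i> * y) / complex_of_real (y powr (1 + a))) =
     cis (- (a * pi / 2)) * complex_of_real (LBINT y:{0<..}. (exp (- y) - 1 + y) / y powr (1 + a))"
proof -
  define f where "f \<theta> y = (exp (- (cis \<theta> * y)) - 1 + cis \<theta> * complex_of_real y) / complex_of_real (y powr (1 + a))" for \<theta> y
  define G where "G \<theta> = (LBINT y:{0<..}. f \<theta> y)" for \<theta>
  let ?S = "{- (pi / 2)..0}"
  have Re: "Re (cis \<theta>) \<ge> 0" if "\<theta> \<in> ?S" for \<theta>
    using that by (auto intro!: cos_ge_zero)
  have G': "(G has_vector_derivative (\<i> * a * G \<theta>)) (at \<theta> within ?S)" if \<theta>: "\<theta> \<in> ?S" for \<theta>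
  proof -
    define f' where "f' \<theta> y = \<i> * (cis \<theta> * complex_of_real y * (1 - exp (- (cis \<theta> * y))) / complex_of_real (y powr (1 + a)))" for \<theta> y
    have "(G has_vector_derivative (LBINT y. indicator {0<..} y *\<^sub>R f' \<theta> y)) (at \<theta> within ?S)"
      unfolding G_def set_lebesgue_integral_def
    proof (rule has_vector_derivative_lebesgue_integral)
      show "integrable lborel (\<lambda>y. indicator {0<..} y *\<^sub>R f t y)" if "t \<in> ?S" for t
        using integrable_exp_remainder_powr[OF a Re[OF that]] unfolding set_integrable_def f_def .
      show "((\<lambda>t. indicator {0<..} y *\<^sub>R f t y) has_vector_derivative indicator {0<..} y *\<^sub>R f' t y) (at t within ?S)"
        if "t \<in> ?S" for t y
      proof (cases "y > 0")
        case True
        have c: "((\<lambda>t. cis t * complex_of_real y) has_vector_derivative \<i> * cis t * complex_of_real y) (at t within ?S)"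
        proof -
          have "((\<lambda>t. exp (\<i> * of_real t) * complex_of_real y) has_vector_derivative exp (\<i> * of_real t) * \<i> * complex_of_real y) (at t within ?S)"
            by (rule has_vector_derivative_real_field[where f = "\<lambda>w. exp (\<i> * w) * complex_of_real y"])
               (auto intro!: derivative_eq_intros)
          then show ?thesis by (simp add: cis_conv_exp mult_ac)
        qed
        have d: "((\<lambda>w. (exp (- w) - 1 + w) / complex_of_real (y powr (1 + a))) has_field_derivative
            (- exp (- (cis t * complex_of_real y)) + 1) / complex_of_real (y powr (1 + a)))
            (at (cis t * complex_of_real y) within X)" for X
          by (rule DERIV_cdivide) (auto intro!: derivative_eq_intros)
        have "((\<lambda>t. f t y) has_vector_derivative (\<i> * cis t * complex_of_real y * ((- exp (- (cis t * complex_of_real y)) + 1) / complex_of_real (y powr (1 + a))))) (at t within ?S)"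
          using field_vector_diff_chain_within[OF c d] unfolding f_def comp_def .
        moreover have "\<i> * cis t * complex_of_real y * ((- exp (- (cis t * complex_of_real y)) + 1) / complex_of_real (y powr (1 + a))) = f' t y"
          unfolding f'_def by simp
        ultimately show ?thesis using True by simp
      qed simp
      show "(\<lambda>y. indicator {0<..} y *\<^sub>R f' \<theta> y) \<in> borel_measurable lborel"
        unfolding f'_def by measurable
      show "norm (indicator {0<..} y *\<^sub>R f' t y) \<le> indicator {0<..} y *\<^sub>R (2 * (min y (y\<^sup>2) / y powr (1 + a)))"
        if "t \<in> ?S" for t y
      proof (cases "y > 0")
        case True
        have "norm (1 - exp (- (cis t * y))) \<le> y"
          using norm_exp_minus_1_le[of "- (cis t * y)"] Re[OF that] True by (simp add: norm_mult norm_minus_commute)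
        moreover have "norm (1 - exp (- (cis t * y))) \<le> 2"
          by (rule order_trans[OF norm_triangle_ineq4]) (use Re[OF that] True in simp)
        ultimately have "norm (1 - exp (- (cis t * y))) \<le> 2 * min 1 y" using True by auto
        then have "y * norm (1 - exp (- (cis t * y))) \<le> y * (2 * min 1 y)"
          using True by (intro mult_left_mono) auto
        also have "y * (2 * min 1 y) = 2 * min y (y\<^sup>2)"
          using True by (auto simp: min_def power2_eq_square)
        finally show ?thesis
          using True unfolding f'_def by (simp add: norm_mult norm_divide divide_right_mono)
      qed simp
      show "integrable lborel (\<lambda>y. indicator {0<..} y *\<^sub>R (2 * (min y (y\<^sup>2) / y powr (1 + a))))"
        using set_integrable_mult_right[OF integrable_powr_cutoff[OF a], of 2] unfolding set_integrable_def .
    qed (use \<theta> in auto)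
    also have "(LBINT y. indicator {0<..} y *\<^sub>R f' \<theta> y) = (LBINT y:{0<..}. f' \<theta> y)"
      by (simp add: set_lebesgue_integral_def)
    also have "\<dots> = \<i> * (a * G \<theta>)"
      unfolding f'_def set_integral_mult_right G_def f_def
      by (simp only: exp_remainder_powr_by_parts(2)[OF a Re[OF \<theta>]])
    finally show ?thesis by (simp add: mult_ac)
  qed
  have "cis (- a * 0) * G 0 = cis (- a * (- (pi / 2))) * G (- (pi / 2))"
  proof (rule has_derivative_zero_unique[where f = "\<lambda>\<theta>. cis (- a * \<theta>) * G \<theta>" and s = ?S])
    fix \<theta> assume \<theta>: "\<theta> \<in> ?S"
    have "((\<lambda>t. exp (- (\<i> * a) * of_real t)) has_vector_derivative exp (- (\<i> * a) * of_real \<theta>) * (- (\<i> * a))) (at \<theta> within ?S)"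
      by (rule has_vector_derivative_real_field[where f = "\<lambda>w. exp (- (\<i> * a) * w)"])
         (auto intro!: derivative_eq_intros)
    then have "((\<lambda>t. cis (- a * t)) has_vector_derivative cis (- a * \<theta>) * (- (\<i> * a))) (at \<theta> within ?S)"
      by (simp add: cis_conv_exp mult_ac)
    from has_vector_derivative_mult[OF this G'[OF \<theta>]]
    have "((\<lambda>t. cis (- a * t) * G t) has_vector_derivative 0) (at \<theta> within ?S)"
      by (simp add: algebra_simps)
    then show "((\<lambda>t. cis (- a * t) * G t) has_derivative (\<lambda>h. 0)) (at \<theta> within ?S)"
      by (simp add: has_vector_derivative_def)
  qed auto
  then have "cis (- (a * pi / 2)) * G 0 = cis (- (a * pi / 2)) * (cis (a * pi / 2) * G (- (pi / 2)))"
    by simp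
  also have "\<dots> = G (- (pi / 2))"
    by (simp only: mult.assoc[symmetric] cis_mult) simp
  also have "\<dots> = (LBINT y:{0<..}. (exp (\<i> * y) - 1 - \<i> * y) / complex_of_real (y powr (1 + a)))"
  proof -
    have "cis (- (pi / 2)) = - \<i>" by (simp add: complex_eq_iff)
    then show ?thesis by (simp add: G_def f_def)
  qed
  also have "G 0 = complex_of_real (LBINT y:{0<..}. (exp (- y) - 1 + y) / y powr (1 + a))"
    unfolding G_def f_def set_integral_complex_of_real[symmetric]
    by (simp add: exp_of_real flip: of_real_minus)
  finally show ?thesis by simp
qed

text \<open>By the rotation the integral is a real number g times
  \<open>cis (- (a * pi / 2))\<close>. Comparing real parts gives D = - cos(a pi / 2) g for the
  cosine integral D, which eliminates g; the quotient of sine and cosine left over is the tangent.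
  The cosine is negative because a pi / 2 lies between pi / 2 and pi.\<close>

lemma cos_integral_powr_pos: "(LBINT y:{0<..}. (1 - cos y) / y powr (1 + a)) > 0"
  and iexp_remainder_powr_integral:
  "(LBINT y:{0<..}. (exp (\<i> * y) - 1 - \<i> * y) / complex_of_real (y powr (1 + a))) =
     - complex_of_real (LBINT y:{0<..}. (1 - cos y) / y powr (1 + a)) * (1 - \<i> * tan (pi * a / 2))"
proof -
  let ?J = "LBINT y:{0<..}. (exp (\<i> * y) - 1 - \<i> * y) / complex_of_real (y powr (1 + a))"
  let ?D = "LBINT y:{0<..}. (1 - cos y) / y powr (1 + a)"
  define g where "g = (LBINT y:{0<..}. (exp (- y) - 1 + y) / y powr (1 + a))"
  have int: "integrable lborel (\<lambda>y. indicator {0<..} y *\<^sub>R ((exp (\<i> * y) - 1 - \<i> * y) / complex_of_real (y powr (1 + a))))"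
    using integrable_exp_remainder_powr[OF a, of "- \<i>"] by (simp add: set_integrable_def)
  have Re_eq: "Re (indicator {0<..} y *\<^sub>R ((exp (\<i> * y) - 1 - \<i> * y) / complex_of_real (y powr (1 + a))))
     = - (indicator {0<..} y *\<^sub>R ((1 - cos y) / y powr (1 + a)))" for y
    by (simp add: Re_exp diff_divide_distrib algebra_simps)
  have Dint: "integrable lborel (\<lambda>y. indicator {0<..} y *\<^sub>R ((1 - cos y) / y powr (1 + a)))"
    using integrable_Re[OF int] unfolding Re_eq by simp
  have ReJ: "Re ?J = - ?D"
    unfolding set_lebesgue_integral_def integral_Re[OF int, symmetric] Re_eq by simp
  have J: "?J = cis (- (a * pi / 2)) * complex_of_real g"
    unfolding g_def by (rule iexp_remainder_powr_rotation)
  have c: "cos (a * pi / 2) < 0"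
  proof -
    have "cos (a * pi / 2) < cos (pi / 2)"
      using a by (intro cos_monotone_0_pi) auto
    then show ?thesis by simp
  qed
  have D: "?D = - cos (a * pi / 2) * g" using ReJ J by simp
  have "?J = complex_of_real g * (cos (a * pi / 2) - \<i> * sin (a * pi / 2))"
    unfolding J by (simp add: complex_eq_iff)
  also have "sin (a * pi / 2) = cos (a * pi / 2) * tan (pi * a / 2)"
    using c by (simp add: tan_def mult.commute)
  finally show "?J = - complex_of_real ?D * (1 - \<i> * tan (pi * a / 2))"
    unfolding D by (simp add: algebra_simps)
  have nonneg: "0 \<le> indicator {0<..} y *\<^sub>R ((1 - cos y) / y powr (1 + a))" for y :: real
    by (simp add: indicator_def)
  have "?D \<noteq> 0"
  proof
    assume "?D = 0"
    then have "AE y in lborel. indicator {0<..} y *\<^sub>R ((1 - cos y) / y powr (1 + a)) = 0"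
      unfolding set_lebesgue_integral_def
      by (subst (asm) integral_nonneg_eq_0_iff_AE[OF Dint]) (use nonneg in auto)
    \<comment> \<open>The integrand is strictly positive on \<open>{0<..1}\<close>, a set of measure
      1, so it cannot vanish almost everywhere.\<close>
    then have "AE y in lborel. y \<notin> {0<..1::real}"
    proof eventually_elim
      case (elim y)
      show ?case
      proof
        assume y: "y \<in> {0<..1}"
        then have "cos y < cos 0" using pi_gt3 by (intro cos_monotone_0_pi) auto
        then show False using elim y by auto
      qed
    qed
    then have "{0<..1::real} \<in> null_sets lborel"
      by (simp add: AE_iff_null_sets)
    then show False by (simp add: null_sets_def)
  qed
  moreover have "?D \<ge> 0"
    unfolding set_lebesgue_integral_def by (rule integral_nonneg_AE) (use nonneg in auto)
  ultimately show "?D > 0" by simp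
qed

end

section \<open>The stable generator on exponentials\<close>

text \<open>Levy density of Z without the factor \<open>d_const \<alpha>\<close>.\<close>

definition stable_kernel :: "real \<Rightarrow> real \<Rightarrow> real \<Rightarrow> real" where
  "stable_kernel \<alpha> \<beta> u =
     ((1 + \<beta>) * indicator {0<..} u + (1 - \<beta>) * indicator {..<0} u) / (2 * \<bar>u\<bar> powr (1 + \<alpha>))"

definition stable_exponent :: "real \<Rightarrow> real \<Rightarrow> real \<Rightarrow> complex" where
  "stable_exponent \<alpha> \<beta> k =
     - complex_of_real (\<bar>k\<bar> powr \<alpha>) * (1 - \<i> * complex_of_real (\<beta> * sgn k * tan (pi * \<alpha> / 2)))"

lemma stable_cf_eq_exp: "stable_cf \<alpha> 1 \<beta> t = exp (stable_exponent \<alpha> \<beta> t)"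
  by (simp add: stable_cf_def stable_exponent_def)

lemma stable_exponent_0 [simp]: "stable_exponent \<alpha> \<beta> 0 = 0"
  by (simp add: stable_exponent_def)

text \<open>Homogeneity of degree \<alpha> is the analytic form of strict stability; both the Stein
  equation and the law of r x + c_r Z rest on it.\<close>

lemma stable_exponent_scale:
  "r \<ge> 0 \<Longrightarrow> stable_exponent \<alpha> \<beta> (s * r) = complex_of_real (r powr \<alpha>) * stable_exponent \<alpha> \<beta> s"
  by (cases "r = 0") (auto simp: stable_exponent_def abs_mult powr_mult sgn_mult)

lemma borel_measurable_stable_kernel [measurable]: "stable_kernel \<alpha> \<beta> \<in> borel_measurable borel"
  unfolding stable_kernel_def by measurable

context
  fixes \<alpha> \<beta> :: real
  assumes \<alpha>: "1 < \<alpha>" "\<alpha> < 2"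
begin

text \<open>The substitution y = k u moves the frequency out as k powr \<alpha>. It keeps the half
  line only for k > 0; negative frequencies follow later by conjugation.\<close>

lemma iexp_remainder_powr_scaled:
  assumes "k > 0"
  shows "(LBINT u:{0<..}. (exp (\<i> * (k * u)) - 1 - \<i> * (k * u)) / complex_of_real (u powr (1 + \<alpha>))) =
    - complex_of_real (k powr \<alpha> * (LBINT y:{0<..}. (1 - cos y) / y powr (1 + \<alpha>))) * (1 - \<i> * tan (pi * \<alpha> / 2))"
proof -
  let ?f = "\<lambda>y. indicator {0<..} y *\<^sub>R ((exp (\<i> * y) - 1 - \<i> * y) / complex_of_real (y powr (1 + \<alpha>)))"
  have eq: "?f (k * u) = complex_of_real (k powr (- \<alpha> - 1)) *
    (indicator {0<..} u *\<^sub>R ((exp (\<i> * (k * u)) - 1 - \<i> * (k * u)) / complex_of_real (u powr (1 + \<alpha>))))" for u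
  proof (cases "u > 0")
    case True
    have "k powr (- \<alpha> - 1) = inverse (k powr (1 + \<alpha>))"
    proof -
      have "- \<alpha> - 1 = - (1 + \<alpha>)" by simp
      then show ?thesis by (simp only: powr_minus)
    qed
    then show ?thesis using assms True by (simp add: powr_mult divide_inverse)
  qed (use assms in \<open>simp add: zero_less_mult_iff\<close>)
  have "(LBINT y. ?f y) = \<bar>k\<bar> *\<^sub>R (LBINT u. ?f (0 + k * u))"
    using assms by (intro lborel_integral_real_affine) auto
  also have "(LBINT u. ?f (0 + k * u)) = complex_of_real (k powr (- \<alpha> - 1)) *
     (LBINT u:{0<..}. (exp (\<i> * (k * u)) - 1 - \<i> * (k * u)) / complex_of_real (u powr (1 + \<alpha>)))"
    unfolding add_0 eq set_lebesgue_integral_def by (rule integral_mult_right_zero)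
  finally have 1: "(LBINT y. ?f y) = complex_of_real (k * k powr (- \<alpha> - 1)) * 
     (LBINT u:{0<..}. (exp (\<i> * (k * u)) - 1 - \<i> * (k * u)) / complex_of_real (u powr (1 + \<alpha>)))"
    using assms by (simp add: scaleR_conv_of_real)
  have 2: "k * k powr (- \<alpha> - 1) = k powr - \<alpha>"
    using powr_mult_base[of k "- \<alpha> - 1"] assms by simp
  have 3: "k powr \<alpha> * k powr - \<alpha> = 1" using assms by (simp flip: powr_add)
  have "(LBINT u:{0<..}. (exp (\<i> * (k * u)) - 1 - \<i> * (k * u)) / complex_of_real (u powr (1 + \<alpha>)))
    = complex_of_real (k powr \<alpha>) * (LBINT y. ?f y)"
    unfolding 1 2 using 3 by (simp add: mult.assoc[symmetric] flip: of_real_mult)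
  also have "(LBINT y. ?f y) = - complex_of_real (LBINT y:{0<..}. (1 - cos y) / y powr (1 + \<alpha>)) * (1 - \<i> * tan (pi * \<alpha> / 2))"
    using iexp_remainder_powr_integral[OF \<alpha>] unfolding set_lebesgue_integral_def .
  finally show ?thesis by simp
qed

lemma integrable_stable_kernel_cutoff: "integrable lborel (\<lambda>u. min \<bar>u\<bar> (u\<^sup>2) * stable_kernel \<alpha> \<beta> u)"
proof -
  let ?f = "\<lambda>u::real. indicator {0<..} u *\<^sub>R (min u (u\<^sup>2) / u powr (1 + \<alpha>))"
  have f: "integrable lborel ?f"
    using integrable_powr_cutoff[OF \<alpha>] unfolding set_integrable_def .
  \<comment> \<open>The reflection is spelled \<open>0 + (- 1) * u\<close> to match the affine
    substitution rules for \<open>lborel\<close>; the same form recurs below.\<close>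
  have f': "integrable lborel (\<lambda>u. ?f (0 + (- 1) * u))"
    using f by (subst lborel_integrable_real_affine_iff) auto
  have "min \<bar>u\<bar> (u\<^sup>2) * stable_kernel \<alpha> \<beta> u = (1 + \<beta>) / 2 * ?f u + (1 - \<beta>) / 2 * ?f (0 + (- 1) * u)" for u
    by (auto simp: stable_kernel_def indicator_def)
  then show ?thesis
    by (simp only:) (intro Bochner_Integration.integrable_add integrable_mult_right f f')
qed

text \<open>The second part identifies the symbol of L. The negative half line contributes the
  positive one at frequency - k, that is, the complex conjugate. The weights (1 + \<beta>) / 2 and
  (1 - \<beta>) / 2 therefore keep the real part and multiply the imaginary part by \<beta>, and
  \<open>d_const\<close> normalises the real part.\<close>

lemma stable_kernel_iexp_integral:
  fixes k :: real
  shows "integrable lborel (\<lambda>u. (exp (\<i> * (k * u)) - 1 - \<i> * (k * u)) * complex_of_real (stable_kernel \<alpha> \<beta> u))"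
    and "d_const \<alpha> * (LBINT u. (exp (\<i> * (k * u)) - 1 - \<i> * (k * u)) * complex_of_real (stable_kernel \<alpha> \<beta> u))
      = stable_exponent \<alpha> \<beta> k"
proof -
  let ?f = "\<lambda>k u. indicator {0<..} u *\<^sub>R ((exp (\<i> * (complex_of_real k * complex_of_real u)) - 1 - \<i> * (complex_of_real k * complex_of_real u)) / complex_of_real (u powr (1 + \<alpha>)))"
  define D where "D = (LBINT y:{0<..}. (1 - cos y) / y powr (1 + \<alpha>))"
  have D: "D > 0" unfolding D_def by (rule cos_integral_powr_pos[OF \<alpha>])
  have f: "integrable lborel (?f k)" for k :: real
    using integrable_exp_remainder_powr[OF \<alpha>, of "- \<i> * complex_of_real k"] unfolding set_integrable_def
    by (simp add: mult.assoc)
  have f': "integrable lborel (\<lambda>u. ?f (- k) (0 + (- 1) * u))"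
    by (subst lborel_integrable_real_affine_iff[OF _, of "-1" "?f (- k)" 0]) (use f[of "- k"] in auto)
  have eq: "(exp (\<i> * (k * u)) - 1 - \<i> * (k * u)) * complex_of_real (stable_kernel \<alpha> \<beta> u) = 
     complex_of_real ((1 + \<beta>) / 2) * ?f k u + complex_of_real ((1 - \<beta>) / 2) * ?f (- k) (0 + (- 1) * u)" for u
    by (cases u "0 :: real" rule: linorder_cases) (auto simp: stable_kernel_def)
  show "integrable lborel (\<lambda>u. (exp (\<i> * (k * u)) - 1 - \<i> * (k * u)) * complex_of_real (stable_kernel \<alpha> \<beta> u))"
    unfolding eq by (intro Bochner_Integration.integrable_add integrable_mult_right f f')
  have cnj: "(LBINT u. ?f (- k) u) = cnj (LBINT u. ?f k u)" for k
  proof -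
    have "?f (- k) u = cnj (?f k u)" for u by (simp add: exp_cnj)
    then show ?thesis by (simp only:) (rule Bochner_Integration.integral_cnj)
  qed
  have "(LBINT u. (exp (\<i> * (k * u)) - 1 - \<i> * (k * u)) * complex_of_real (stable_kernel \<alpha> \<beta> u)) = 
     complex_of_real ((1 + \<beta>) / 2) * (LBINT u. ?f k u) + complex_of_real ((1 - \<beta>) / 2) * (LBINT u. ?f (- k) (0 + (- 1) * u))"
    unfolding eq by (subst Bochner_Integration.integral_add[OF integrable_mult_right[OF f] integrable_mult_right[OF f']]) 
      (simp only: integral_mult_right_zero)
  also have "(LBINT u. ?f (- k) (0 + (- 1) * u)) = (LBINT u. ?f (- k) u)"
    by (subst lborel_integral_real_affine[of "-1" "?f (- k)" 0]) auto
  also have "complex_of_real ((1 + \<beta>) / 2) * (LBINT u. ?f k u) + complex_of_real ((1 - \<beta>) / 2) * (LBINT u. ?f (- k) u)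
    = complex_of_real D * stable_exponent \<alpha> \<beta> k"
  proof -
    have pos: "(LBINT u. ?f k u) = - complex_of_real (k powr \<alpha> * D) * (1 - \<i> * tan (pi * \<alpha> / 2))" if "k > 0" for k
      using iexp_remainder_powr_scaled[OF that] unfolding set_lebesgue_integral_def D_def .
    have "k < 0 \<or> k = 0 \<or> k > 0" by linarith
    then show ?thesis
    proof (elim disjE)
      assume k: "k > 0"
      show ?thesis
        unfolding cnj pos[OF k] using k by (simp add: stable_exponent_def complex_eq_iff field_simps)
    next
      assume k: "k < 0"
      then have k': "- k > 0" by simp
      have "(LBINT u. ?f k u) = cnj (LBINT u. ?f (- k) u)"
        using cnj[of "- k"] by simp
      then show ?thesis
        unfolding pos[OF k'] using k by (simp add: stable_exponent_def complex_eq_iff field_simps)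
    qed (simp add: stable_exponent_def)
  qed
  finally show "d_const \<alpha> * (LBINT u. (exp (\<i> * (k * u)) - 1 - \<i> * (k * u)) * complex_of_real (stable_kernel \<alpha> \<beta> u))
      = stable_exponent \<alpha> \<beta> k"
    using D by (simp add: d_const_def D_def[symmetric])
qed

end

section \<open>The Stein equation for exponentials\<close>

lemma set_integrable_bounded_measurable:
  fixes f :: "real \<Rightarrow> complex"
  assumes [measurable]: "f \<in> borel_measurable borel" and "\<And>r. 0 < r \<Longrightarrow> r < 1 \<Longrightarrow> norm (f r) \<le> B"
  shows "set_integrable lborel {0<..<1} f"
proof (rule set_integrable_bound)
  show "set_integrable lborel {0<..<1::real} (\<lambda>_. B)"
    by (simp add: set_integrable_def)
  have "norm (f r) \<le> norm B" if "0 < r" "r < 1" for r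
    using assms(2)[OF that] unfolding real_norm_def by linarith
  then show "AE r in lborel. r \<in> {0<..<1} \<longrightarrow> norm (f r) \<le> norm B" by simp
qed (simp add: set_borel_measurable_def)

text \<open>Characteristic function at s of c_r Z, where c_r powr \<alpha> = 1 - r powr
  \<alpha>.\<close>

definition ou_factor :: "real \<Rightarrow> real \<Rightarrow> real \<Rightarrow> real \<Rightarrow> complex" where
  "ou_factor \<alpha> \<beta> s r = exp (complex_of_real (1 - r powr \<alpha>) * stable_exponent \<alpha> \<beta> s)"

definition stein_exp :: "real \<Rightarrow> real \<Rightarrow> real \<Rightarrow> real \<Rightarrow> complex" where
  "stein_exp \<alpha> \<beta> s x = - \<alpha> * (LBINT r:{0<..<1}. (iexp (s * r * x) - 1) / r * ou_factor \<alpha> \<beta> s r)"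

definition stein_exp' :: "real \<Rightarrow> real \<Rightarrow> real \<Rightarrow> real \<Rightarrow> complex" where
  "stein_exp' \<alpha> \<beta> s x = - \<alpha> * (LBINT r:{0<..<1}. iexp (s * r * x) * (\<i> * s * ou_factor \<alpha> \<beta> s r))"

text \<open>The coefficient stays nested because this is literally what
  \<open>has_vector_derivative_iexp_integral\<close> produces from
  \<open>stein_exp'\<close>.\<close>

definition stein_exp'' :: "real \<Rightarrow> real \<Rightarrow> real \<Rightarrow> real \<Rightarrow> complex" where
  "stein_exp'' \<alpha> \<beta> s x = - \<alpha> * (LBINT r:{0<..<1}. iexp (s * r * x) * (\<i> * s * r * (\<i> * s * ou_factor \<alpha> \<beta> s r)))"

lemma has_vector_derivative_iexp:
  "((\<lambda>x. iexp (c * x)) has_vector_derivative \<i> * c * iexp (c * x)) (at x within S)"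
proof -
  have "((\<lambda>x. exp (\<i> * c * of_real x)) has_vector_derivative exp (\<i> * c * of_real x) * (\<i> * c)) (at x within S)"
    by (rule has_vector_derivative_real_field[where f = "\<lambda>w. exp (\<i> * c * w)"]) (auto intro!: derivative_eq_intros)
  then show ?thesis by (simp add: mult_ac)
qed

lemma Re_stable_exponent_nonpos: "Re (stable_exponent \<alpha> \<beta> s) \<le> 0"
  by (simp add: stable_exponent_def)

lemma borel_measurable_ou_factor [measurable]: "ou_factor \<alpha> \<beta> s \<in> borel_measurable borel"
  unfolding ou_factor_def by measurable

lemma norm_ou_factor_le:
  assumes "0 < \<alpha>" "0 < r" "r < 1"
  shows "norm (ou_factor \<alpha> \<beta> s r) \<le> 1"
proof -
  have "r powr \<alpha> \<le> 1 powr \<alpha>" using assms by (intro powr_mono2) auto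
  then show ?thesis
    using Re_stable_exponent_nonpos[of \<alpha> \<beta> s] by (simp add: ou_factor_def mult_nonneg_nonpos)
qed

lemma norm_mult_ou_factor_le:
  assumes "0 < \<alpha>" "0 < r" "r < 1" "norm z \<le> B"
  shows "norm (z * ou_factor \<alpha> \<beta> s r) \<le> B"
proof -
  have "norm z * norm (ou_factor \<alpha> \<beta> s r) \<le> B * 1"
    by (intro mult_mono norm_ou_factor_le assms norm_ge_zero order_trans[OF norm_ge_zero assms(4)])
  then show ?thesis by (simp add: norm_mult)
qed

lemma norm_iexp_minus_1_le: "norm (iexp t - 1) \<le> \<bar>t\<bar>"
  using norm_exp_minus_1_le[of "\<i> * complex_of_real t"] by (simp add: norm_mult)

lemma norm_iexp_mult: "norm (iexp t * z) = norm z"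
  by (simp add: norm_mult)

text \<open>Each differentiation brings down i s r, bounded by |s| on (0, 1), so the same statement
  can be applied again to its own result.\<close>

lemma has_vector_derivative_iexp_integral:
  fixes s :: real
  assumes [measurable]: "g \<in> borel_measurable borel" and g: "\<And>r. 0 < r \<Longrightarrow> r < 1 \<Longrightarrow> norm (g r) \<le> B"
  shows "((\<lambda>x. LBINT r:{0<..<1}. iexp (s * r * x) * g r) has_vector_derivative
      (LBINT r:{0<..<1}. iexp (s * r * x) * (\<i> * s * r * g r))) (at x)"
proof -
  let ?f = "\<lambda>x r. indicator {0<..<1} r *\<^sub>R (iexp (s * r * x) * g r)"
  let ?f' = "\<lambda>x r. indicator {0<..<1} r *\<^sub>R (iexp (s * r * x) * (\<i> * s * r * g r))"
  have "((\<lambda>x. LBINT r. ?f x r) has_vector_derivative (LBINT r. ?f' x r)) (at x within UNIV)"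
  proof (rule has_vector_derivative_lebesgue_integral[where w = "\<lambda>r. indicator {0<..<1} r *\<^sub>R (\<bar>s\<bar> * B)"])
    have "set_integrable lborel {0<..<1} (\<lambda>r. iexp (s * r * t) * g r)" for t
      by (rule set_integrable_bounded_measurable[where B = B]) (use g in \<open>auto simp: norm_mult\<close>)
    then show "integrable lborel (?f t)" for t
      unfolding set_integrable_def .
    show "((\<lambda>t. ?f t r) has_vector_derivative ?f' t r) (at t within UNIV)" for t r
    proof (cases "r \<in> {0<..<1}")
      case True
      from has_vector_derivative_mult_left[OF has_vector_derivative_iexp[of "s * r" t UNIV], of "g r"]
      show ?thesis using True by (simp add: mult_ac)
    qed simp
    show "?f' x \<in> borel_measurable lborel" by measurable
    show "norm (?f' t r) \<le> indicator {0<..<1} r *\<^sub>R (\<bar>s\<bar> * B)" for t r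
    proof (cases "r \<in> {0<..<1}")
      case True
      then have "r * norm (g r) \<le> 1 * B" using g by (intro mult_mono) auto
      then have "\<bar>s\<bar> * (r * norm (g r)) \<le> \<bar>s\<bar> * (1 * B)" by (rule mult_left_mono) simp
      then show ?thesis using True by (simp add: norm_mult mult.assoc)
    qed simp
  qed auto
  then show ?thesis unfolding set_lebesgue_integral_def by simp
qed

context
  fixes \<alpha> \<beta> s :: real
  assumes \<alpha>: "1 < \<alpha>" "\<alpha> < 2"
begin

lemma norm_stein_coeff_le:
  assumes "0 < r" "r < 1"
  shows "norm (\<i> * s * r * (\<i> * s * ou_factor \<alpha> \<beta> s r)) \<le> \<bar>s\<bar> * \<bar>s\<bar>"
proof -
  have "norm (\<i> * s * r * (\<i> * s)) = r * (\<bar>s\<bar> * \<bar>s\<bar>)" using assms by (simp add: norm_mult)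
  also have "\<dots> \<le> \<bar>s\<bar> * \<bar>s\<bar>" using assms by (intro mult_left_le_one_le) auto
  finally have "norm (\<i> * s * r * (\<i> * s) * ou_factor \<alpha> \<beta> s r) \<le> \<bar>s\<bar> * \<bar>s\<bar>"
    using \<alpha> assms by (intro norm_mult_ou_factor_le) auto
  then show ?thesis by (simp only: mult.assoc)
qed

lemma stein_exp_integrable:
  "set_integrable lborel {0<..<1} (\<lambda>r. (iexp (s * r * x) - 1) / r * ou_factor \<alpha> \<beta> s r)"
  "set_integrable lborel {0<..<1} (\<lambda>r. iexp (s * r * x) * (\<i> * s * ou_factor \<alpha> \<beta> s r))"
  "set_integrable lborel {0<..<1} (\<lambda>r. iexp (s * r * x) * (\<i> * s * r * (\<i> * s * ou_factor \<alpha> \<beta> s r)))"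
proof -
  have "norm ((iexp (s * r * x) - 1) / complex_of_real r) \<le> \<bar>s\<bar> * \<bar>x\<bar>" if "0 < r" "r < 1" for r
    using norm_iexp_minus_1_le[of "s * r * x"] that by (simp add: norm_divide divide_simps abs_mult mult_ac)
  then show "set_integrable lborel {0<..<1} (\<lambda>r. (iexp (s * r * x) - 1) / r * ou_factor \<alpha> \<beta> s r)"
    using \<alpha> by (intro set_integrable_bounded_measurable norm_mult_ou_factor_le) auto
  have "norm (\<i> * s * ou_factor \<alpha> \<beta> s r) \<le> \<bar>s\<bar>" if "0 < r" "r < 1" for r
    using \<alpha> that by (intro norm_mult_ou_factor_le) (auto simp: norm_mult)
  then show "set_integrable lborel {0<..<1} (\<lambda>r. iexp (s * r * x) * (\<i> * s * ou_factor \<alpha> \<beta> s r))"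
    by (intro set_integrable_bounded_measurable[where B = "\<bar>s\<bar>"]) (simp_all add: norm_mult)
  show "set_integrable lborel {0<..<1} (\<lambda>r. iexp (s * r * x) * (\<i> * s * r * (\<i> * s * ou_factor \<alpha> \<beta> s r)))"
    by (intro set_integrable_bounded_measurable[where B = "\<bar>s\<bar> * \<bar>s\<bar>"]) (simp_all only: norm_iexp_mult norm_stein_coeff_le, measurable)
qed

text \<open>Kept apart from the higher derivatives because of the factor 1 / r: it cancels against
  the r that differentiation brings down, and |exp(i t) - 1| <= |t| keeps the original integrand
  bounded near r = 0.\<close>

lemma has_vector_derivative_stein_exp:
  "(stein_exp \<alpha> \<beta> s has_vector_derivative stein_exp' \<alpha> \<beta> s x) (at x)"
proof -
  let ?f = "\<lambda>x r. indicator {0<..<1} r *\<^sub>R ((iexp (s * r * x) - 1) / complex_of_real r * ou_factor \<alpha> \<beta> s r)"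
  let ?f' = "\<lambda>x r. indicator {0<..<1} r *\<^sub>R (iexp (s * r * x) * (\<i> * s * ou_factor \<alpha> \<beta> s r))"
  have "((\<lambda>x. LBINT r. ?f x r) has_vector_derivative (LBINT r. ?f' x r)) (at x within UNIV)"
  proof (rule has_vector_derivative_lebesgue_integral[where w = "\<lambda>r. indicator {0<..<1} r *\<^sub>R \<bar>s\<bar>"])
    show "integrable lborel (?f t)" for t
      using stein_exp_integrable(1) unfolding set_integrable_def .
    show "((\<lambda>t. ?f t r) has_vector_derivative ?f' t r) (at t within UNIV)" for t r
    proof (cases "r \<in> {0<..<1}")
      case True
      have "((\<lambda>t. iexp (s * r * t) - 1) has_vector_derivative (\<i> * (s * r) * iexp (s * r * t))) (at t within UNIV)"
        using has_vector_derivative_diff[OF has_vector_derivative_iexp[of "s * r" t] has_vector_derivative_const] by simp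
      from has_vector_derivative_mult_left[OF this, of "inverse (complex_of_real r) * ou_factor \<alpha> \<beta> s r"]
      show ?thesis using True by (simp add: field_simps)
    qed simp
    show "?f' x \<in> borel_measurable lborel" by measurable
    show "norm (?f' t r) \<le> indicator {0<..<1} r *\<^sub>R \<bar>s\<bar>" for t r
      using \<alpha> norm_mult_ou_factor_le[of \<alpha> r "\<i> * s * iexp (s * r * t)" "\<bar>s\<bar>" \<beta> s]
      by (cases "r \<in> {0<..<1}") (auto simp: norm_mult)
  qed auto
  then have "((\<lambda>x. - complex_of_real \<alpha> * (LBINT r. ?f x r)) has_vector_derivative - complex_of_real \<alpha> * (LBINT r. ?f' x r)) (at x)"
    by (rule has_vector_derivative_mult_right)
  then show ?thesis
    unfolding stein_exp_def stein_exp'_def set_lebesgue_integral_def .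
qed

lemma has_vector_derivative_stein_exp':
  "(stein_exp' \<alpha> \<beta> s has_vector_derivative stein_exp'' \<alpha> \<beta> s x) (at x)"
  unfolding stein_exp''_def stein_exp'_def
proof (intro has_vector_derivative_mult_right has_vector_derivative_iexp_integral)
  show "norm (\<i> * s * ou_factor \<alpha> \<beta> s r) \<le> \<bar>s\<bar>" if "0 < r" "r < 1" for r
    using \<alpha> that by (intro norm_mult_ou_factor_le) (auto simp: norm_mult)
qed measurable

text \<open>Continuity is read off a third derivative, which exists by the same argument as the
  second.\<close>

lemma continuous_stein_exp'': "continuous_on UNIV (stein_exp'' \<alpha> \<beta> s)"
proof -
  have "isCont (stein_exp'' \<alpha> \<beta> s) x" for x
    unfolding stein_exp''_def
  proof (rule has_vector_derivative_continuous, rule has_vector_derivative_mult_right)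
    show "((\<lambda>x. LBINT r:{0<..<1}. iexp (s * r * x) * (\<i> * s * r * (\<i> * s * ou_factor \<alpha> \<beta> s r))) has_vector_derivative
      (LBINT r:{0<..<1}. iexp (s * r * x) * (\<i> * s * r * (\<i> * s * r * (\<i> * s * ou_factor \<alpha> \<beta> s r))))) (at x)"
      by (rule has_vector_derivative_iexp_integral[OF _ norm_stein_coeff_le]) measurable
  qed
  then show ?thesis by (simp add: continuous_on_eq_continuous_at)
qed

text \<open>The two ends of the semigroup for h(x) = exp(i s x): r to 0 gives E h(Z), r to 1 gives
  h(x). Their difference is the right hand side of the Stein equation.\<close>

lemma ou_factor_endpoints:
  "((\<lambda>r. iexp (s * r * x) * ou_factor \<alpha> \<beta> s r) \<longlongrightarrow> exp (stable_exponent \<alpha> \<beta> s)) (at_right 0)"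
  "((\<lambda>r. iexp (s * r * x) * ou_factor \<alpha> \<beta> s r) \<longlongrightarrow> iexp (s * x)) (at_left 1)"
proof -
  have 0: "((\<lambda>r. r powr \<alpha>) \<longlongrightarrow> 0) (at_right 0)"
    using \<alpha> by (intro tendsto_zero_powrI[where b = \<alpha>]) (auto simp: eventually_at_filter)
  have "((\<lambda>r. iexp (s * r * x) * ou_factor \<alpha> \<beta> s r) \<longlongrightarrow> iexp (s * 0 * x) * exp (complex_of_real (1 - 0) * stable_exponent \<alpha> \<beta> s)) (at_right 0)"
    unfolding ou_factor_def by (intro tendsto_intros 0)
  then show "((\<lambda>r. iexp (s * r * x) * ou_factor \<alpha> \<beta> s r) \<longlongrightarrow> exp (stable_exponent \<alpha> \<beta> s)) (at_right 0)" by simp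
  have "((\<lambda>r. iexp (s * r * x) * ou_factor \<alpha> \<beta> s r) \<longlongrightarrow> iexp (s * 1 * x) * exp (complex_of_real (1 - 1 powr \<alpha>) * stable_exponent \<alpha> \<beta> s)) (at_left 1)"
    unfolding ou_factor_def by (intro tendsto_intros) auto
  then show "((\<lambda>r. iexp (s * r * x) * ou_factor \<alpha> \<beta> s r) \<longlongrightarrow> iexp (s * x)) (at_left 1)" by simp
qed

text \<open>Fundamental theorem of calculus for r between 0 and 1 applied to E h(r x + c_r Z). The
  first integral, times x, is the drift part - x \<phi>'(x) / \<alpha>; the second, times -
  \<alpha>, is what \<open>stein_exp_equation\<close> recognises as the generator part.\<close>

lemma ou_factor_ftc:
  "set_integrable lborel {0<..<1} (\<lambda>r. complex_of_real (r powr (\<alpha> - 1)) * stable_exponent \<alpha> \<beta> s * iexp (s * r * x) * ou_factor \<alpha> \<beta> s r)" (is "set_integrable _ _ ?g")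
  "(LBINT r:{0<..<1}. iexp (s * r * x) * (\<i> * s * ou_factor \<alpha> \<beta> s r)) * x
   - \<alpha> * (LBINT r:{0<..<1}. complex_of_real (r powr (\<alpha> - 1)) * stable_exponent \<alpha> \<beta> s * iexp (s * r * x) * ou_factor \<alpha> \<beta> s r)
   = iexp (s * x) - exp (stable_exponent \<alpha> \<beta> s)"
proof -
  let ?f = "\<lambda>r. iexp (s * r * x) * (\<i> * s * ou_factor \<alpha> \<beta> s r)"
  have "norm (complex_of_real (r powr (\<alpha> - 1)) * stable_exponent \<alpha> \<beta> s * iexp (s * r * x)) \<le> norm (stable_exponent \<alpha> \<beta> s)"
    if "0 < r" "r < 1" for r
  proof -
    have "r powr (\<alpha> - 1) \<le> 1 powr (\<alpha> - 1)" using that \<alpha> by (intro powr_mono2) auto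
    then show ?thesis by (simp add: norm_mult mult_left_le_one_le)
  qed
  then show g: "set_integrable lborel {0<..<1} ?g"
    using \<alpha> by (intro set_integrable_bounded_measurable norm_mult_ou_factor_le) auto
  note f = stein_exp_integrable(2)[of x]
  have fg: "set_integrable lborel {0<..<1} (\<lambda>r. ?f r * x - \<alpha> * ?g r)"
    by (rule set_integral_diff(1)[OF set_integrable_mult_left[OF f] set_integrable_mult_right[OF g]])
  have "(LBINT r=ereal 0..ereal 1. ?f r * x - \<alpha> * ?g r) = iexp (s * x) - exp (stable_exponent \<alpha> \<beta> s)"
  proof (rule interval_integral_FTC_integrable[where F = "\<lambda>r. iexp (s * r * x) * ou_factor \<alpha> \<beta> s r"])
    show "((\<lambda>r. iexp (s * r * x) * ou_factor \<alpha> \<beta> s r) has_vector_derivative ?f r * x - \<alpha> * ?g r) (at r)"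
      if r: "ereal 0 < ereal r" for r
    proof -
      have 1: "((\<lambda>r. iexp (s * r * x)) has_vector_derivative \<i> * (s * x) * iexp (s * r * x)) (at r)"
        using has_vector_derivative_iexp[of "s * x" r UNIV] by (simp add: mult_ac)
      have "((\<lambda>r. 1 - r powr \<alpha>) has_real_derivative - (\<alpha> * r powr (\<alpha> - 1))) (at r)"
        using r by (auto intro!: derivative_eq_intros)
      then have "((\<lambda>r. complex_of_real (1 - r powr \<alpha>)) has_vector_derivative complex_of_real (- (\<alpha> * r powr (\<alpha> - 1)))) (at r)"
        by (intro has_vector_derivative_of_real) (simp add: has_real_derivative_iff_has_vector_derivative)
      moreover have "((\<lambda>w. exp (w * stable_exponent \<alpha> \<beta> s)) has_field_derivative
          exp (w * stable_exponent \<alpha> \<beta> s) * stable_exponent \<alpha> \<beta> s) (at w)" for w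
        by (auto intro!: derivative_eq_intros)
      ultimately have "(((\<lambda>w. exp (w * stable_exponent \<alpha> \<beta> s)) \<circ> (\<lambda>r. complex_of_real (1 - r powr \<alpha>))) has_vector_derivative
          complex_of_real (- (\<alpha> * r powr (\<alpha> - 1))) * (ou_factor \<alpha> \<beta> s r * stable_exponent \<alpha> \<beta> s)) (at r)"
        unfolding ou_factor_def by (rule field_vector_diff_chain_at)
      then have 2: "(ou_factor \<alpha> \<beta> s has_vector_derivative complex_of_real (- (\<alpha> * r powr (\<alpha> - 1))) * (ou_factor \<alpha> \<beta> s r * stable_exponent \<alpha> \<beta> s)) (at r)"
        unfolding ou_factor_def comp_def .
      from has_vector_derivative_mult[OF 1 2] show ?thesis by (simp add: algebra_simps)
    qed
    show "isCont (\<lambda>r. ?f r * x - \<alpha> * ?g r) r" if "ereal 0 < ereal r" for r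
      using that unfolding ou_factor_def by (intro continuous_intros) auto
    show "set_integrable lborel (einterval (ereal 0) (ereal 1)) (\<lambda>r. ?f r * x - \<alpha> * ?g r)"
      using fg unfolding einterval_eq .
    show "(((\<lambda>r. iexp (s * r * x) * ou_factor \<alpha> \<beta> s r) \<circ> real_of_ereal) \<longlongrightarrow> exp (stable_exponent \<alpha> \<beta> s)) (at_right (ereal 0))"
      using ou_factor_endpoints(1) by (simp only: ereal_tendsto_simps)
    show "(((\<lambda>r. iexp (s * r * x) * ou_factor \<alpha> \<beta> s r) \<circ> real_of_ereal) \<longlongrightarrow> iexp (s * x)) (at_left (ereal 1))"
      using ou_factor_endpoints(2) by (simp only: ereal_tendsto_simps)
  qed auto
  also have "(LBINT r=ereal 0..ereal 1. ?f r * x - \<alpha> * ?g r) = (LBINT r:{0<..<1}. ?f r * x - \<alpha> * ?g r)"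
    by (simp add: interval_lebesgue_integral_def)
  also have "\<dots> = (LBINT r:{0<..<1}. ?f r * x) - (LBINT r:{0<..<1}. \<alpha> * ?g r)"
    by (rule set_integral_diff(2)[OF set_integrable_mult_left[OF f] set_integrable_mult_right[OF g]])
  also have "\<dots> = (LBINT r:{0<..<1}. ?f r) * x - \<alpha> * (LBINT r:{0<..<1}. ?g r)"
    by (simp only: set_integral_mult_left set_integral_mult_right)
  finally show "(LBINT r:{0<..<1}. ?f r) * x - \<alpha> * (LBINT r:{0<..<1}. ?g r)
    = iexp (s * x) - exp (stable_exponent \<alpha> \<beta> s)" .
qed

text \<open>The three integrals are merged before integrating over u, since only their combination
  has the second-order cancellation at u = 0 that makes Fubini's theorem applicable.\<close>

lemma stein_exp_remainder:
  "stein_exp \<alpha> \<beta> s (u + x) - stein_exp \<alpha> \<beta> s x - u * stein_exp' \<alpha> \<beta> s x =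
    - complex_of_real \<alpha> * (LBINT r:{0<..<1}. iexp (s * r * x) * (exp (\<i> * (complex_of_real (s * r) * u)) - 1 - \<i> * (complex_of_real (s * r) * u)) / r * ou_factor \<alpha> \<beta> s r)"
proof -
  note I = stein_exp_integrable
  have "stein_exp \<alpha> \<beta> s (u + x) - stein_exp \<alpha> \<beta> s x - u * stein_exp' \<alpha> \<beta> s x = 
    - complex_of_real \<alpha> * ((LBINT r:{0<..<1}. (iexp (s * r * (u + x)) - 1) / r * ou_factor \<alpha> \<beta> s r) - (LBINT r:{0<..<1}. (iexp (s * r * x) - 1) / r * ou_factor \<alpha> \<beta> s r)
      - (LBINT r:{0<..<1}. u * (iexp (s * r * x) * (\<i> * s * ou_factor \<alpha> \<beta> s r))))"
    unfolding stein_exp_def stein_exp'_def set_integral_mult_right by (simp add: algebra_simps)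
  also have "(LBINT r:{0<..<1}. (iexp (s * r * (u + x)) - 1) / r * ou_factor \<alpha> \<beta> s r) - (LBINT r:{0<..<1}. (iexp (s * r * x) - 1) / r * ou_factor \<alpha> \<beta> s r)
      = (LBINT r:{0<..<1}. (iexp (s * r * (u + x)) - 1) / r * ou_factor \<alpha> \<beta> s r - (iexp (s * r * x) - 1) / r * ou_factor \<alpha> \<beta> s r)"
    by (rule set_integral_diff(2)[OF I(1) I(1), symmetric])
  also have "\<dots> - (LBINT r:{0<..<1}. u * (iexp (s * r * x) * (\<i> * s * ou_factor \<alpha> \<beta> s r))) = 
     (LBINT r:{0<..<1}. (iexp (s * r * (u + x)) - 1) / r * ou_factor \<alpha> \<beta> s r - (iexp (s * r * x) - 1) / r * ou_factor \<alpha> \<beta> s r - u * (iexp (s * r * x) * (\<i> * s * ou_factor \<alpha> \<beta> s r)))"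
    by (rule set_integral_diff(2)[OF set_integral_diff(1)[OF I(1) I(1)] set_integrable_mult_right[OF I(2)], symmetric])
  also have "\<dots> = (LBINT r:{0<..<1}. iexp (s * r * x) * (exp (\<i> * (complex_of_real (s * r) * u)) - 1 - \<i> * (complex_of_real (s * r) * u)) / r * ou_factor \<alpha> \<beta> s r)"
  proof (rule set_lebesgue_integral_cong)
    have e: "iexp (s * r * (u + x)) = iexp (s * r * x) * exp (\<i> * (complex_of_real (s * r) * u))" for r
      by (simp add: exp_add[symmetric] algebra_simps)
    show "\<forall>r. r \<in> {0<..<1} \<longrightarrow> (iexp (s * r * (u + x)) - 1) / r * ou_factor \<alpha> \<beta> s r - (iexp (s * r * x) - 1) / r * ou_factor \<alpha> \<beta> s r - u * (iexp (s * r * x) * (\<i> * s * ou_factor \<alpha> \<beta> s r))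
      = iexp (s * r * x) * (exp (\<i> * (complex_of_real (s * r) * u)) - 1 - \<i> * (complex_of_real (s * r) * u)) / r * ou_factor \<alpha> \<beta> s r"
      unfolding e by (auto simp: field_simps)
  qed simp
  finally show ?thesis .
qed

lemma stein_exp_equation:
  "integrable lborel (\<lambda>u. (stein_exp \<alpha> \<beta> s (u + x) - stein_exp \<alpha> \<beta> s x - u * stein_exp' \<alpha> \<beta> s x) * complex_of_real (stable_kernel \<alpha> \<beta> u))"
  "d_const \<alpha> * (LBINT u. (stein_exp \<alpha> \<beta> s (u + x) - stein_exp \<alpha> \<beta> s x - u * stein_exp' \<alpha> \<beta> s x) * complex_of_real (stable_kernel \<alpha> \<beta> u))
     - x * stein_exp' \<alpha> \<beta> s x / \<alpha> = iexp (s * x) - exp (stable_exponent \<alpha> \<beta> s)"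
proof -
  define Q where "Q r u = (exp (\<i> * (complex_of_real (s * r) * complex_of_real u)) - 1 - \<i> * (complex_of_real (s * r) * complex_of_real u))" for r u
  define H where "H r u = indicator {0<..<1} r *\<^sub>R (iexp (s * r * x) * Q r u / complex_of_real r * ou_factor \<alpha> \<beta> s r * complex_of_real (stable_kernel \<alpha> \<beta> u))" for r u
  define C where "C = 2 * \<bar>s\<bar> + s\<^sup>2"
  \<comment> \<open>Integrable majorant of \<open>H\<close> on the product space. The remainder
    bound carries a factor r in both regimes of the minimum, after weakening r squared to r in the
    quadratic one, and this pays for the 1 / r in \<open>H\<close>.\<close>
  define B where "B r u = indicator {0<..<1} r * (C * (min \<bar>u\<bar> (u\<^sup>2) * \<bar>stable_kernel \<alpha> \<beta> u\<bar>))" for r u :: real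
  have [measurable]: "(\<lambda>(r, u). H r u) \<in> borel_measurable (lborel \<Otimes>\<^sub>M lborel)" 
    unfolding H_def Q_def by measurable
  have [measurable]: "(\<lambda>(r, u). B r u) \<in> borel_measurable (lborel \<Otimes>\<^sub>M lborel)" 
    unfolding B_def by measurable
  have cut: "integrable lborel (\<lambda>u. min \<bar>u\<bar> (u\<^sup>2) * \<bar>stable_kernel \<alpha> \<beta> u\<bar>)"
    using integrable_abs[OF integrable_stable_kernel_cutoff[OF \<alpha>, of \<beta>]] by (simp add: abs_mult)
  have C: "C \<ge> 0" by (simp add: C_def)
  have B: "integrable (lborel \<Otimes>\<^sub>M lborel) (\<lambda>(r, u). B r u)"
  proof (rule lborel_pair.Fubini_integrable)
    have "integrable lborel (\<lambda>u. B r u)" for r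
      unfolding B_def by (intro integrable_mult_right cut)
    then show "AE r in lborel. integrable lborel (\<lambda>u. case (r, u) of (r, u) \<Rightarrow> B r u)" by simp
    have "norm (B r u) = B r u" for r u
      using C by (auto simp: B_def)
    then have "(LBINT u. norm (case (r, u) of (r, u) \<Rightarrow> B r u)) = indicator {0<..<1} r * (C * (LBINT u. min \<bar>u\<bar> (u\<^sup>2) * \<bar>stable_kernel \<alpha> \<beta> u\<bar>))" for r
      by (simp add: B_def)
    then show "integrable lborel (\<lambda>r. LBINT u. norm (case (r, u) of (r, u) \<Rightarrow> B r u))" by simp
  qed simp
  have bound: "norm (H r u) \<le> B r u" for r u
  proof (cases "r \<in> {0<..<1}")
    case True
    then have r: "0 < r" "r < 1" by auto
    have "norm (Q r u) \<le> min (2 * (\<bar>s\<bar> * r * \<bar>u\<bar>)) ((\<bar>s\<bar> * r * \<bar>u\<bar>)\<^sup>2)"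
      using norm_exp_minus_1_minus_le[of "\<i> * (complex_of_real (s * r) * complex_of_real u)"] r
      by (simp add: Q_def norm_mult)
    also have "\<dots> \<le> r * (C * min \<bar>u\<bar> (u\<^sup>2))"
    proof (cases "\<bar>u\<bar> \<le> u\<^sup>2")
      case True
      have "2 * (\<bar>s\<bar> * r * \<bar>u\<bar>) \<le> r * (C * \<bar>u\<bar>)"
        using r by (simp add: C_def algebra_simps)
      then show ?thesis using True by (simp add: min_absorb1 min.coboundedI1)
    next
      case False
      have "(\<bar>s\<bar> * r * \<bar>u\<bar>)\<^sup>2 = (s\<^sup>2 * u\<^sup>2) * (r * r)" by (simp add: power2_eq_square mult_ac)
      also have "\<dots> \<le> (s\<^sup>2 * u\<^sup>2) * (r * 1)" using r by (intro mult_left_mono) auto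
      also have "\<dots> \<le> r * (C * u\<^sup>2)" using r by (simp add: C_def algebra_simps)
      finally show ?thesis using False by (simp add: min_absorb2 min.coboundedI2)
    qed
    finally have Q: "norm (Q r u / complex_of_real r) \<le> C * min \<bar>u\<bar> (u\<^sup>2)"
      using r by (simp add: norm_divide divide_simps mult_ac)
    have "norm (Q r u / complex_of_real r * ou_factor \<alpha> \<beta> s r) * \<bar>stable_kernel \<alpha> \<beta> u\<bar> \<le> C * min \<bar>u\<bar> (u\<^sup>2) * \<bar>stable_kernel \<alpha> \<beta> u\<bar>"
      using \<alpha> r by (intro mult_right_mono norm_mult_ou_factor_le Q) auto
    then show ?thesis using True by (simp add: H_def B_def norm_mult norm_divide mult.assoc)
  qed (simp add: H_def B_def)
  have H: "integrable (lborel \<Otimes>\<^sub>M lborel) (\<lambda>(r, u). H r u)"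
  proof (rule Bochner_Integration.integrable_bound[OF B])
    show "AE z in lborel \<Otimes>\<^sub>M lborel. norm (case z of (r, u) \<Rightarrow> H r u) \<le> norm (case z of (r, u) \<Rightarrow> B r u)"
      using bound order_trans[OF bound abs_ge_self] by (intro AE_I2) (auto split: prod.split)
  qed simp
  have inner: "(stein_exp \<alpha> \<beta> s (u + x) - stein_exp \<alpha> \<beta> s x - u * stein_exp' \<alpha> \<beta> s x) * complex_of_real (stable_kernel \<alpha> \<beta> u)
     = - complex_of_real \<alpha> * (LBINT r. H r u)" for u
  proof -
    have "H r u = indicator {0<..<1} r *\<^sub>R (iexp (s * r * x) * Q r u / complex_of_real r * ou_factor \<alpha> \<beta> s r) * complex_of_real (stable_kernel \<alpha> \<beta> u)" for r
      by (simp add: H_def)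
    then have "(LBINT r. H r u) = (LBINT r:{0<..<1}. iexp (s * r * x) * Q r u / complex_of_real r * ou_factor \<alpha> \<beta> s r) * complex_of_real (stable_kernel \<alpha> \<beta> u)"
      by (simp only: set_lebesgue_integral_def integral_mult_left_zero)
    then show ?thesis unfolding stein_exp_remainder Q_def by (simp only: mult.assoc)
  qed
  show "integrable lborel (\<lambda>u. (stein_exp \<alpha> \<beta> s (u + x) - stein_exp \<alpha> \<beta> s x - u * stein_exp' \<alpha> \<beta> s x) * complex_of_real (stable_kernel \<alpha> \<beta> u))"
    unfolding inner by (intro integrable_mult_right lborel_pair.integrable_snd H)
  \<comment> \<open>For fixed r the integral over u is the symbol at s r, and \<psi>(s r) / r = r
    powr (\<alpha> - 1) \<psi>(s); this is the second integrand of
    \<open>ou_factor_ftc\<close>.\<close>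
  have *: "d_const \<alpha> * (LBINT u. H r u) = indicator {0<..<1} r *\<^sub>R (complex_of_real (r powr (\<alpha> - 1)) * stable_exponent \<alpha> \<beta> s * iexp (s * r * x) * ou_factor \<alpha> \<beta> s r)" for r
  proof (cases "r \<in> {0<..<1}")
    case True
    have "d_const \<alpha> * (LBINT u. H r u) = iexp (s * r * x) / complex_of_real r * ou_factor \<alpha> \<beta> s r * (d_const \<alpha> * (LBINT u. Q r u * complex_of_real (stable_kernel \<alpha> \<beta> u)))"
    proof -
      have "H r u = iexp (s * r * x) / complex_of_real r * ou_factor \<alpha> \<beta> s r * (Q r u * complex_of_real (stable_kernel \<alpha> \<beta> u))" for u
        using True by (simp add: H_def)
      then show ?thesis by simp
    qed
    also have "d_const \<alpha> * (LBINT u. Q r u * complex_of_real (stable_kernel \<alpha> \<beta> u)) = stable_exponent \<alpha> \<beta> (s * r)"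
      using stable_kernel_iexp_integral(2)[OF \<alpha>, of "s * r" \<beta>] unfolding Q_def of_real_mult .
    also have "\<dots> = complex_of_real (r powr \<alpha>) * stable_exponent \<alpha> \<beta> s"
      using True by (intro stable_exponent_scale) auto
    also have "complex_of_real (r powr \<alpha>) = complex_of_real r * complex_of_real (r powr (\<alpha> - 1))"
      using True powr_mult_base[of r "\<alpha> - 1"] by (simp flip: of_real_mult)
    finally show ?thesis using True by (simp add: mult_ac)
  qed (simp add: H_def)
  have "d_const \<alpha> * (LBINT u. (stein_exp \<alpha> \<beta> s (u + x) - stein_exp \<alpha> \<beta> s x - u * stein_exp' \<alpha> \<beta> s x) * complex_of_real (stable_kernel \<alpha> \<beta> u))
     = - complex_of_real \<alpha> * (d_const \<alpha> * (LBINT u. LBINT r. H r u))"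
    unfolding inner integral_mult_right_zero by (simp only: mult_ac)
  also have "(LBINT u. LBINT r. H r u) = (LBINT r. LBINT u. H r u)"
    by (rule lborel_pair.Fubini_integral[OF H])
  also have "d_const \<alpha> * \<dots> = (LBINT r:{0<..<1}. complex_of_real (r powr (\<alpha> - 1)) * stable_exponent \<alpha> \<beta> s * iexp (s * r * x) * ou_factor \<alpha> \<beta> s r)"
    unfolding *[symmetric] set_lebesgue_integral_def by (rule integral_mult_right_zero[symmetric])
  finally show "d_const \<alpha> * (LBINT u. (stein_exp \<alpha> \<beta> s (u + x) - stein_exp \<alpha> \<beta> s x - u * stein_exp' \<alpha> \<beta> s x) * complex_of_real (stable_kernel \<alpha> \<beta> u))
     - x * stein_exp' \<alpha> \<beta> s x / \<alpha> = iexp (s * x) - exp (stable_exponent \<alpha> \<beta> s)"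
    unfolding ou_factor_ftc(2)[symmetric] stein_exp'_def using \<alpha> by simp
qed

end

section \<open>Fourier inversion and the stable density\<close>

lemma power_le_fact_mult_exp: "0 \<le> x \<Longrightarrow> x ^ n \<le> fact n * exp (x::real)"
proof -
  assume x: "0 \<le> x"
  have "(\<Sum>k\<in>{n}. x ^ k /\<^sub>R fact k) \<le> (\<Sum>k. x ^ k /\<^sub>R fact k)"
    using x by (intro sum_le_suminf summable_exp_generic) auto
  then show "x ^ n \<le> fact n * exp x"
    by (simp add: exp_def field_simps)
qed

lemma integrable_inverse_1_plus_square_lborel: "integrable lborel (\<lambda>t::real. C * inverse (1 + t\<^sup>2))"
  using integrable_inverse_1_plus_square by (simp add: set_integrable_def)

text \<open>Strong enough to give both integrability and vanishing limits at infinity, the two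
  inputs of a partial integration over the whole line.\<close>

definition inverse_square_decay :: "(real \<Rightarrow> complex) \<Rightarrow> bool" where
  "inverse_square_decay f \<longleftrightarrow> (\<exists>C. \<forall>t. norm (f t) \<le> C * inverse (1 + t\<^sup>2))"

lemma inverse_square_decay_integrable:
  assumes "inverse_square_decay f" "f \<in> borel_measurable borel"
  shows "integrable lborel f"
proof -
  obtain C where C: "\<And>t. norm (f t) \<le> C * inverse (1 + t\<^sup>2)"
    using assms unfolding inverse_square_decay_def by blast
  show ?thesis
    by (rule Bochner_Integration.integrable_bound[OF integrable_inverse_1_plus_square_lborel[of C]])
       (use assms order_trans[OF C abs_ge_self] in \<open>auto simp del: abs_mult\<close>)
qed

lemma inverse_square_decay_tendsto_0:
  assumes "inverse_square_decay f"
  shows "(f \<longlongrightarrow> 0) at_top" "(f \<longlongrightarrow> 0) at_bot"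
proof -
  obtain C where C: "\<And>t. norm (f t) \<le> C * inverse (1 + t\<^sup>2)"
    using assms unfolding inverse_square_decay_def by blast
  have sq: "filterlim (\<lambda>t::real. 1 + t\<^sup>2) at_top at_top" "filterlim (\<lambda>t::real. 1 + t\<^sup>2) at_top at_bot"
    by (intro filterlim_tendsto_add_at_top[OF tendsto_const] filterlim_pow_at_top filterlim_ident
        filterlim_pow_at_bot_even; simp)+
  have "((\<lambda>t::real. C * inverse (1 + t\<^sup>2)) \<longlongrightarrow> 0) at_top" "((\<lambda>t::real. C * inverse (1 + t\<^sup>2)) \<longlongrightarrow> 0) at_bot"
    by (intro tendsto_mult_right_zero tendsto_inverse_0_at_top sq)+
  then show "(f \<longlongrightarrow> 0) at_top" "(f \<longlongrightarrow> 0) at_bot"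
    by (auto intro: Lim_null_comparison[OF always_eventually] C)
qed

text \<open>From |t| <= 1 + |t| powr \<alpha> it follows that exp(- |t| powr \<alpha>) is at most e
  times exp(- |t|), which absorbs every power of 1 + |t|. The two extra powers in
  \<open>n + 2\<close> buy the factor 1 + t^2.\<close>

lemma inverse_square_decay_poly_exp:
  assumes \<alpha>: "1 < \<alpha>" and f: "\<And>t. norm (f t) \<le> K * (1 + \<bar>t\<bar>) ^ n * exp (- (\<bar>t\<bar> powr \<alpha>))"
  shows "inverse_square_decay f"
proof -
  have "K \<ge> 0"
    using order_trans[OF norm_ge_zero f[of 0]] by (simp add: zero_le_mult_iff)
  have "norm (f t) \<le> (K * fact (n + 2) * exp 2) * inverse (1 + t\<^sup>2)" for t
  proof -
    have "\<bar>t\<bar> \<le> 1 + \<bar>t\<bar> powr \<alpha>"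
    proof (cases "\<bar>t\<bar> \<le> 1")
      case False
      then have "\<bar>t\<bar> powr 1 \<le> \<bar>t\<bar> powr \<alpha>" using \<alpha> by (intro powr_mono) auto
      then show ?thesis using False by simp
    qed (simp add: add_increasing2)
    then have e: "exp (1 + \<bar>t\<bar>) * exp (- (\<bar>t\<bar> powr \<alpha>)) \<le> exp 2"
      by (simp flip: exp_add)
    have "1 + t\<^sup>2 \<le> (1 + \<bar>t\<bar>)\<^sup>2" by (simp add: power2_eq_square algebra_simps)
    then have "(1 + \<bar>t\<bar>) ^ n * (1 + t\<^sup>2) \<le> (1 + \<bar>t\<bar>) ^ (n + 2)"
      unfolding power_add by (rule mult_left_mono) simp
    also have "\<dots> \<le> fact (n + 2) * exp (1 + \<bar>t\<bar>)"
      by (rule power_le_fact_mult_exp) simp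
    finally have "(1 + \<bar>t\<bar>) ^ n * (1 + t\<^sup>2) * exp (- (\<bar>t\<bar> powr \<alpha>)) \<le> fact (n + 2) * exp (1 + \<bar>t\<bar>) * exp (- (\<bar>t\<bar> powr \<alpha>))"
      by (rule mult_right_mono) simp
    also have "\<dots> \<le> fact (n + 2) * exp 2"
      unfolding mult.assoc by (rule mult_left_mono[OF e]) simp
    finally have "K * ((1 + \<bar>t\<bar>) ^ n * (1 + t\<^sup>2) * exp (- (\<bar>t\<bar> powr \<alpha>))) \<le> K * (fact (n + 2) * exp 2)"
      using \<open>K \<ge> 0\<close> by (rule mult_left_mono)
    moreover have "norm (f t) * (1 + t\<^sup>2) \<le> K * (1 + \<bar>t\<bar>) ^ n * exp (- (\<bar>t\<bar> powr \<alpha>)) * (1 + t\<^sup>2)"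
      by (rule mult_right_mono[OF f]) simp
    ultimately have "norm (f t) * (1 + t\<^sup>2) \<le> K * fact (n + 2) * exp 2"
      by (simp only: mult_ac)
    moreover have "1 + t\<^sup>2 > 0" by (simp add: add_pos_nonneg)
    ultimately show ?thesis by (simp add: divide_inverse[symmetric] pos_le_divide_eq)
  qed
  then show ?thesis unfolding inverse_square_decay_def by blast
qed

text \<open>Sign as in the inversion formula for characteristic functions, without its factor 1 / (2
  pi).\<close>

definition fourier :: "(real \<Rightarrow> complex) \<Rightarrow> real \<Rightarrow> complex" where
  "fourier f x = (LBINT t. iexp (- x * t) * f t)"

lemma integrable_iexp_mult:
  fixes f :: "real \<Rightarrow> complex"
  shows "integrable lborel f \<Longrightarrow> integrable lborel (\<lambda>t. iexp (c * t) * f t)"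
  by (rule Bochner_Integration.integrable_bound[of _ f]) (auto simp: norm_mult)

lemma norm_fourier_le:
  fixes f :: "real \<Rightarrow> complex"
  shows "integrable lborel f \<Longrightarrow> norm (fourier f x) \<le> (LBINT t. norm (f t))"
  unfolding fourier_def by (rule order_trans[OF integral_norm_bound]) (simp add: norm_mult)

lemma has_vector_derivative_fourier:
  fixes f :: "real \<Rightarrow> complex"
  assumes "integrable lborel f" "integrable lborel (\<lambda>t. t * f t)"
  shows "(fourier f has_vector_derivative - \<i> * fourier (\<lambda>t. t * f t) x) (at x)"
proof -
  have [measurable]: "f \<in> borel_measurable borel" using assms(1) by auto
  have "((\<lambda>x. LBINT t. iexp (- x * t) * f t) has_vector_derivative (LBINT t. - \<i> * (iexp (- x * t) * (t * f t)))) (at x within UNIV)"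
  proof (rule has_vector_derivative_lebesgue_integral[where w = "\<lambda>t. norm (t * f t)"])
    show "integrable lborel (\<lambda>t. iexp (- x * t) * f t)" for x
      by (rule integrable_iexp_mult assms)+
    show "((\<lambda>x. iexp (- x * t) * f t) has_vector_derivative - \<i> * (iexp (- x * t) * (t * f t))) (at x within UNIV)" for x t
      using has_vector_derivative_mult_left[OF has_vector_derivative_iexp[of "- t" x UNIV], of "f t"]
      by (simp add: mult_ac)
    show "integrable lborel (\<lambda>t. norm (t * f t))"
      using assms(2) by (rule integrable_norm)
  qed (auto simp: norm_mult)
  then show ?thesis unfolding fourier_def[abs_def] by simp
qed

text \<open>Trades smoothness of \<open>f\<close> for decay of its transform; the decay of
  \<open>f\<close> itself removes the boundary terms.\<close>

lemma fourier_by_parts: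
  assumes deriv: "\<And>t. (f has_vector_derivative f' t) (at t)"
    and cont: "continuous_on UNIV f'" and "inverse_square_decay f" "inverse_square_decay f'"
  shows "fourier f' x = \<i> * x * fourier f x"
proof -
  have "continuous_on UNIV f"
    using deriv by (intro continuous_at_imp_continuous_on) (auto intro: has_vector_derivative_continuous)
  then have f: "integrable lborel f" and f': "integrable lborel f'"
    using assms by (auto intro!: inverse_square_decay_integrable borel_measurable_continuous_onI)
  let ?F = "\<lambda>t. iexp (- x * t) * f t"
  have lim: "(?F \<longlongrightarrow> 0) F" if "(f \<longlongrightarrow> 0) F" for F
    using tendsto_norm_zero[OF that] by (intro tendsto_norm_zero_cancel[of ?F]) (simp add: norm_mult)
  have int: "integrable lborel (\<lambda>t. iexp (- x * t) * f' t)" "integrable lborel (\<lambda>t. - \<i> * x * (iexp (- x * t) * f t))"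
    by (intro integrable_mult_right integrable_iexp_mult f f')+
  have "(LBINT t=-\<infinity>..\<infinity>. iexp (- x * t) * f' t + - \<i> * x * (iexp (- x * t) * f t)) = 0 - 0"
  proof (rule interval_integral_FTC_integrable[where F = ?F])
    show "(?F has_vector_derivative iexp (- x * t) * f' t + - \<i> * x * (iexp (- x * t) * f t)) (at t)" for t
      using has_vector_derivative_mult[OF has_vector_derivative_iexp[of "- x" t UNIV] deriv[of t]]
      by (simp add: mult_ac)
    show "isCont (\<lambda>t. iexp (- x * t) * f' t + - \<i> * x * (iexp (- x * t) * f t)) t" for t
      using cont \<open>continuous_on UNIV f\<close> by (auto simp: continuous_on_eq_continuous_at intro!: continuous_intros)
    show "set_integrable lborel (einterval (-\<infinity>) \<infinity>) (\<lambda>t. iexp (- x * t) * f' t + - \<i> * x * (iexp (- x * t) * f t))"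
      using Bochner_Integration.integrable_add[OF int] by (simp add: set_integrable_def)
    show "((?F \<circ> real_of_ereal) \<longlongrightarrow> 0) (at_right (-\<infinity>))"
      by (simp only: ereal_tendsto_simps) (intro lim inverse_square_decay_tendsto_0 assms)
    show "((?F \<circ> real_of_ereal) \<longlongrightarrow> 0) (at_left \<infinity>)"
      by (simp only: ereal_tendsto_simps) (intro lim inverse_square_decay_tendsto_0 assms)
  qed simp
  then have "(LBINT t. iexp (- x * t) * f' t + - \<i> * x * (iexp (- x * t) * f t)) = 0"
    by (simp add: interval_lebesgue_integral_def set_lebesgue_integral_def)
  then have "(LBINT t. iexp (- x * t) * f' t) + (LBINT t. - \<i> * x * (iexp (- x * t) * f t)) = 0"
    unfolding Bochner_Integration.integral_add[OF int] .
  then have "fourier f' x + (- \<i> * x) * fourier f x = 0"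
    unfolding fourier_def integral_mult_right_zero .
  then show ?thesis by (simp add: algebra_simps)
qed

text \<open>Supplies the one point where |t| powr \<alpha> and its odd version are not smooth
  powers: at 0 the difference quotient is at most |h| powr (\<alpha> - 1), which tends to 0 because
  \<alpha> > 1.\<close>

lemma has_real_derivative_0_if_abs_le_powr:
  assumes "1 < \<alpha>" and f: "\<And>h. \<bar>f h\<bar> \<le> \<bar>h\<bar> powr \<alpha>"
  shows "(f has_real_derivative 0) (at 0)"
proof -
  have "f 0 = 0" using f[of 0] by simp
  have "((\<lambda>h. f h / h) \<longlongrightarrow> 0) (at 0)"
  proof (rule Lim_null_comparison)
    show "((\<lambda>h. \<bar>h\<bar> powr (\<alpha> - 1)) \<longlongrightarrow> 0) (at 0)"
      using assms(1) by (intro tendsto_zero_powrI[where b = "\<alpha> - 1"] tendsto_rabs_zero) auto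
    have "norm (f h / h) \<le> \<bar>h\<bar> powr (\<alpha> - 1)" if "h \<noteq> 0" for h
      using divide_right_mono[OF f[of h], of "\<bar>h\<bar>"] that by (simp add: powr_diff)
    then show "\<forall>\<^sub>F h in at 0. norm (f h / h) \<le> \<bar>h\<bar> powr (\<alpha> - 1)"
      by (auto simp: eventually_at_filter)
  qed
  then show ?thesis by (simp add: DERIV_def \<open>f 0 = 0\<close>)
qed

lemma has_real_derivative_abs_powr:
  assumes "1 < \<alpha>"
  shows "((\<lambda>t. \<bar>t\<bar> powr \<alpha>) has_real_derivative \<alpha> * \<bar>t\<bar> powr (\<alpha> - 1) * sgn t) (at t)"
    and "((\<lambda>t. sgn t * \<bar>t\<bar> powr \<alpha>) has_real_derivative \<alpha> * \<bar>t\<bar> powr (\<alpha> - 1)) (at t)"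
proof -
  have pos: "((\<lambda>t. t powr \<alpha>) has_real_derivative \<alpha> * t powr (\<alpha> - 1)) (at t)" if "t > 0" for t
    using that by (auto intro!: derivative_eq_intros)
  have neg: "((\<lambda>t. (- t) powr \<alpha>) has_real_derivative - (\<alpha> * (- t) powr (\<alpha> - 1))) (at t)" if "t < 0" for t
    using that by (auto intro!: derivative_eq_intros)
  have "t < 0 \<or> t = 0 \<or> t > 0" by linarith
  then show "((\<lambda>t. \<bar>t\<bar> powr \<alpha>) has_real_derivative \<alpha> * \<bar>t\<bar> powr (\<alpha> - 1) * sgn t) (at t)"
  proof (elim disjE)
    assume "t = 0"
    then show ?thesis using assms by (auto intro: has_real_derivative_0_if_abs_le_powr[of \<alpha>])
  next
    assume t: "t > 0"
    have "((\<lambda>t. \<bar>t\<bar> powr \<alpha>) has_real_derivative \<alpha> * t powr (\<alpha> - 1)) (at t)"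
      by (rule has_field_derivative_transform_within_open[OF pos[OF t], of "{0<..}"]) (use t in auto)
    then show ?thesis using t by simp
  next
    assume t: "t < 0"
    have "((\<lambda>t. \<bar>t\<bar> powr \<alpha>) has_real_derivative - (\<alpha> * (- t) powr (\<alpha> - 1))) (at t)"
      by (rule has_field_derivative_transform_within_open[OF neg[OF t], of "{..<0}"]) (use t in auto)
    then show ?thesis using t by simp
  qed
  have "t < 0 \<or> t = 0 \<or> t > 0" by linarith
  then show "((\<lambda>t. sgn t * \<bar>t\<bar> powr \<alpha>) has_real_derivative \<alpha> * \<bar>t\<bar> powr (\<alpha> - 1)) (at t)"
  proof (elim disjE)
    assume "t = 0"
    then show ?thesis using assms by (auto intro: has_real_derivative_0_if_abs_le_powr[of \<alpha>] simp: sgn_if)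
  next
    assume t: "t > 0"
    have "((\<lambda>t. sgn t * \<bar>t\<bar> powr \<alpha>) has_real_derivative \<alpha> * t powr (\<alpha> - 1)) (at t)"
      by (rule has_field_derivative_transform_within_open[OF pos[OF t], of "{0<..}"]) (use t in auto)
    then show ?thesis using t by simp
  next
    assume t: "t < 0"
    have "((\<lambda>t. sgn t * \<bar>t\<bar> powr \<alpha>) has_real_derivative - (- (\<alpha> * (- t) powr (\<alpha> - 1)))) (at t)"
      by (rule has_field_derivative_transform_within_open[OF DERIV_minus[OF neg[OF t]], of "{..<0}"]) (use t in auto)
    then show ?thesis using t by simp
  qed
qed

definition stable_exponent' :: "real \<Rightarrow> real \<Rightarrow> real \<Rightarrow> complex" where
  "stable_exponent' \<alpha> \<beta> t =
     - complex_of_real (\<alpha> * \<bar>t\<bar> powr (\<alpha> - 1)) * (complex_of_real (sgn t) - \<i> * complex_of_real (\<beta> * tan (pi * \<alpha> / 2)))"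

lemma abs_powr_le_power:
  assumes "0 \<le> a" "a \<le> real n"
  shows "\<bar>t\<bar> powr a \<le> (1 + \<bar>t\<bar>) ^ n"
proof -
  have "\<bar>t\<bar> powr a \<le> (1 + \<bar>t\<bar>) powr a" using assms by (intro powr_mono2) auto
  also have "\<dots> \<le> (1 + \<bar>t\<bar>) powr real n" using assms by (intro powr_mono) auto
  finally show ?thesis by (simp add: powr_realpow add_pos_nonneg)
qed

lemma norm_stable_exponent_le: "norm (stable_exponent \<alpha> \<beta> t) \<le> (1 + \<bar>\<beta> * tan (pi * \<alpha> / 2)\<bar>) * \<bar>t\<bar> powr \<alpha>"
proof -
  have "norm (1 - \<i> * complex_of_real (\<beta> * sgn t * tan (pi * \<alpha> / 2))) \<le> 1 + \<bar>\<beta> * sgn t * tan (pi * \<alpha> / 2)\<bar>"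
    by (rule order_trans[OF norm_triangle_ineq4]) (simp add: norm_mult abs_mult)
  also have "\<dots> \<le> 1 + \<bar>\<beta> * tan (pi * \<alpha> / 2)\<bar>" by (simp add: abs_mult sgn_if)
  finally have "\<bar>t\<bar> powr \<alpha> * norm (1 - \<i> * complex_of_real (\<beta> * sgn t * tan (pi * \<alpha> / 2))) \<le> \<bar>t\<bar> powr \<alpha> * (1 + \<bar>\<beta> * tan (pi * \<alpha> / 2)\<bar>)"
    by (rule mult_left_mono) simp
  then show ?thesis
    unfolding stable_exponent_def norm_mult norm_minus_cancel norm_of_real by (simp add: mult.commute)
qed

lemma norm_exp_stable_exponent: "norm (exp (stable_exponent \<alpha> \<beta> t)) = exp (- (\<bar>t\<bar> powr \<alpha>))"
  by (simp add: stable_exponent_def)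

section \<open>Differentiability and decay of the stable characteristic function\<close>

context
  fixes \<alpha> \<beta> :: real
  assumes \<alpha>: "1 < \<alpha>" "\<alpha> < 2"
begin

lemma has_vector_derivative_stable_exponent:
  "(stable_exponent \<alpha> \<beta> has_vector_derivative stable_exponent' \<alpha> \<beta> t) (at t)"
proof -
  let ?c = "\<i> * complex_of_real (\<beta> * tan (pi * \<alpha> / 2))"
  note d = has_real_derivative_abs_powr[OF \<alpha>(1)]
  have "stable_exponent \<alpha> \<beta> = (\<lambda>t. ?c * complex_of_real (sgn t * \<bar>t\<bar> powr \<alpha>) - complex_of_real (\<bar>t\<bar> powr \<alpha>))"
    by (auto simp: stable_exponent_def algebra_simps)
  moreover have "((\<lambda>t. ?c * complex_of_real (sgn t * \<bar>t\<bar> powr \<alpha>) - complex_of_real (\<bar>t\<bar> powr \<alpha>)) has_vector_derivative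
      ?c * complex_of_real (\<alpha> * \<bar>t\<bar> powr (\<alpha> - 1)) - complex_of_real (\<alpha> * \<bar>t\<bar> powr (\<alpha> - 1) * sgn t)) (at t)"
    by (intro has_vector_derivative_diff has_vector_derivative_mult_right has_vector_derivative_of_real d)
  moreover have "?c * complex_of_real (\<alpha> * \<bar>t\<bar> powr (\<alpha> - 1)) - complex_of_real (\<alpha> * \<bar>t\<bar> powr (\<alpha> - 1) * sgn t) = stable_exponent' \<alpha> \<beta> t"
    by (simp add: stable_exponent'_def algebra_simps)
  ultimately show ?thesis by simp
qed

lemma continuous_stable_exponent: "continuous_on UNIV (stable_exponent \<alpha> \<beta>)"
  using has_vector_derivative_stable_exponent
  by (intro continuous_at_imp_continuous_on) (auto intro: has_vector_derivative_continuous)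

text \<open>The only critical point is 0, where the jump of \<open>sgn\<close> is damped by |t| powr
  (\<alpha> - 1).\<close>

lemma continuous_stable_exponent': "continuous_on UNIV (stable_exponent' \<alpha> \<beta>)"
proof -
  have "isCont (\<lambda>t. \<bar>t\<bar> powr (\<alpha> - 1) * sgn t) t" for t
  proof (cases "t = 0")
    case True
    have "((\<lambda>h. \<bar>h\<bar> powr (\<alpha> - 1) * sgn h) \<longlongrightarrow> 0) (at 0)"
    proof (rule Lim_null_comparison)
      show "((\<lambda>h. \<bar>h\<bar> powr (\<alpha> - 1)) \<longlongrightarrow> 0) (at 0)"
        using \<alpha> by (intro tendsto_zero_powrI[where b = "\<alpha> - 1"] tendsto_rabs_zero) auto
    qed (auto simp: abs_mult sgn_if intro!: always_eventually)
    then show ?thesis using True by (simp add: isCont_def)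
  next
    case False
    then show ?thesis by (intro continuous_intros) auto
  qed
  then have 1: "continuous_on UNIV (\<lambda>t. \<bar>t\<bar> powr (\<alpha> - 1) * sgn t)"
    by (intro continuous_at_imp_continuous_on) auto
  have 2: "continuous_on UNIV (\<lambda>t::real. \<bar>t\<bar> powr (\<alpha> - 1))"
    using \<alpha> by (intro continuous_on_powr') (auto intro!: continuous_intros)
  have "stable_exponent' \<alpha> \<beta> = (\<lambda>t. - complex_of_real \<alpha> * (complex_of_real (\<bar>t\<bar> powr (\<alpha> - 1) * sgn t)
      - \<i> * complex_of_real (\<beta> * tan (pi * \<alpha> / 2)) * complex_of_real (\<bar>t\<bar> powr (\<alpha> - 1))))"
    by (auto simp: stable_exponent'_def algebra_simps)
  then show ?thesis by (simp only:) (intro continuous_intros 1 2)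
qed

text \<open>Euler's relation for the homogeneous function \<psi>. It expresses the derivative of t
  exp(\<psi>(t)) without \<psi>', which is not differentiable at 0, and so permits a second
  differentiation.\<close>

lemma mult_stable_exponent': "t * stable_exponent' \<alpha> \<beta> t = \<alpha> * stable_exponent \<alpha> \<beta> t"
proof -
  have "t * (\<bar>t\<bar> powr (\<alpha> - 1) * sgn t) = \<bar>t\<bar> powr \<alpha>" "t * \<bar>t\<bar> powr (\<alpha> - 1) = \<bar>t\<bar> powr \<alpha> * sgn t"
    using powr_mult_base[of "\<bar>t\<bar>" "\<alpha> - 1"] \<alpha> by (auto simp: sgn_if abs_if split: if_splits)
  then have "complex_of_real t * (complex_of_real (\<bar>t\<bar> powr (\<alpha> - 1)) * complex_of_real (sgn t)) = complex_of_real (\<bar>t\<bar> powr \<alpha>)"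
     "complex_of_real t * complex_of_real (\<bar>t\<bar> powr (\<alpha> - 1)) = complex_of_real (\<bar>t\<bar> powr \<alpha>) * complex_of_real (sgn t)"
    unfolding of_real_mult[symmetric] by simp_all
  \<comment> \<open>The real powers are abstracted into ring variables, since only the two product
    relations just derived enter.\<close>
  moreover have "T * (- (A * P) * (S - \<i> * (b * c))) = A * (- Q * (1 - \<i> * (b * S * c)))"
    if "T * (P * S) = Q" "T * P = Q * S" for T P S Q A b c :: complex
  proof -
    have "T * (- (A * P) * (S - \<i> * (b * c))) = - A * (T * (P * S)) + A * (\<i> * (b * c)) * (T * P)"
      by (simp add: algebra_simps)
    then show ?thesis unfolding that by (simp add: algebra_simps)
  qed
  ultimately show ?thesis
    unfolding stable_exponent_def stable_exponent'_def of_real_mult by blast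
qed

lemma has_vector_derivative_exp_stable_exponent:
  "((\<lambda>t. exp (stable_exponent \<alpha> \<beta> t)) has_vector_derivative stable_exponent' \<alpha> \<beta> t * exp (stable_exponent \<alpha> \<beta> t)) (at t)"
  using field_vector_diff_chain_at[OF has_vector_derivative_stable_exponent DERIV_exp] by (simp add: comp_def)

lemma has_vector_derivative_mult_stable_cf:
  "((\<lambda>t. t * exp (stable_exponent \<alpha> \<beta> t)) has_vector_derivative (1 + \<alpha> * stable_exponent \<alpha> \<beta> t) * exp (stable_exponent \<alpha> \<beta> t)) (at t)"
proof -
  have "((\<lambda>t. complex_of_real t * exp (stable_exponent \<alpha> \<beta> t)) has_vector_derivative
     complex_of_real t * (stable_exponent' \<alpha> \<beta> t * exp (stable_exponent \<alpha> \<beta> t)) + complex_of_real 1 * exp (stable_exponent \<alpha> \<beta> t)) (at t)"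
    by (intro has_vector_derivative_mult has_vector_derivative_of_real DERIV_ident has_vector_derivative_exp_stable_exponent)
  also have "complex_of_real t * (stable_exponent' \<alpha> \<beta> t * exp (stable_exponent \<alpha> \<beta> t)) + complex_of_real 1 * exp (stable_exponent \<alpha> \<beta> t)
     = (1 + \<alpha> * stable_exponent \<alpha> \<beta> t) * exp (stable_exponent \<alpha> \<beta> t)"
    unfolding mult_stable_exponent'[symmetric] by (simp add: algebra_simps)
  finally show ?thesis .
qed

lemma has_vector_derivative_mult_stable_cf':
  "((\<lambda>t. (1 + \<alpha> * stable_exponent \<alpha> \<beta> t) * exp (stable_exponent \<alpha> \<beta> t)) has_vector_derivative
     (1 + \<alpha> + \<alpha> * stable_exponent \<alpha> \<beta> t) * stable_exponent' \<alpha> \<beta> t * exp (stable_exponent \<alpha> \<beta> t)) (at t)"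
proof -
  have "((\<lambda>t. (1 + \<alpha> * stable_exponent \<alpha> \<beta> t) * exp (stable_exponent \<alpha> \<beta> t)) has_vector_derivative
    (1 + \<alpha> * stable_exponent \<alpha> \<beta> t) * (stable_exponent' \<alpha> \<beta> t * exp (stable_exponent \<alpha> \<beta> t)) + (0 + \<alpha> * stable_exponent' \<alpha> \<beta> t) * exp (stable_exponent \<alpha> \<beta> t)) (at t)"
    by (intro has_vector_derivative_mult has_vector_derivative_add has_vector_derivative_const has_vector_derivative_mult_right
        has_vector_derivative_exp_stable_exponent has_vector_derivative_stable_exponent)
  then show ?thesis by (simp add: algebra_simps)
qed

lemma norm_stable_exponent'_le: "norm (stable_exponent' \<alpha> \<beta> t) \<le> \<alpha> * (1 + \<bar>\<beta> * tan (pi * \<alpha> / 2)\<bar>) * \<bar>t\<bar> powr (\<alpha> - 1)"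
proof -
  have "norm (complex_of_real (sgn t) - \<i> * complex_of_real (\<beta> * tan (pi * \<alpha> / 2))) \<le> \<bar>sgn t\<bar> + \<bar>\<beta> * tan (pi * \<alpha> / 2)\<bar>"
    by (rule order_trans[OF norm_triangle_ineq4]) (simp add: norm_mult abs_mult)
  also have "\<dots> \<le> 1 + \<bar>\<beta> * tan (pi * \<alpha> / 2)\<bar>" by (simp add: sgn_if)
  finally have "(\<alpha> * \<bar>t\<bar> powr (\<alpha> - 1)) * norm (complex_of_real (sgn t) - \<i> * complex_of_real (\<beta> * tan (pi * \<alpha> / 2))) \<le> (\<alpha> * \<bar>t\<bar> powr (\<alpha> - 1)) * (1 + \<bar>\<beta> * tan (pi * \<alpha> / 2)\<bar>)"
    by (rule mult_left_mono) (use \<alpha> in simp)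
  then show ?thesis
    unfolding stable_exponent'_def norm_mult norm_minus_cancel norm_of_real using \<alpha> by (simp add: mult_ac abs_mult)
qed

text \<open>The first three govern p, p' and the continuity of p'; the last three are the
  derivatives used to bound p and p' at infinity.\<close>

lemma stable_cf_decay:
  "inverse_square_decay (\<lambda>t. exp (stable_exponent \<alpha> \<beta> t))"
  "inverse_square_decay (\<lambda>t. t * exp (stable_exponent \<alpha> \<beta> t))"
  "inverse_square_decay (\<lambda>t. t * (t * exp (stable_exponent \<alpha> \<beta> t)))"
  "inverse_square_decay (\<lambda>t. stable_exponent' \<alpha> \<beta> t * exp (stable_exponent \<alpha> \<beta> t))"
  "inverse_square_decay (\<lambda>t. (1 + \<alpha> * stable_exponent \<alpha> \<beta> t) * exp (stable_exponent \<alpha> \<beta> t))"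
  "inverse_square_decay (\<lambda>t. (1 + \<alpha> + \<alpha> * stable_exponent \<alpha> \<beta> t) * stable_exponent' \<alpha> \<beta> t * exp (stable_exponent \<alpha> \<beta> t))"
proof -
  let ?B = "1 + \<bar>\<beta> * tan (pi * \<alpha> / 2)\<bar>"
  have decay: "inverse_square_decay (\<lambda>t. g t * exp (stable_exponent \<alpha> \<beta> t))" if "\<And>t. norm (g t) \<le> K * (1 + \<bar>t\<bar>) ^ n" for g K n
    using \<alpha>(1) by (rule inverse_square_decay_poly_exp[where K = K and n = n])
      (simp only: norm_mult norm_exp_stable_exponent, intro mult_right_mono that, simp)
  have B: "?B \<ge> 0" by simp
  have \<psi>: "norm (stable_exponent \<alpha> \<beta> t) \<le> ?B * (1 + \<bar>t\<bar>) ^ 2" for t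
    using \<alpha> by (intro order_trans[OF norm_stable_exponent_le] mult_left_mono abs_powr_le_power) auto
  have \<psi>': "norm (stable_exponent' \<alpha> \<beta> t) \<le> \<alpha> * ?B * (1 + \<bar>t\<bar>) ^ 1" for t
    using \<alpha> by (intro order_trans[OF norm_stable_exponent'_le] mult_left_mono abs_powr_le_power) auto
  have lin: "norm (complex_of_real c + \<alpha> * stable_exponent \<alpha> \<beta> t) \<le> (c + \<alpha> * ?B) * (1 + \<bar>t\<bar>) ^ 2" if "c \<ge> 0" for c t
  proof -
    have "norm (complex_of_real c + \<alpha> * stable_exponent \<alpha> \<beta> t) \<le> c + \<alpha> * norm (stable_exponent \<alpha> \<beta> t)"
      using \<alpha> that by (intro order_trans[OF norm_triangle_ineq]) (simp add: norm_mult)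
    also have "\<dots> \<le> c * (1 + \<bar>t\<bar>) ^ 2 + \<alpha> * (?B * (1 + \<bar>t\<bar>) ^ 2)"
      using \<alpha> that by (intro add_mono mult_left_mono \<psi>) (auto simp: mult_left_le intro: mult_left_le_one_le one_le_power mult_le_cancel_left1[THEN iffD2])
    finally show ?thesis by (simp add: algebra_simps)
  qed
  show "inverse_square_decay (\<lambda>t. exp (stable_exponent \<alpha> \<beta> t))"
    using decay[of "\<lambda>_. 1" 1 0] by simp
  show "inverse_square_decay (\<lambda>t. t * exp (stable_exponent \<alpha> \<beta> t))"
    by (rule decay[of _ 1 1]) simp
  have "inverse_square_decay (\<lambda>t. (complex_of_real t * complex_of_real t) * exp (stable_exponent \<alpha> \<beta> t))"
  proof (rule decay[of _ 1 2])
    show "norm (complex_of_real t * complex_of_real t) \<le> 1 * (1 + \<bar>t\<bar>) ^ 2" for t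
      using mult_mono[of "\<bar>t\<bar>" "1 + \<bar>t\<bar>" "\<bar>t\<bar>" "1 + \<bar>t\<bar>"] by (simp add: norm_mult power2_eq_square)
  qed
  then show "inverse_square_decay (\<lambda>t. t * (t * exp (stable_exponent \<alpha> \<beta> t)))" by (simp only: mult.assoc)
  show "inverse_square_decay (\<lambda>t. stable_exponent' \<alpha> \<beta> t * exp (stable_exponent \<alpha> \<beta> t))"
    by (rule decay[OF \<psi>'])
  show "inverse_square_decay (\<lambda>t. (1 + \<alpha> * stable_exponent \<alpha> \<beta> t) * exp (stable_exponent \<alpha> \<beta> t))"
    using decay[OF lin[of 1]] by simp
  show "inverse_square_decay (\<lambda>t. (1 + \<alpha> + \<alpha> * stable_exponent \<alpha> \<beta> t) * stable_exponent' \<alpha> \<beta> t * exp (stable_exponent \<alpha> \<beta> t))"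
  proof (rule decay)
    fix t
    have "norm (complex_of_real (1 + \<alpha>) + \<alpha> * stable_exponent \<alpha> \<beta> t) * norm (stable_exponent' \<alpha> \<beta> t) \<le>
      ((1 + \<alpha> + \<alpha> * ?B) * (1 + \<bar>t\<bar>) ^ 2) * (\<alpha> * ?B * (1 + \<bar>t\<bar>) ^ 1)"
      using \<alpha> by (intro mult_mono lin \<psi>') auto
    also have "\<dots> = ((1 + \<alpha> + \<alpha> * ?B) * (\<alpha> * ?B)) * (1 + \<bar>t\<bar>) ^ 3"
      by (simp add: power3_eq_cube power2_eq_square mult_ac)
    finally show "norm ((1 + \<alpha> + \<alpha> * stable_exponent \<alpha> \<beta> t) * stable_exponent' \<alpha> \<beta> t) \<le> ((1 + \<alpha> + \<alpha> * ?B) * (\<alpha> * ?B)) * (1 + \<bar>t\<bar>) ^ 3"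
      by (simp add: norm_mult)
  qed
qed

end

text \<open>Levy's theorem gives the measure of intervals \<open>{a<..b}\<close>. Integrability of
  the characteristic function turns the symmetric limit into a full integral that can be
  differentiated in b. Continuity of \<open>p\<close> makes the other side differentiable too, with
  derivative p(b), so the formula holds at every point and not merely almost everywhere.\<close>

lemma (in real_distribution) density_eq_fourier_char:
  fixes p :: "real \<Rightarrow> real"
  assumes p: "continuous_on UNIV p" "\<And>y. 0 \<le> p y" and M: "M = density lborel p"
    and int: "integrable lborel (char M)"
  shows "complex_of_real (p x) = fourier (char M) x / (2 * pi)"
proof -
  define a where "a = x - 1"
  define F where "F b t = (iexp (- (t * a)) - iexp (- (t * b))) / (\<i> * t) * char M t" for b t :: real
  \<comment> \<open>\<open>F b 0\<close> is 0 for every b, by division by zero, so its derivative in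
    b at t = 0 must be 0 as well; the Fourier integrand differs from this at a single point
    only.\<close>
  define F' where "F' b t = (if t = 0 then 0 else iexp (- b * t) * char M t)" for b t :: real
  have [measurable]: "char M \<in> borel_measurable borel" using int by auto
  have [measurable]: "p \<in> borel_measurable borel" using p(1) by (rule borel_measurable_continuous_onI)
  have F_bound: "norm (F b t) \<le> \<bar>b - a\<bar> * norm (char M t)" for b t
  proof (cases "t = 0")
    case False
    have "iexp (- (t * a)) - iexp (- (t * b)) = - iexp (- (t * a)) * (iexp (- (t * (b - a))) - 1)"
    proof -
      have "iexp (- (t * b)) = iexp (- (t * a)) * iexp (- (t * (b - a)))"
        unfolding exp_add[symmetric] by (simp add: algebra_simps)
      then show ?thesis by (simp only: ring_distribs) simp
    qed
    then have "norm (iexp (- (t * a)) - iexp (- (t * b))) \<le> \<bar>t\<bar> * \<bar>b - a\<bar>"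
      using norm_iexp_minus_1_le[of "- (t * (b - a))"] by (simp add: norm_mult abs_mult)
    then have "norm ((iexp (- (t * a)) - iexp (- (t * b))) / (\<i> * t)) \<le> \<bar>b - a\<bar>"
      using False by (simp add: norm_divide norm_mult pos_divide_le_eq mult.commute)
    then show ?thesis unfolding F_def norm_mult by (rule mult_right_mono) simp
  qed (simp add: F_def)
  have F_int: "integrable lborel (F b)" for b
  proof (rule Bochner_Integration.integrable_bound)
    show "integrable lborel (\<lambda>t. \<bar>b - a\<bar> * norm (char M t))" using int by simp
    show "F b \<in> borel_measurable lborel" unfolding F_def by measurable
    show "AE t in lborel. norm (F b t) \<le> norm (\<bar>b - a\<bar> * norm (char M t))"
      using order_trans[OF F_bound abs_ge_self] by simp
  qed
  have F_deriv: "((\<lambda>b. LBINT t. F b t) has_vector_derivative fourier (char M) b) (at b within UNIV)" for b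
  proof -
    have "((\<lambda>b. LBINT t. F b t) has_vector_derivative (LBINT t. F' b t)) (at b within UNIV)"
    proof (rule has_vector_derivative_lebesgue_integral[where w = "\<lambda>t. norm (char M t)"])
      show "((\<lambda>b. F b t) has_vector_derivative F' b t) (at b within UNIV)" for b t
      proof (cases "t = 0")
        case False
        have "((\<lambda>b. (iexp (- (t * a)) - iexp (- t * b))) has_vector_derivative 0 - \<i> * (- t) * iexp (- t * b)) (at b within UNIV)"
          using has_vector_derivative_iexp[of "- t" b UNIV] by (intro has_vector_derivative_diff has_vector_derivative_const) simp
        from has_vector_derivative_mult_left[OF this, of "char M t / (\<i> * t)"]
        show ?thesis using False by (simp add: F_def F'_def mult_ac)
      qed (simp add: F_def F'_def)
      show "F' b \<in> borel_measurable lborel" unfolding F'_def by measurable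
    qed (use int F_int in \<open>auto simp: F'_def norm_mult\<close>)
    also have "(LBINT t. F' b t) = fourier (char M) b"
      unfolding fourier_def
    proof (rule integral_cong_AE)
      show "AE t in lborel. F' b t = iexp (- b * t) * char M t"
        using AE_lborel_singleton[of 0] by eventually_elim (simp add: F'_def)
    qed (unfold F'_def, measurable)
    finally show ?thesis .
  qed
  have meas: "measure M {a<..b} = (LBINT y=a..b. p y)" if "a \<le> b" for b
  proof -
    have "measure M {a<..b} = integral\<^sup>L M (indicator {a<..b})" by simp
    also have "\<dots> = (LBINT y:{a<..b}. p y)"
      unfolding M set_lebesgue_integral_def using p(2) by (subst integral_density) (auto simp: mult.commute)
    finally show ?thesis using that by (simp add: interval_integral_Ioc)
  qed
  have null: "measure M {c} = 0" for c
  proof -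
    have "emeasure M {c} = 0"
      unfolding M by (simp add: emeasure_density nn_integral_indicator_singleton)
    then show ?thesis by (simp add: measure_def)
  qed
  have eq: "complex_of_real (LBINT y=a..b. p y) = 1 / (2 * pi) * (LBINT t. F b t)" if b: "a \<le> b" for b
  proof -
    have "(\<lambda>n::nat. CLBINT t=- real n..real n. F b t) \<longlonglongrightarrow> (LBINT t. F b t)"
    proof -
      have "(\<lambda>n::nat. LBINT t. indicator {- real n<..<real n} t *\<^sub>R F b t) \<longlonglongrightarrow> (LBINT t. F b t)"
      proof (rule integral_dominated_convergence[where w = "\<lambda>t. norm (F b t)"])
        show "AE t in lborel. (\<lambda>n. indicator {- real n<..<real n} t *\<^sub>R F b t) \<longlonglongrightarrow> F b t"
        proof (rule AE_I2, rule tendsto_eventually)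
          fix t :: real
          obtain N where N: "\<bar>t\<bar> < real N" using reals_Archimedean2 by blast
          show "\<forall>\<^sub>F n in sequentially. indicator {- real n<..<real n} t *\<^sub>R F b t = F b t"
            using eventually_ge_at_top[of N] by eventually_elim (use N in \<open>auto simp: indicator_def\<close>)
        qed
      qed (use F_int in \<open>auto simp: indicator_def\<close>)
      moreover have "(CLBINT t=- real n..real n. F b t) = (LBINT t. indicator {- real n<..<real n} t *\<^sub>R F b t)" for n :: nat
        by (simp add: interval_lebesgue_integral_def set_lebesgue_integral_def)
      ultimately show ?thesis by simp
    qed
    then have "(\<lambda>n::nat. 1 / (2 * pi) * (CLBINT t=- real n..real n. F b t)) \<longlonglongrightarrow> 1 / (2 * pi) * (LBINT t. F b t)"
      by (rule tendsto_mult_left)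
    moreover have "(\<lambda>n::nat. 1 / (2 * pi) * (CLBINT t=- real n..real n. F b t)) \<longlonglongrightarrow> measure M {a<..b}"
      unfolding F_def using Levy_Inversion[OF b null null] by simp
    ultimately have "1 / (2 * pi) * (LBINT t. F b t) = measure M {a<..b}" by (rule LIMSEQ_unique)
    then show ?thesis unfolding meas[OF b] by (rule sym)
  qed
  \<comment> \<open>The measure formula is available only for b >= a. The choice a = x - 1 puts x
    inside \<open>{a..x + 1}\<close>, where the derivative within the interval is unique.\<close>
  have xin: "x \<in> {a..x + 1}" by (simp add: a_def)
  have "((\<lambda>b. LBINT y=a..b. p y) has_vector_derivative p x) (at x within {a..x + 1})"
    by (rule interval_integral_FTC2) (use p(1) in \<open>auto simp: a_def intro: continuous_on_subset\<close>)
  then have "((\<lambda>b. complex_of_real (LBINT y=a..b. p y)) has_vector_derivative complex_of_real (p x)) (at x within {a..x + 1})"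
    by (intro has_vector_derivative_of_real) (simp add: has_real_derivative_iff_has_vector_derivative)
  then have 1: "((\<lambda>b. 1 / (2 * pi) * (LBINT t. F b t)) has_vector_derivative complex_of_real (p x)) (at x within {a..x + 1})"
    by (rule has_vector_derivative_transform[rotated 2]) (use xin in \<open>simp_all only: eq atLeastAtMost_iff\<close>)
  have 2: "((\<lambda>b. 1 / (2 * pi) * (LBINT t. F b t)) has_vector_derivative 1 / (2 * pi) * fourier (char M) x) (at x within {a..x + 1})"
    by (rule has_vector_derivative_mult_right[OF has_vector_derivative_at_within[OF F_deriv]])
  show ?thesis
    using vector_derivative_unique_within[OF _ 1 2] by (simp add: a_def trivial_limit_within islimpt_Icc)
qed

section \<open>Regularity of the stable density\<close>

context
  fixes \<alpha> \<beta> :: real and \<mu> :: "real measure" and p p' :: "real \<Rightarrow> real"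
  assumes \<alpha>: "1 < \<alpha>" "\<alpha> < 2"
    and stable: "is_stable_law \<alpha> 1 \<beta> \<mu>"
    and p_nonneg: "\<And>y. 0 \<le> p y"
    and \<mu>: "\<mu> = density lborel p"
    and p': "\<And>y. (p has_real_derivative p' y) (at y)"
begin

lemma continuous_stable_density: "continuous_on UNIV p"
  using p' by (intro continuous_at_imp_continuous_on) (auto intro: DERIV_isCont)

lemma char_stable: "char \<mu> = (\<lambda>t. exp (stable_exponent \<alpha> \<beta> t))"
  using stable by (auto simp: is_stable_law_def stable_cf_eq_exp)

lemma integrable_stable_cf:
  "integrable lborel (\<lambda>t. exp (stable_exponent \<alpha> \<beta> t))"
  "integrable lborel (\<lambda>t. t * exp (stable_exponent \<alpha> \<beta> t))"
  "integrable lborel (\<lambda>t. t * (t * exp (stable_exponent \<alpha> \<beta> t)))"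
  "integrable lborel (\<lambda>t. stable_exponent' \<alpha> \<beta> t * exp (stable_exponent \<alpha> \<beta> t))"
  "integrable lborel (\<lambda>t. (1 + \<alpha> + \<alpha> * stable_exponent \<alpha> \<beta> t) * stable_exponent' \<alpha> \<beta> t * exp (stable_exponent \<alpha> \<beta> t))"
  by (intro inverse_square_decay_integrable stable_cf_decay[OF \<alpha>] borel_measurable_continuous_onI
      continuous_intros continuous_stable_exponent[OF \<alpha>] continuous_stable_exponent'[OF \<alpha>])+

lemma stable_density_eq: "complex_of_real (p x) = fourier (\<lambda>t. exp (stable_exponent \<alpha> \<beta> t)) x / (2 * pi)"
proof -
  interpret real_distribution \<mu> using stable by (simp add: is_stable_law_def)
  show ?thesis
    using density_eq_fourier_char[OF continuous_stable_density p_nonneg \<mu>] integrable_stable_cf(1)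
    by (simp add: char_stable)
qed

text \<open>\<open>p'\<close> is given only as a pointwise derivative; uniqueness of derivatives
  identifies it with the result of differentiating the inversion formula.\<close>

lemma stable_density_deriv_eq:
  "complex_of_real (p' x) = - \<i> * fourier (\<lambda>t. t * exp (stable_exponent \<alpha> \<beta> t)) x / (2 * pi)"
proof -
  have "((\<lambda>x. complex_of_real (p x)) has_vector_derivative complex_of_real (p' x)) (at x)"
    by (intro has_vector_derivative_of_real p')
  moreover have "((\<lambda>x. complex_of_real (p x)) has_vector_derivative
      - \<i> * fourier (\<lambda>t. t * exp (stable_exponent \<alpha> \<beta> t)) x * (1 / (2 * pi))) (at x)"
    unfolding stable_density_eq
    using has_vector_derivative_mult_left[OF has_vector_derivative_fourier[OF integrable_stable_cf(1,2)], of "1 / (2 * pi)" x]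
    by simp
  ultimately show ?thesis
    by (auto dest: vector_derivative_unique_at)
qed

lemma continuous_stable_density_deriv: "continuous_on UNIV p'"
proof -
  have "isCont (fourier (\<lambda>t. t * exp (stable_exponent \<alpha> \<beta> t))) x" for x
    by (rule has_vector_derivative_continuous[OF has_vector_derivative_fourier[OF integrable_stable_cf(2,3)]])
  then have "continuous_on UNIV (\<lambda>x. Re (- \<i> * fourier (\<lambda>t. t * exp (stable_exponent \<alpha> \<beta> t)) x / (2 * pi)))"
    by (intro continuous_intros continuous_at_imp_continuous_on) auto
  moreover have "p' x = Re (- \<i> * fourier (\<lambda>t. t * exp (stable_exponent \<alpha> \<beta> t)) x / (2 * pi))" for x
    unfolding stable_density_deriv_eq[symmetric] by simp
  ultimately show ?thesis by simp
qed

text \<open>One partial integration on the Fourier side bounds |x| p(x). The limits remove the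
  boundary terms when a derivative is later moved onto p.\<close>

lemma stable_density_tendsto_0: "(p \<longlongrightarrow> 0) at_top" "(p \<longlongrightarrow> 0) at_bot"
proof -
  define C where "C = (LBINT t. norm (stable_exponent' \<alpha> \<beta> t * exp (stable_exponent \<alpha> \<beta> t)))"
  have bound: "norm (p x) \<le> C * inverse \<bar>x\<bar>" if "x \<noteq> 0" for x
  proof -
    have "fourier (\<lambda>t. stable_exponent' \<alpha> \<beta> t * exp (stable_exponent \<alpha> \<beta> t)) x = \<i> * x * fourier (\<lambda>t. exp (stable_exponent \<alpha> \<beta> t)) x"
      by (intro fourier_by_parts has_vector_derivative_exp_stable_exponent stable_cf_decay \<alpha>
          continuous_intros continuous_stable_exponent[OF \<alpha>] continuous_stable_exponent'[OF \<alpha>])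
    also have "fourier (\<lambda>t. exp (stable_exponent \<alpha> \<beta> t)) x = 2 * pi * complex_of_real (p x)"
      by (simp add: stable_density_eq)
    finally have "\<bar>x\<bar> * (2 * pi * \<bar>p x\<bar>) = norm (fourier (\<lambda>t. stable_exponent' \<alpha> \<beta> t * exp (stable_exponent \<alpha> \<beta> t)) x)"
      by (simp add: norm_mult)
    also have "\<dots> \<le> C" unfolding C_def by (rule norm_fourier_le[OF integrable_stable_cf(4)])
    finally have "\<bar>x\<bar> * (2 * pi * \<bar>p x\<bar>) \<le> C" .
    moreover have "\<bar>x\<bar> * (1 * \<bar>p x\<bar>) \<le> \<bar>x\<bar> * (2 * pi * \<bar>p x\<bar>)"
      using pi_gt3 by (intro mult_left_mono mult_right_mono) auto
    ultimately have "\<bar>x\<bar> * \<bar>p x\<bar> \<le> C" by simp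
    then show ?thesis using that by (simp add: field_simps)
  qed
  have "((\<lambda>x::real. C * inverse \<bar>x\<bar>) \<longlongrightarrow> 0) at_top" "((\<lambda>x::real. C * inverse \<bar>x\<bar>) \<longlongrightarrow> 0) at_bot"
    by (intro tendsto_mult_right_zero tendsto_inverse_0_at_top filterlim_abs_real filterlim_compose[OF filterlim_abs_real filterlim_uminus_at_top_at_bot, simplified])+
  moreover have "\<forall>\<^sub>F x in at_top. norm (p x) \<le> C * inverse \<bar>x\<bar>" "\<forall>\<^sub>F x in at_bot. norm (p x) \<le> C * inverse \<bar>x\<bar>"
    by (rule eventually_mono[OF eventually_gt_at_top[of 0]], rule bound, simp)
       (rule eventually_mono[OF eventually_gt_at_bot[of 0]], rule bound, simp)
  ultimately show "(p \<longlongrightarrow> 0) at_top" "(p \<longlongrightarrow> 0) at_bot"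
    by (auto intro: Lim_null_comparison)
qed

text \<open>Two partial integrations of the transform of t exp(\<psi>(t)) bound x^2 |p'(x)|; adding
  the direct bound on |p'(x)| gives the integrable majorant.\<close>

lemma integrable_stable_density_deriv: "integrable lborel p'"
proof -
  let ?g = "\<lambda>t. t * exp (stable_exponent \<alpha> \<beta> t)"
  let ?g' = "\<lambda>t. (1 + \<alpha> * stable_exponent \<alpha> \<beta> t) * exp (stable_exponent \<alpha> \<beta> t)"
  let ?g'' = "\<lambda>t. (1 + \<alpha> + \<alpha> * stable_exponent \<alpha> \<beta> t) * stable_exponent' \<alpha> \<beta> t * exp (stable_exponent \<alpha> \<beta> t)"
  define C where "C = (LBINT t. norm (?g t)) + (LBINT t. norm (?g'' t))"
  have bound: "norm (p' x) \<le> C * inverse (1 + x\<^sup>2)" for x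
  proof -
    have "fourier ?g'' x = \<i> * x * fourier ?g' x" "fourier ?g' x = \<i> * x * fourier ?g x"
      by (intro fourier_by_parts has_vector_derivative_mult_stable_cf has_vector_derivative_mult_stable_cf' stable_cf_decay \<alpha>
          continuous_intros continuous_stable_exponent[OF \<alpha>] continuous_stable_exponent'[OF \<alpha>])+
    then have "norm (fourier ?g'' x) = x\<^sup>2 * norm (fourier ?g x)"
      by (simp add: norm_mult power2_eq_square abs_mult[symmetric] mult.assoc[symmetric])
    then have "(1 + x\<^sup>2) * norm (fourier ?g x) \<le> C"
      using norm_fourier_le[OF integrable_stable_cf(2), of x] norm_fourier_le[OF integrable_stable_cf(5), of x]
      by (simp add: C_def algebra_simps)
    moreover have "fourier ?g x = \<i> * (2 * pi * complex_of_real (p' x))"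
      by (simp add: stable_density_deriv_eq)
    then have "norm (fourier ?g x) = 2 * pi * \<bar>p' x\<bar>" by (simp add: norm_mult)
    moreover have "1 * \<bar>p' x\<bar> \<le> 2 * pi * \<bar>p' x\<bar>"
      using pi_gt3 by (intro mult_right_mono) auto
    ultimately have "(1 + x\<^sup>2) * \<bar>p' x\<bar> \<le> C"
      using mult_left_mono[of "1 * \<bar>p' x\<bar>" "2 * pi * \<bar>p' x\<bar>" "1 + x\<^sup>2"] by simp
    moreover have "1 + x\<^sup>2 > 0" by (simp add: add_pos_nonneg)
    ultimately show ?thesis by (simp add: divide_inverse[symmetric] pos_le_divide_eq mult.commute)
  qed
  show ?thesis
    by (rule Bochner_Integration.integrable_bound[OF integrable_inverse_1_plus_square_lborel[of C]])
       (use order_trans[OF bound abs_ge_self] borel_measurable_continuous_onI[OF continuous_stable_density_deriv] in \<open>auto simp del: abs_mult\<close>)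
qed

end

section \<open>First moment and a Beta integral\<close>

text \<open>The Taylor value s^2 / 2 loses at most |s|^3 / 6 <= s^2 / 6, which leaves one
  third.\<close>

lemma one_minus_cos_ge:
  fixes s :: real
  assumes "\<bar>s\<bar> \<le> 1"
  shows "s\<^sup>2 / 3 \<le> 1 - cos s"
proof -
  have sum: "(\<Sum>k \<le> 2. (\<i> * complex_of_real s) ^ k / fact k) = 1 + \<i> * s - s\<^sup>2 / 2"
  proof -
    have "{..2::nat} = {0, 1, 2}" by auto
    then show ?thesis by (simp add: power_mult_distrib)
  qed
  have "\<bar>cos s - 1 + s\<^sup>2 / 2\<bar> \<le> norm (iexp s - (1 + \<i> * s - s\<^sup>2 / 2))"
    using abs_Re_le_cmod[of "iexp s - (1 + \<i> * s - s\<^sup>2 / 2)"] by (simp add: Re_exp)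
  also have "\<dots> \<le> \<bar>s\<bar> ^ 3 / 6"
    using iexp_approx1[of s 2] unfolding sum by (simp add: numeral_3_eq_3 fact_numeral)
  also have "\<bar>s\<bar> ^ 3 / 6 \<le> s\<^sup>2 / 6"
    using assms mult_left_le[of "\<bar>s\<bar>" "s\<^sup>2"] by (simp add: power3_eq_cube power2_eq_square mult.assoc)
  finally have "\<bar>cos s - 1 + s\<^sup>2 / 2\<bar> \<le> s\<^sup>2 / 6" .
  from order_trans[OF abs_ge_self this] show ?thesis by linarith
qed

text \<open>For |y| > 1 the integral of (1 - cos(t y)) / t^2 over 0 < t < 1 is at least |y| / 3.
  Averaging over y and exchanging the integrals replaces 1 - cos by 1 minus the real part of the
  characteristic function, and the resulting bound C t powr (\<alpha> - 2) is integrable at 0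
  because \<alpha> > 1.\<close>

lemma (in real_distribution) integrable_if_char_powr_bound:
  assumes \<alpha>: "1 < \<alpha>" and C: "\<And>t. norm (1 - char M t) \<le> C * \<bar>t\<bar> powr \<alpha>"
  shows "integrable M (\<lambda>x. x)"
proof -
  interpret P: pair_sigma_finite lborel M ..
  let ?k = "\<lambda>t y. ennreal (indicator {0<..<1} t * ((1 - cos (t * y)) / t\<^sup>2))"
  have k_nonneg: "0 \<le> indicator {0<..<1} t * ((1 - cos (t * y)) / t\<^sup>2)" for t y :: real
    by simp
  \<comment> \<open>Only t < 1 / |y| is kept, where 1 - cos(t y) >= (t y)^2 / 3; that interval has
    length 1 / |y| and lies in (0, 1) because |y| > 1.\<close>
  have lower: "ennreal (\<bar>y\<bar> / 3) \<le> (\<integral>\<^sup>+ t. ?k t y \<partial>lborel)" if y: "\<bar>y\<bar> > 1" for y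
  proof -
    have "ennreal (\<bar>y\<bar> / 3) = ennreal (y\<^sup>2 / 3) * ennreal (1 / \<bar>y\<bar>)"
      using y by (simp add: power2_eq_square abs_mult[symmetric] field_simps flip: ennreal_mult)
    also have "ennreal (1 / \<bar>y\<bar>) = emeasure lborel {0<..<1 / \<bar>y\<bar>}" using y by simp
    also have "ennreal (y\<^sup>2 / 3) * \<dots> = (\<integral>\<^sup>+ t. ennreal (y\<^sup>2 / 3) * indicator {0<..<1 / \<bar>y\<bar>} t \<partial>lborel)"
      by (rule nn_integral_cmult_indicator[symmetric]) simp
    also have "\<dots> \<le> (\<integral>\<^sup>+ t. ?k t y \<partial>lborel)"
    proof (rule nn_integral_mono)
      fix t :: real
      show "ennreal (y\<^sup>2 / 3) * indicator {0<..<1 / \<bar>y\<bar>} t \<le> ?k t y"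
      proof (cases "t \<in> {0<..<1 / \<bar>y\<bar>}")
        case True
        then have t: "0 < t" "t * \<bar>y\<bar> < 1" using y by (auto simp: field_simps)
        have "t * 1 \<le> t * \<bar>y\<bar>" using t y by (intro mult_left_mono) auto
        then have "t < 1" using t by linarith
        have "(t * y)\<^sup>2 / 3 \<le> 1 - cos (t * y)"
          using t by (intro one_minus_cos_ge) (simp add: abs_mult)
        then have "y\<^sup>2 / 3 \<le> (1 - cos (t * y)) / t\<^sup>2"
          using t by (simp add: field_simps power_mult_distrib)
        then show ?thesis using True t \<open>t < 1\<close> by (simp add: ennreal_leI)
      qed simp
    qed
    finally show ?thesis .
  qed
  have inner: "(\<integral>\<^sup>+ y. ?k t y \<partial>M) \<le> ennreal (indicator {0<..<1} t *\<^sub>R (C * t powr (\<alpha> - 2)))" for t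
  proof (cases "t \<in> {0<..<1}")
    case True
    have int: "integrable M (\<lambda>y. iexp (t * y))" by (rule integrable_iexp) auto
    have int': "integrable M (\<lambda>y. (1 - cos (t * y)) / t\<^sup>2)"
      using integrable_Re[OF int] by (simp add: Re_exp)
    have "(\<integral>\<^sup>+ y. ?k t y \<partial>M) = (\<integral>\<^sup>+ y. ennreal ((1 - cos (t * y)) / t\<^sup>2) \<partial>M)"
      using True by simp
    also have "\<dots> = ennreal (LINT y|M. (1 - cos (t * y)) / t\<^sup>2)"
      by (rule nn_integral_eq_integral[OF int']) simp
    also have "(LINT y|M. (1 - cos (t * y)) / t\<^sup>2) = (1 - Re (char M t)) / t\<^sup>2"
    proof -
      have "(LINT y|M. cos (t * y)) = Re (char M t)"
        unfolding char_def integral_Re[OF int, symmetric] by (simp add: Re_exp)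
      moreover have "integrable M (\<lambda>y. cos (t * y))"
        using integrable_Re[OF int] by (simp add: Re_exp)
      ultimately show ?thesis using prob_space by simp
    qed
    also have "\<dots> \<le> C * t powr (\<alpha> - 2)"
    proof -
      have "1 - Re (char M t) \<le> norm (1 - char M t)"
        using complex_Re_le_cmod[of "1 - char M t"] by simp
      also have "\<dots> \<le> C * t powr \<alpha>" using C[of t] True by simp
      finally have "(1 - Re (char M t)) / t\<^sup>2 \<le> C * t powr \<alpha> / t\<^sup>2" by (rule divide_right_mono) simp
      then show ?thesis using True by (simp add: powr_diff)
    qed
    finally show ?thesis using True by (simp add: ennreal_leI)
  qed simp
  have "(\<lambda>y. y powr (\<alpha> - 2)) integrable_on {0..1}"
    using \<alpha> by (intro integrable_on_powr_from_0) auto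
  then have "(\<lambda>y. y powr (\<alpha> - 2)) absolutely_integrable_on {0..1}"
    by (intro nonnegative_absolutely_integrable_1) auto
  then have "set_integrable lborel {0..1} (\<lambda>y. y powr (\<alpha> - 2))"
    unfolding set_integrable_def by (subst (asm) integrable_completion) auto
  then have "set_integrable lborel {0<..<1} (\<lambda>y. C * y powr (\<alpha> - 2))"
    by (intro set_integrable_mult_right) (rule set_integrable_subset, auto)
  then have fin: "(\<integral>\<^sup>+ t. ennreal (indicator {0<..<1} t *\<^sub>R (C * t powr (\<alpha> - 2))) \<partial>lborel) < \<infinity>"
    unfolding set_integrable_def real_integrable_def by (simp add: less_top)
  have "(\<integral>\<^sup>+ y. ennreal (norm y) \<partial>M) \<le> (\<integral>\<^sup>+ y. 1 + 3 * (\<integral>\<^sup>+ t. ?k t y \<partial>lborel) \<partial>M)"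
  proof (rule nn_integral_mono)
    fix y
    show "ennreal (norm y) \<le> 1 + 3 * (\<integral>\<^sup>+ t. ?k t y \<partial>lborel)"
    proof (cases "\<bar>y\<bar> \<le> 1")
      case True
      then have "ennreal (norm y) \<le> 1" by (simp add: ennreal_le_1)
      then show ?thesis by (rule order_trans) simp
    next
      case False
      then have "ennreal (norm y) = 3 * ennreal (\<bar>y\<bar> / 3)"
        by (simp add: ennreal_numeral[symmetric] del: ennreal_numeral flip: ennreal_mult)
      also have "\<dots> \<le> 3 * (\<integral>\<^sup>+ t. ?k t y \<partial>lborel)"
        using lower False by (intro mult_left_mono) auto
      finally show ?thesis by (rule order_trans) simp
    qed
  qed
  also have "\<dots> = 1 + 3 * (\<integral>\<^sup>+ y. (\<integral>\<^sup>+ t. ?k t y \<partial>lborel) \<partial>M)"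
    by (subst nn_integral_add) (auto simp: nn_integral_cmult emeasure_space_1[simplified])
  also have "(\<integral>\<^sup>+ y. (\<integral>\<^sup>+ t. ?k t y \<partial>lborel) \<partial>M) = (\<integral>\<^sup>+ t. (\<integral>\<^sup>+ y. ?k t y \<partial>M) \<partial>lborel)"
    by (rule P.Fubini') measurable
  also have "\<dots> \<le> (\<integral>\<^sup>+ t. ennreal (indicator {0<..<1} t *\<^sub>R (C * t powr (\<alpha> - 2))) \<partial>lborel)"
    by (intro nn_integral_mono inner)
  finally have "(\<integral>\<^sup>+ y. ennreal (norm y) \<partial>M) \<le> 1 + 3 * (\<integral>\<^sup>+ t. ennreal (indicator {0<..<1} t *\<^sub>R (C * t powr (\<alpha> - 2))) \<partial>lborel)"
    by (simp add: add_left_mono mult_left_mono)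
  also have "\<dots> < \<infinity>" using fin by (simp add: ennreal_mult_less_top less_top)
  finally show ?thesis by (intro integrableI_bounded) auto
qed

text \<open>With v = r powr \<alpha> one has dv = \<alpha> r powr (\<alpha> - 1) dr and v powr (2 /
  \<alpha> - 1) = r powr (2 - \<alpha>), with product \<alpha> r dr. The prefactor \<alpha> of the
  Stein solution is thus used up by the substitution, and the remaining power is 1 / c_r.\<close>

lemma Beta_substitution:
  fixes \<alpha> :: real
  assumes \<alpha>: "1 < \<alpha>" "\<alpha> < 2"
  shows "set_integrable lborel {0<..<1} (\<lambda>r. r * (1 - r powr \<alpha>) powr (- 1 / \<alpha>))"
    and "\<alpha> * (LBINT r:{0<..<1}. r * (1 - r powr \<alpha>) powr (- 1 / \<alpha>)) = Beta (2 / \<alpha>) (1 - 1 / \<alpha>)"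
proof -
  let ?S = "{0<..<1::real}"
  let ?f = "\<lambda>t. t powr (2 / \<alpha> - 1) * (1 - t) powr (1 - 1 / \<alpha> - 1)"
  let ?g = "\<lambda>r. \<alpha> * (r * (1 - r powr \<alpha>) powr (- 1 / \<alpha>))"
  have lt1: "r powr a < 1" if "0 < r" "r < 1" "0 < a" for r a :: real
    using powr_less_mono2[of a r 1] that by simp
  have \<alpha>0: "0 < \<alpha>" using \<alpha> by simp
  have img: "(\<lambda>r. r powr \<alpha>) ` ?S = ?S"
  proof
    show "(\<lambda>r. r powr \<alpha>) ` ?S \<subseteq> ?S"
      using \<alpha>0 by (auto intro: lt1)
    show "?S \<subseteq> (\<lambda>r. r powr \<alpha>) ` ?S"
    proof
      fix v assume v: "v \<in> ?S"
      then have "v = (v powr (1 / \<alpha>)) powr \<alpha>" "v powr (1 / \<alpha>) \<in> ?S"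
        using \<alpha>0 by (auto simp: powr_powr intro!: lt1)
      then show "v \<in> (\<lambda>r. r powr \<alpha>) ` ?S" by blast
    qed
  qed
  have "(?f has_integral Beta (2 / \<alpha>) (1 - 1 / \<alpha>)) {0..1}"
    using \<alpha> by (intro has_integral_Beta_real) auto
  then have f: "(?f has_integral Beta (2 / \<alpha>) (1 - 1 / \<alpha>)) ?S"
    using has_integral_open_interval[of ?f "Beta (2 / \<alpha>) (1 - 1 / \<alpha>)" 0 1] by (simp only: box_real)
  have "?f absolutely_integrable_on ((\<lambda>r. r powr \<alpha>) ` ?S) \<and> integral ((\<lambda>r. r powr \<alpha>) ` ?S) ?f = Beta (2 / \<alpha>) (1 - 1 / \<alpha>)"
    unfolding img using f by (auto intro!: nonnegative_absolutely_integrable_1 has_integral_integrable integral_unique)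
  moreover have "(\<lambda>r. \<bar>\<alpha> * r powr (\<alpha> - 1)\<bar> * ?f (r powr \<alpha>)) absolutely_integrable_on ?S \<and>
      integral ?S (\<lambda>r. \<bar>\<alpha> * r powr (\<alpha> - 1)\<bar> * ?f (r powr \<alpha>)) = Beta (2 / \<alpha>) (1 - 1 / \<alpha>) \<longleftrightarrow>
     ?f absolutely_integrable_on ((\<lambda>r. r powr \<alpha>) ` ?S) \<and> integral ((\<lambda>r. r powr \<alpha>) ` ?S) ?f = Beta (2 / \<alpha>) (1 - 1 / \<alpha>)"
  proof (rule has_absolute_integral_change_of_variables_1')
    show "((\<lambda>r. r powr \<alpha>) has_field_derivative \<alpha> * r powr (\<alpha> - 1)) (at r within ?S)" if "r \<in> ?S" for r
      using that by (auto intro!: derivative_eq_intros)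
    show "inj_on (\<lambda>r. r powr \<alpha>) ?S"
      using \<alpha> by (intro inj_on_inverseI[where g = "\<lambda>v. v powr (1 / \<alpha>)"]) (auto simp: powr_powr)
  qed simp
  ultimately have A: "(\<lambda>r. \<bar>\<alpha> * r powr (\<alpha> - 1)\<bar> * ?f (r powr \<alpha>)) absolutely_integrable_on ?S"
      and I: "integral ?S (\<lambda>r. \<bar>\<alpha> * r powr (\<alpha> - 1)\<bar> * ?f (r powr \<alpha>)) = Beta (2 / \<alpha>) (1 - 1 / \<alpha>)" by blast+
  have eq: "\<bar>\<alpha> * r powr (\<alpha> - 1)\<bar> * ?f (r powr \<alpha>) = ?g r" if "r \<in> ?S" for r
  proof -
    have "(r powr \<alpha>) powr (2 / \<alpha> - 1) = r powr (2 - \<alpha>)"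
      using \<alpha> by (simp add: powr_powr algebra_simps)
    moreover have "r powr (\<alpha> - 1) * r powr (2 - \<alpha>) = r"
      using that by (simp flip: powr_add)
    ultimately have "\<bar>\<alpha> * r powr (\<alpha> - 1)\<bar> * (r powr \<alpha>) powr (2 / \<alpha> - 1) = \<alpha> * r"
      using \<alpha> by (simp add: abs_mult)
    then show ?thesis by (simp add: mult.assoc[symmetric])
  qed
  have g: "?g absolutely_integrable_on ?S" "integral ?S ?g = Beta (2 / \<alpha>) (1 - 1 / \<alpha>)"
    by (rule iffD1[OF set_integrable_cong[OF refl refl eq] A], assumption)
       (rule trans[OF Henstock_Kurzweil_Integration.integral_cong[OF eq[symmetric]] I], assumption)
  have g': "set_integrable lborel ?S ?g"
    using g(1) unfolding set_integrable_def by (subst (asm) integrable_completion) auto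
  then show "set_integrable lborel ?S (\<lambda>r. r * (1 - r powr \<alpha>) powr (- 1 / \<alpha>))"
    using \<alpha> by (subst (asm) set_integrable_mult_right_iff) auto
  have "\<alpha> * (LBINT r:?S. r * (1 - r powr \<alpha>) powr (- 1 / \<alpha>)) = (LBINT r:?S. ?g r)" by simp
  also have "\<dots> = integral ?S ?g" by (rule set_borel_integral_eq_integral(2)[OF g'])
  finally show "\<alpha> * (LBINT r:?S. r * (1 - r powr \<alpha>) powr (- 1 / \<alpha>)) = Beta (2 / \<alpha>) (1 - 1 / \<alpha>)"
    unfolding g(2) .
qed

section \<open>Trigonometric polynomials\<close>

text \<open>Moves the derivative from \<open>f\<close> to the density at the price of 1 / c. The
  bound \<open>B\<close> secures integrability, while the estimate sees only the bound
  \<open>A\<close> on \<open>f\<close>. Applied to f = h', it turns |h'| <= 1 into a bound on E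
  h''.\<close>

lemma density_by_parts:
  fixes f f' p p' :: "real \<Rightarrow> real"
  assumes c: "c > 0"
    and f: "\<And>y. (f has_real_derivative f' y) (at y)" "continuous_on UNIV f'" "\<And>y. \<bar>f y\<bar> \<le> A" "\<And>y. \<bar>f' y\<bar> \<le> B"
    and p: "\<And>y. (p has_real_derivative p' y) (at y)" "continuous_on UNIV p'" "integrable lborel p" "integrable lborel p'"
    and lim: "(p \<longlongrightarrow> 0) at_top" "(p \<longlongrightarrow> 0) at_bot"
  shows "\<bar>LBINT y. f' (a + c * y) * p y\<bar> \<le> A / c * (LBINT y. \<bar>p' y\<bar>)"
proof -
  let ?F = "\<lambda>y. f (a + c * y) * p y"
  have cf: "continuous_on UNIV f" using f(1) by (intro continuous_at_imp_continuous_on) (auto intro: DERIV_isCont)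
  have cp: "continuous_on UNIV p" using p(1) by (intro continuous_at_imp_continuous_on) (auto intro: DERIV_isCont)
  have comp: "continuous_on UNIV (\<lambda>y. g (a + c * y))" if "continuous_on UNIV g" for g :: "real \<Rightarrow> real"
    by (rule continuous_on_compose2[OF that]) (auto intro!: continuous_intros)
  note [measurable] = borel_measurable_continuous_onI[OF comp[OF f(2)]] borel_measurable_continuous_onI[OF comp[OF cf]]
    borel_measurable_continuous_onI[OF cp] borel_measurable_continuous_onI[OF p(2)]
  have int1: "integrable lborel (\<lambda>y. f' (a + c * y) * p y)"
    by (rule Bochner_Integration.integrable_bound[OF integrable_mult_right[OF integrable_abs[OF p(3)], of B]])
       (auto simp: abs_mult intro!: mult_right_mono order_trans[OF f(4) abs_ge_self])
  have int2: "integrable lborel (\<lambda>y. f (a + c * y) * p' y)"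
    by (rule Bochner_Integration.integrable_bound[OF integrable_mult_right[OF integrable_abs[OF p(4)], of A]])
       (auto simp: abs_mult intro!: mult_right_mono order_trans[OF f(3) abs_ge_self])
  have limF: "(?F \<longlongrightarrow> 0) F" if "(p \<longlongrightarrow> 0) F" for F
  proof (rule Lim_null_comparison)
    show "\<forall>\<^sub>F y in F. norm (?F y) \<le> A * \<bar>p y\<bar>"
      by (intro always_eventually allI) (simp add: abs_mult mult_right_mono f(3))
    show "((\<lambda>y. A * \<bar>p y\<bar>) \<longlongrightarrow> 0) F"
      using that by (intro tendsto_mult_right_zero tendsto_rabs_zero)
  qed
  have "(LBINT y=-\<infinity>..\<infinity>. c * (f' (a + c * y) * p y) + f (a + c * y) * p' y) = 0 - 0"
  proof (rule interval_integral_FTC_integrable[where F = ?F])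
    show "(?F has_vector_derivative c * (f' (a + c * y) * p y) + f (a + c * y) * p' y) (at y)" for y
    proof -
      have "((\<lambda>y. f (a + c * y)) has_real_derivative f' (a + c * y) * c) (at y)"
        by (rule DERIV_chain2[OF f(1)]) (auto intro!: derivative_eq_intros)
      from DERIV_mult[OF this p(1)] show ?thesis
        unfolding has_real_derivative_iff_has_vector_derivative by (simp add: algebra_simps)
    qed
    show "isCont (\<lambda>y. c * (f' (a + c * y) * p y) + f (a + c * y) * p' y) y" for y
      using comp[OF f(2)] comp[OF cf] cp p(2) by (auto simp: continuous_on_eq_continuous_at intro!: continuous_intros)
    show "set_integrable lborel (einterval (-\<infinity>) \<infinity>) (\<lambda>y. c * (f' (a + c * y) * p y) + f (a + c * y) * p' y)"
      using Bochner_Integration.integrable_add[OF integrable_mult_right[OF int1, of c] int2] by (simp add: set_integrable_def)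
  qed (use limF lim in \<open>simp_all only: ereal_tendsto_simps, simp\<close>)
  then have "c * (LBINT y. f' (a + c * y) * p y) + (LBINT y. f (a + c * y) * p' y) = 0"
    using Bochner_Integration.integral_add[OF integrable_mult_right[OF int1, of c] int2]
    by (simp add: interval_lebesgue_integral_def set_lebesgue_integral_def)
  then have "c * (LBINT y. f' (a + c * y) * p y) = - (LBINT y. f (a + c * y) * p' y)" by simp
  then have "c * \<bar>LBINT y. f' (a + c * y) * p y\<bar> = \<bar>LBINT y. f (a + c * y) * p' y\<bar>"
    using c by (metis abs_minus_cancel abs_mult abs_of_pos)
  also have "\<dots> \<le> (LBINT y. A * \<bar>p' y\<bar>)"
    by (rule integral_abs_bound[THEN order_trans], rule integral_mono)
       (use integrable_abs[OF int2] p(4) in \<open>auto simp: abs_mult intro!: mult_right_mono f(3)\<close>)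
  finally show ?thesis using c by (simp add: field_simps)
qed

text \<open>Lists of coefficient and frequency pairs, where frequencies may repeat: addition is
  concatenation, and linear statements become list inductions.\<close>

definition trig_eval :: "(complex \<times> real) list \<Rightarrow> real \<Rightarrow> complex" where
  "trig_eval cs x = (\<Sum>(c, s)\<leftarrow>cs. c * iexp (s * x))"

definition trig_deriv :: "(complex \<times> real) list \<Rightarrow> (complex \<times> real) list" where
  "trig_deriv cs = map (\<lambda>(c, s). (c * (\<i> * s), s)) cs"

lemma trig_eval_simps [simp]:
  "trig_eval [] x = 0"
  "trig_eval ((c, s) # cs) x = c * iexp (s * x) + trig_eval cs x"
  by (simp_all add: trig_eval_def)

lemma trig_deriv_simps [simp]:
  "trig_deriv [] = []"
  "trig_deriv ((c, s) # cs) = (c * (\<i> * s), s) # trig_deriv cs"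
  by (simp_all add: trig_deriv_def)

lemma trig_eval_append [simp]: "trig_eval (cs @ ds) x = trig_eval cs x + trig_eval ds x"
  by (simp add: trig_eval_def)

lemma has_vector_derivative_trig_eval:
  "(trig_eval cs has_vector_derivative trig_eval (trig_deriv cs) x) (at x)"
proof (induction cs)
  case Nil
  then show ?case by (simp add: trig_eval_def[abs_def])
next
  case (Cons a cs)
  obtain c s where a: "a = (c, s)" by (cases a)
  have "((\<lambda>x. c * iexp (s * x) + trig_eval cs x) has_vector_derivative c * (\<i> * s * iexp (s * x)) + trig_eval (trig_deriv cs) x) (at x)"
    by (intro has_vector_derivative_add has_vector_derivative_mult_right has_vector_derivative_iexp Cons.IH)
  then show ?case by (simp add: a mult_ac)
qed

lemma continuous_trig_eval: "continuous_on UNIV (trig_eval cs)"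
  by (intro continuous_at_imp_continuous_on) (auto intro: has_vector_derivative_continuous[OF has_vector_derivative_trig_eval])

lemma borel_measurable_trig_eval [measurable]: "trig_eval cs \<in> borel_measurable borel"
  by (rule borel_measurable_continuous_onI[OF continuous_trig_eval])

lemma norm_trig_eval_le: "norm (trig_eval cs x) \<le> (\<Sum>(c, s)\<leftarrow>cs. norm c)"
  by (induction cs) (auto simp: norm_mult intro!: norm_triangle_le add_left_mono)

definition stein_trig :: "real \<Rightarrow> real \<Rightarrow> (complex \<times> real) list \<Rightarrow> real \<Rightarrow> complex" where
  "stein_trig \<alpha> \<beta> cs x = (\<Sum>(c, s)\<leftarrow>cs. c * stein_exp \<alpha> \<beta> s x)"

definition stein_trig' :: "real \<Rightarrow> real \<Rightarrow> (complex \<times> real) list \<Rightarrow> real \<Rightarrow> complex" where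
  "stein_trig' \<alpha> \<beta> cs x = (\<Sum>(c, s)\<leftarrow>cs. c * stein_exp' \<alpha> \<beta> s x)"

definition stein_trig'' :: "real \<Rightarrow> real \<Rightarrow> (complex \<times> real) list \<Rightarrow> real \<Rightarrow> complex" where
  "stein_trig'' \<alpha> \<beta> cs x = (\<Sum>(c, s)\<leftarrow>cs. c * stein_exp'' \<alpha> \<beta> s x)"

lemma stein_trig_simps [simp]:
  "stein_trig \<alpha> \<beta> [] x = 0" "stein_trig' \<alpha> \<beta> [] x = 0" "stein_trig'' \<alpha> \<beta> [] x = 0"
  "stein_trig \<alpha> \<beta> ((c, s) # cs) x = c * stein_exp \<alpha> \<beta> s x + stein_trig \<alpha> \<beta> cs x"
  "stein_trig' \<alpha> \<beta> ((c, s) # cs) x = c * stein_exp' \<alpha> \<beta> s x + stein_trig' \<alpha> \<beta> cs x"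
  "stein_trig'' \<alpha> \<beta> ((c, s) # cs) x = c * stein_exp'' \<alpha> \<beta> s x + stein_trig'' \<alpha> \<beta> cs x"
  by (simp_all add: stein_trig_def stein_trig'_def stein_trig''_def)

lemma has_vector_derivative_stein_trig:
  assumes \<alpha>: "1 < \<alpha>" "\<alpha> < 2"
  shows
  "(stein_trig \<alpha> \<beta> cs has_vector_derivative stein_trig' \<alpha> \<beta> cs x) (at x)"
proof (induction cs)
  case (Cons a cs)
  obtain c s where a: "a = (c, s)" by (cases a)
  show ?case unfolding a stein_trig_simps[abs_def]
    by (intro has_vector_derivative_add has_vector_derivative_mult_right has_vector_derivative_stein_exp \<alpha> Cons.IH)
qed (simp add: stein_trig_simps[abs_def])

lemma has_vector_derivative_stein_trig':
  assumes \<alpha>: "1 < \<alpha>" "\<alpha> < 2"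
  shows
  "(stein_trig' \<alpha> \<beta> cs has_vector_derivative stein_trig'' \<alpha> \<beta> cs x) (at x)"
proof (induction cs)
  case (Cons a cs)
  obtain c s where a: "a = (c, s)" by (cases a)
  show ?case unfolding a stein_trig_simps[abs_def]
    by (intro has_vector_derivative_add has_vector_derivative_mult_right has_vector_derivative_stein_exp' \<alpha> Cons.IH)
qed (simp add: stein_trig_simps[abs_def])

lemma continuous_stein_trig'':
  assumes \<alpha>: "1 < \<alpha>" "\<alpha> < 2"
  shows "continuous_on UNIV (stein_trig'' \<alpha> \<beta> cs)"
proof (induction cs)
  case (Cons a cs)
  obtain c s where a: "a = (c, s)" by (cases a)
  show ?case unfolding a stein_trig_simps[abs_def]
    by (intro continuous_intros continuous_stein_exp'' \<alpha> Cons.IH)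
qed (simp add: stein_trig_simps[abs_def])

text \<open>Interface between the Fourier part and the Stein part: the law is represented by its
  density alone, with its characteristic function and what partial integration against it
  requires.\<close>

locale stable_density =
  fixes \<alpha> \<beta> :: real and p p' :: "real \<Rightarrow> real"
  assumes \<alpha>: "1 < \<alpha>" "\<alpha> < 2"
    and p: "\<And>y. 0 \<le> p y" "integrable lborel p"
    and p_char: "\<And>t. (LBINT y. iexp (t * y) * p y) = exp (stable_exponent \<alpha> \<beta> t)"
    and p': "\<And>y. (p has_real_derivative p' y) (at y)" "continuous_on UNIV p'" "integrable lborel p'"
    and p_lim: "(p \<longlongrightarrow> 0) at_top" "(p \<longlongrightarrow> 0) at_bot"
begin

lemma integrable_bounded_mult_density:
  fixes f :: "real \<Rightarrow> complex"
  assumes [measurable]: "f \<in> borel_measurable borel" and f: "\<And>y. norm (f y) \<le> B"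
  shows "integrable lborel (\<lambda>y. f y * p y)"
proof -
  have [measurable]: "p \<in> borel_measurable borel" using p(2) by auto
  show ?thesis
    by (rule Bochner_Integration.integrable_bound[OF integrable_mult_right[OF integrable_abs[OF p(2)], of B]])
       (auto simp: norm_mult abs_mult intro!: mult_right_mono order_trans[OF f abs_ge_self])
qed

text \<open>Integrability and equation are proved together, because splitting the integral in the
  induction step needs integrability for the tail.\<close>

lemma stein_trig_equation:
  "integrable lborel (\<lambda>u. (stein_trig \<alpha> \<beta> cs (u + x) - stein_trig \<alpha> \<beta> cs x - u * stein_trig' \<alpha> \<beta> cs x) * complex_of_real (stable_kernel \<alpha> \<beta> u)) \<and>
   d_const \<alpha> * (LBINT u. (stein_trig \<alpha> \<beta> cs (u + x) - stein_trig \<alpha> \<beta> cs x - u * stein_trig' \<alpha> \<beta> cs x) * complex_of_real (stable_kernel \<alpha> \<beta> u))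
     - x * stein_trig' \<alpha> \<beta> cs x / \<alpha> = trig_eval cs x - (LBINT y. trig_eval cs y * p y)" (is "?P cs")
proof (induction cs)
  case (Cons a cs)
  obtain c s where a: "a = (c, s)" by (cases a)
  let ?f = "\<lambda>u. (stein_trig \<alpha> \<beta> cs (u + x) - stein_trig \<alpha> \<beta> cs x - u * stein_trig' \<alpha> \<beta> cs x) * complex_of_real (stable_kernel \<alpha> \<beta> u)"
  let ?g = "\<lambda>u. (stein_exp \<alpha> \<beta> s (u + x) - stein_exp \<alpha> \<beta> s x - u * stein_exp' \<alpha> \<beta> s x) * complex_of_real (stable_kernel \<alpha> \<beta> u)"
  have eq: "(stein_trig \<alpha> \<beta> (a # cs) (u + x) - stein_trig \<alpha> \<beta> (a # cs) x - u * stein_trig' \<alpha> \<beta> (a # cs) x) * complex_of_real (stable_kernel \<alpha> \<beta> u)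
     = c * ?g u + ?f u" for u
    by (simp add: a algebra_simps)
  note f = conjunct1[OF Cons.IH] and g = integrable_mult_right[OF stein_exp_equation(1)[OF \<alpha>, of \<beta> s x], of c]
  have "(LBINT y. trig_eval (a # cs) y * p y) = (LBINT y. c * (iexp (s * y) * p y) + trig_eval cs y * p y)"
    by (simp add: a algebra_simps)
  also have "\<dots> = (LBINT y. c * (iexp (s * y) * p y)) + (LBINT y. trig_eval cs y * p y)"
    by (intro Bochner_Integration.integral_add integrable_mult_right integrable_bounded_mult_density[of _ 1]
        integrable_bounded_mult_density[OF _ norm_trig_eval_le]) auto
  also have "(LBINT y. c * (iexp (s * y) * p y)) = c * exp (stable_exponent \<alpha> \<beta> s)"
    unfolding integral_mult_right_zero p_char ..
  finally have mean: "(LBINT y. trig_eval (a # cs) y * p y) = c * exp (stable_exponent \<alpha> \<beta> s) + (LBINT y. trig_eval cs y * p y)" .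
  have "d_const \<alpha> * (LBINT u. c * ?g u + ?f u) - x * stein_trig' \<alpha> \<beta> (a # cs) x / \<alpha> = 
    c * (d_const \<alpha> * (LBINT u. ?g u) - x * stein_exp' \<alpha> \<beta> s x / \<alpha>) + (d_const \<alpha> * (LBINT u. ?f u) - x * stein_trig' \<alpha> \<beta> cs x / \<alpha>)"
    unfolding Bochner_Integration.integral_add[OF g f] integral_mult_right_zero 
    by (simp add: a algebra_simps add_divide_distrib)
  also have "\<dots> = c * (iexp (s * x) - exp (stable_exponent \<alpha> \<beta> s)) + (trig_eval cs x - (LBINT y. trig_eval cs y * p y))"
    unfolding stein_exp_equation(2)[OF \<alpha>] conjunct2[OF Cons.IH] ..
  also have "\<dots> = trig_eval (a # cs) x - (LBINT y. trig_eval (a # cs) y * p y)"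
    unfolding mean by (simp add: a algebra_simps)
  finally show ?case
    unfolding eq using Bochner_Integration.integrable_add[OF g f] by simp
qed simp

text \<open>The left side is E h(r x + c_r Z). Since c_r powr \<alpha> = 1 - r powr \<alpha>,
  homogeneity of \<psi> turns the characteristic function at s c_r into \<open>ou_factor\<close>.
  This probabilistic reading gives the bounds by averaging, which the termwise formula
  hides.\<close>

lemma trig_eval_mean:
  assumes "0 < r" "r < 1"
  shows "(LBINT y. trig_eval cs (r * x + (1 - r powr \<alpha>) powr (1 / \<alpha>) * y) * p y)
     = (\<Sum>(c, s)\<leftarrow>cs. c * (iexp (s * r * x) * ou_factor \<alpha> \<beta> s r))"
proof (induction cs)
  case (Cons a cs)
  obtain c s where a: "a = (c, s)" by (cases a)
  let ?c = "(1 - r powr \<alpha>) powr (1 / \<alpha>)"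
  have r: "r powr \<alpha> < 1" using powr_less_mono2[of \<alpha> r 1] assms \<alpha> by simp
  have [measurable]: "(\<lambda>y. trig_eval cs (r * x + ?c * y)) \<in> borel_measurable borel"
    by measurable
  have "(LBINT y. trig_eval (a # cs) (r * x + ?c * y) * p y) = 
     (LBINT y. c * iexp (s * r * x) * (iexp (s * ?c * y) * p y) + trig_eval cs (r * x + ?c * y) * p y)"
    by (intro Bochner_Integration.integral_cong refl) (simp add: a algebra_simps exp_add)
  also have "\<dots> = (LBINT y. c * iexp (s * r * x) * (iexp (s * ?c * y) * p y)) + (LBINT y. trig_eval cs (r * x + ?c * y) * p y)"
    by (intro Bochner_Integration.integral_add integrable_mult_right integrable_bounded_mult_density[of _ 1]
        integrable_bounded_mult_density[OF _ norm_trig_eval_le]) auto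
  also have "(LBINT y. c * iexp (s * r * x) * (iexp (s * ?c * y) * p y)) = c * iexp (s * r * x) * exp (stable_exponent \<alpha> \<beta> (s * ?c))"
    unfolding integral_mult_right_zero p_char ..
  also have "stable_exponent \<alpha> \<beta> (s * ?c) = complex_of_real (1 - r powr \<alpha>) * stable_exponent \<alpha> \<beta> s"
    using r \<alpha> by (subst stable_exponent_scale) (auto simp: powr_powr)
  finally show ?case unfolding Cons.IH by (simp add: a ou_factor_def)
qed simp

end

lemma abs_Re_set_integral_le:
  fixes f :: "real \<Rightarrow> complex" and g :: "real \<Rightarrow> real"
  assumes f: "set_integrable M A f" and g: "set_integrable M A g"
    and le: "\<And>r. r \<in> A \<Longrightarrow> \<bar>Re (f r)\<bar> \<le> g r"
  shows "\<bar>Re (LINT r:A|M. f r)\<bar> \<le> (LINT r:A|M. g r)"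
proof -
  have int: "integrable M (\<lambda>r. Re (indicator A r *\<^sub>R f r))"
    using f unfolding set_integrable_def by (rule integrable_Re)
  have "\<bar>Re (LINT r:A|M. f r)\<bar> = \<bar>LINT r|M. Re (indicator A r *\<^sub>R f r)\<bar>"
    using f unfolding set_lebesgue_integral_def set_integrable_def by (subst integral_Re) auto
  also have "\<dots> \<le> (LINT r|M. \<bar>Re (indicator A r *\<^sub>R f r)\<bar>)"
    by (rule integral_abs_bound)
  also have "\<dots> \<le> (LINT r|M. indicator A r *\<^sub>R g r)"
    using int g le unfolding set_integrable_def by (intro integral_mono) (auto simp: indicator_def)
  finally show ?thesis unfolding set_lebesgue_integral_def .
qed

text \<open>The coefficients of \<open>trig_deriv\<close> absorb the factor i s, so the integrand
  becomes the sum that \<open>trig_eval_mean\<close> identifies as E h'(r x + c_r Z).\<close>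

lemma stein_trig'_rep:
  assumes \<alpha>: "1 < \<alpha>" "\<alpha> < 2"
  shows
  "set_integrable lborel {0<..<1} (\<lambda>r. \<Sum>(c, s)\<leftarrow>trig_deriv cs. c * (iexp (s * r * x) * ou_factor \<alpha> \<beta> s r)) \<and>
   stein_trig' \<alpha> \<beta> cs x = - complex_of_real \<alpha> * (LBINT r:{0<..<1}. \<Sum>(c, s)\<leftarrow>trig_deriv cs. c * (iexp (s * r * x) * ou_factor \<alpha> \<beta> s r))"
proof (induction cs)
  case Nil
  then show ?case by (simp add: set_integrable_def)
next
  case (Cons a cs)
  obtain c s where a: "a = (c, s)" by (cases a)
  note 1 = set_integrable_mult_right[OF stein_exp_integrable(2)[OF \<alpha>, of s x \<beta>], of c] and 2 = conjunct1[OF Cons.IH]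
  have eq: "(\<Sum>(c, s)\<leftarrow>trig_deriv (a # cs). c * (iexp (s * r * x) * ou_factor \<alpha> \<beta> s r)) =
    c * (iexp (s * r * x) * (\<i> * s * ou_factor \<alpha> \<beta> s r)) + (\<Sum>(c, s)\<leftarrow>trig_deriv cs. c * (iexp (s * r * x) * ou_factor \<alpha> \<beta> s r))" for r
    by (simp add: a mult_ac)
  show ?case unfolding eq set_integral_add(2)[OF 1 2] set_integral_mult_right
    using set_integral_add(1)[OF 1 2] conjunct2[OF Cons.IH] by (simp add: a stein_exp'_def algebra_simps)
qed

lemma stein_trig''_rep:
  assumes \<alpha>: "1 < \<alpha>" "\<alpha> < 2"
  shows
  "set_integrable lborel {0<..<1} (\<lambda>r. r * (\<Sum>(c, s)\<leftarrow>trig_deriv (trig_deriv cs). c * (iexp (s * r * x) * ou_factor \<alpha> \<beta> s r))) \<and>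
   stein_trig'' \<alpha> \<beta> cs x = - complex_of_real \<alpha> * (LBINT r:{0<..<1}. r * (\<Sum>(c, s)\<leftarrow>trig_deriv (trig_deriv cs). c * (iexp (s * r * x) * ou_factor \<alpha> \<beta> s r)))"
proof (induction cs)
  case Nil
  then show ?case by (simp add: set_integrable_def)
next
  case (Cons a cs)
  obtain c s where a: "a = (c, s)" by (cases a)
  note 1 = set_integrable_mult_right[OF stein_exp_integrable(3)[OF \<alpha>, of s x \<beta>], of c] and 2 = conjunct1[OF Cons.IH]
  have eq: "r * (\<Sum>(c, s)\<leftarrow>trig_deriv (trig_deriv (a # cs)). c * (iexp (s * r * x) * ou_factor \<alpha> \<beta> s r)) =
    c * (iexp (s * r * x) * (\<i> * s * r * (\<i> * s * ou_factor \<alpha> \<beta> s r))) + r * (\<Sum>(c, s)\<leftarrow>trig_deriv (trig_deriv cs). c * (iexp (s * r * x) * ou_factor \<alpha> \<beta> s r))" for r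
    by (simp add: a algebra_simps)
  show ?case unfolding eq set_integral_add(2)[OF 1 2] set_integral_mult_right
    using set_integral_add(1)[OF 1 2] conjunct2[OF Cons.IH] by (simp add: a stein_exp''_def algebra_simps)
qed

section \<open>Derivative bounds for the Stein solution and the resulting test function\<close>

context stable_density
begin

lemma integral_density_eq_1: "(LBINT y. p y) = 1"
proof -
  have "complex_of_real (LBINT y. p y) = 1"
    using p_char[of 0] by simp
  then show ?thesis by simp
qed

lemma Re_trig_mean: "Re (LBINT y. trig_eval cs (a + c * y) * p y) = (LBINT y. Re (trig_eval cs (a + c * y)) * p y)"
proof -
  have "integrable lborel (\<lambda>y. trig_eval cs (a + c * y) * p y)"
    by (rule integrable_bounded_mult_density[OF _ norm_trig_eval_le]) measurable
  then show ?thesis by (subst integral_Re[symmetric]) simp_all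
qed

text \<open>An average of Re h' against the probability density p is at most 1 in absolute value,
  and r runs over an interval of length 1; only the prefactor \<alpha> remains.\<close>

lemma abs_Re_stein_trig'_le:
  assumes "\<And>x. \<bar>Re (trig_eval (trig_deriv cs) x)\<bar> \<le> 1"
  shows "\<bar>Re (stein_trig' \<alpha> \<beta> cs x)\<bar> \<le> \<alpha>"
proof -
  let ?f = "\<lambda>r. \<Sum>(c, s)\<leftarrow>trig_deriv cs. c * (iexp (s * r * x) * ou_factor \<alpha> \<beta> s r)"
  have "\<bar>Re (LBINT r:{0<..<1}. ?f r)\<bar> \<le> (LBINT r:{0<..<1::real}. 1)"
  proof (rule abs_Re_set_integral_le)
    show "set_integrable lborel {0<..<1} ?f" using stein_trig'_rep[OF \<alpha>] by blast
    show "set_integrable lborel {0<..<1::real} (\<lambda>_. 1 :: real)" by (simp add: set_integrable_def)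
    fix r :: real assume r: "r \<in> {0<..<1}"
    let ?c = "(1 - r powr \<alpha>) powr (1 / \<alpha>)"
    have "\<bar>Re (?f r)\<bar> = \<bar>LBINT y. Re (trig_eval (trig_deriv cs) (r * x + ?c * y)) * p y\<bar>"
      using trig_eval_mean[of r "trig_deriv cs" x] r
      unfolding Re_trig_mean[symmetric] by simp
    also have "\<dots> \<le> (LBINT y. \<bar>Re (trig_eval (trig_deriv cs) (r * x + ?c * y)) * p y\<bar>)"
      by (rule integral_abs_bound)
    also have "\<dots> \<le> (LBINT y. p y)"
      using p(1) mult_right_mono[OF assms p(1)]
      by (intro Bochner_Integration.integral_mono' p(2)) (auto simp: abs_mult)
    finally show "\<bar>Re (?f r)\<bar> \<le> 1" unfolding integral_density_eq_1 .
  qed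
  also have "\<dots> = 1" by (simp add: set_lebesgue_integral_def)
  finally have "\<alpha> * \<bar>Re (LBINT r:{0<..<1}. ?f r)\<bar> \<le> \<alpha> * 1"
    using \<alpha> by (intro mult_left_mono) auto
  then show ?thesis using \<alpha> by (simp add: conjunct2[OF stein_trig'_rep[OF \<alpha>]] abs_mult)
qed

text \<open>Only h' is controlled uniformly, so the second derivative is moved onto p. The cost 1 /
  c_r is singular at r = 1, but integrable there because 1 / \<alpha> < 1; the weight r is the inner
  derivative of r x.\<close>

lemma abs_Re_stein_trig''_le:
  assumes le: "\<And>x. \<bar>Re (trig_eval (trig_deriv cs) x)\<bar> \<le> 1"
  shows "\<bar>Re (stein_trig'' \<alpha> \<beta> cs x)\<bar> \<le> Beta (2 / \<alpha>) (1 - 1 / \<alpha>) * (LBINT y. \<bar>p' y\<bar>)"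
proof -
  let ?f = "\<lambda>r. complex_of_real r * (\<Sum>(c, s)\<leftarrow>trig_deriv (trig_deriv cs). c * (iexp (s * r * x) * ou_factor \<alpha> \<beta> s r))"
  let ?I = "LBINT y. \<bar>p' y\<bar>"
  let ?g = "\<lambda>r. r * (1 - r powr \<alpha>) powr (- 1 / \<alpha>)"
  have "\<bar>Re (LBINT r:{0<..<1}. ?f r)\<bar> \<le> (LBINT r:{0<..<1}. ?g r * ?I)"
  proof (rule abs_Re_set_integral_le)
    show "set_integrable lborel {0<..<1} ?f" using stein_trig''_rep[OF \<alpha>] by blast
    show "set_integrable lborel {0<..<1::real} (\<lambda>r. ?g r * ?I)"
      by (intro set_integrable_mult_left Beta_substitution(1) \<alpha>)
    fix r :: real assume r: "r \<in> {0<..<1}"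
    let ?c = "(1 - r powr \<alpha>) powr (1 / \<alpha>)"
    have c: "?c > 0" using powr_less_mono2[of \<alpha> r 1] r \<alpha> by simp
    have "\<bar>LBINT y. Re (trig_eval (trig_deriv (trig_deriv cs)) (r * x + ?c * y)) * p y\<bar> \<le> 1 / ?c * ?I"
    proof (rule density_by_parts[OF c _ _ le _ p'(1,2) p(2) p'(3) p_lim])
      show "((\<lambda>y. Re (trig_eval (trig_deriv cs) y)) has_real_derivative Re (trig_eval (trig_deriv (trig_deriv cs)) y)) (at y)" for y
        unfolding has_real_derivative_iff_has_vector_derivative
        by (rule bounded_linear.has_vector_derivative[OF bounded_linear_Re has_vector_derivative_trig_eval])
      show "continuous_on UNIV (\<lambda>y. Re (trig_eval (trig_deriv (trig_deriv cs)) y))"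
        by (intro continuous_intros continuous_trig_eval)
      show "\<bar>Re (trig_eval (trig_deriv (trig_deriv cs)) y)\<bar> \<le> (\<Sum>(c, s)\<leftarrow>trig_deriv (trig_deriv cs). norm c)" for y
        by (rule order_trans[OF abs_Re_le_cmod norm_trig_eval_le])
    qed
    then have "r * \<bar>LBINT y. Re (trig_eval (trig_deriv (trig_deriv cs)) (r * x + ?c * y)) * p y\<bar> \<le> r * (1 / ?c * ?I)"
      using r by (intro mult_left_mono) auto
    also have "1 / ?c = (1 - r powr \<alpha>) powr (- 1 / \<alpha>)"
      by (simp add: powr_minus_divide)
    finally have "r * \<bar>LBINT y. Re (trig_eval (trig_deriv (trig_deriv cs)) (r * x + ?c * y)) * p y\<bar> \<le> ?g r * ?I"
      by (simp only: mult.assoc)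
    then show "\<bar>Re (?f r)\<bar> \<le> ?g r * ?I"
      using trig_eval_mean[of r "trig_deriv (trig_deriv cs)" x] r
      unfolding Re_trig_mean[symmetric] by (simp add: abs_mult)
  qed
  then have "\<alpha> * \<bar>Re (LBINT r:{0<..<1}. ?f r)\<bar> \<le> \<alpha> * (LBINT r:{0<..<1}. ?g r * ?I)"
    using \<alpha> by (intro mult_left_mono) auto
  also have "\<dots> = Beta (2 / \<alpha>) (1 - 1 / \<alpha>) * ?I"
    unfolding Beta_substitution(2)[OF \<alpha>, symmetric] set_integral_mult_left by (simp only: mult.assoc)
  finally show ?thesis using \<alpha> by (simp add: conjunct2[OF stein_trig''_rep[OF \<alpha>]] abs_mult)
qed

lemma stable_gen_stein_trig:
  "stable_gen \<alpha> \<beta> (\<lambda>x. Re (stein_trig \<alpha> \<beta> cs x)) x =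
     Re (trig_eval cs x) - (LBINT y. Re (trig_eval cs y) * p y) + x * Re (stein_trig' \<alpha> \<beta> cs x) / \<alpha>"
proof -
  let ?F = "\<lambda>u. (stein_trig \<alpha> \<beta> cs (u + x) - stein_trig \<alpha> \<beta> cs x - u * stein_trig' \<alpha> \<beta> cs x) * complex_of_real (stable_kernel \<alpha> \<beta> u)"
  note eq = stein_trig_equation[of cs x]
  have "deriv (\<lambda>x. Re (stein_trig \<alpha> \<beta> cs x)) x = Re (stein_trig' \<alpha> \<beta> cs x)"
    by (intro DERIV_imp_deriv)
       (simp add: has_real_derivative_iff_has_vector_derivative
         bounded_linear.has_vector_derivative[OF bounded_linear_Re has_vector_derivative_stein_trig[OF \<alpha>]])
  then have "stable_gen \<alpha> \<beta> (\<lambda>x. Re (stein_trig \<alpha> \<beta> cs x)) x = d_const \<alpha> * (LBINT u. Re (?F u))"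
    unfolding stable_gen_def stable_kernel_def by (simp add: mult_ac)
  also have "\<dots> = Re (d_const \<alpha> * (LBINT u. ?F u))"
    unfolding integral_Re[OF conjunct1[OF eq]] by simp
  also have "d_const \<alpha> * (LBINT u. ?F u) = trig_eval cs x - (LBINT y. trig_eval cs y * p y) + x * stein_trig' \<alpha> \<beta> cs x / \<alpha>"
    using conjunct2[OF eq] by (simp add: algebra_simps)
  \<comment> \<open>A trivial affine form, to fit \<open>Re_trig_mean\<close>.\<close>
  also have "(LBINT y. trig_eval cs y * p y) = (LBINT y. trig_eval cs (0 + 1 * y) * p y)" by simp
  finally show ?thesis
    using Re_trig_mean[of cs 0 1] by simp
qed

text \<open>Hides the trigonometric polynomials behind an admissible \<phi> whose Stein functional
  at X equals E h(X) - E h(Z). Integrability of the generator along X is read off the Stein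
  equation, since h is bounded and |X \<phi>'(X)| <= \<alpha> |X|.\<close>

lemma stein_trig_test_function:
  fixes M :: "'a measure"
  assumes le: "\<And>x. \<bar>Re (trig_eval (trig_deriv cs) x)\<bar> \<le> 1"
    and M: "prob_space M" and X: "integrable M X"
  shows "\<exists>\<phi>. C2 \<phi> \<and> (\<forall>x. \<bar>deriv \<phi> x\<bar> \<le> \<alpha>) \<and>
    (\<forall>x. \<bar>deriv (deriv \<phi>) x\<bar> \<le> Beta (2 / \<alpha>) (1 - 1 / \<alpha>) * (LBINT y. \<bar>p' y\<bar>)) \<and>
    (\<integral>\<omega>. stable_gen \<alpha> \<beta> \<phi> (X \<omega>) \<partial>M) - (1 / \<alpha>) * (\<integral>\<omega>. X \<omega> * deriv \<phi> (X \<omega>) \<partial>M)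
     = (\<integral>\<omega>. Re (trig_eval cs (X \<omega>)) \<partial>M) - (LBINT y. Re (trig_eval cs y) * p y)"
proof -
  interpret prob_space M by (rule M)
  let ?\<phi> = "\<lambda>x. Re (stein_trig \<alpha> \<beta> cs x)"
  let ?\<phi>1 = "\<lambda>x. Re (stein_trig' \<alpha> \<beta> cs x)"
  let ?\<phi>2 = "\<lambda>x. Re (stein_trig'' \<alpha> \<beta> cs x)"
  have d1: "(?\<phi> has_real_derivative ?\<phi>1 x) (at x)" for x
    unfolding has_real_derivative_iff_has_vector_derivative
    by (rule bounded_linear.has_vector_derivative[OF bounded_linear_Re has_vector_derivative_stein_trig[OF \<alpha>]])
  have d2: "(?\<phi>1 has_real_derivative ?\<phi>2 x) (at x)" for x
    unfolding has_real_derivative_iff_has_vector_derivative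
    by (rule bounded_linear.has_vector_derivative[OF bounded_linear_Re has_vector_derivative_stein_trig'[OF \<alpha>]])
  have D1: "deriv ?\<phi> = ?\<phi>1" using DERIV_imp_deriv[OF d1] by auto
  have D2: "deriv ?\<phi>1 = ?\<phi>2" using DERIV_imp_deriv[OF d2] by auto
  have "C2 ?\<phi>"
    unfolding C2_def D1 D2 using d1 d2
    by (auto simp: real_differentiable_def intro!: continuous_intros continuous_stein_trig''[OF \<alpha>])
  moreover have "(\<integral>\<omega>. stable_gen \<alpha> \<beta> ?\<phi> (X \<omega>) \<partial>M) - (1 / \<alpha>) * (\<integral>\<omega>. X \<omega> * ?\<phi>1 (X \<omega>) \<partial>M)
     = (\<integral>\<omega>. Re (trig_eval cs (X \<omega>)) \<partial>M) - (LBINT y. Re (trig_eval cs y) * p y)"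
  proof -
    have [measurable]: "X \<in> borel_measurable M" using X by auto
    have [measurable]: "?\<phi>1 \<in> borel_measurable borel"
      using d2 by (intro borel_measurable_continuous_onI continuous_at_imp_continuous_on) (auto intro: DERIV_isCont)
    have h: "integrable M (\<lambda>\<omega>. Re (trig_eval cs (X \<omega>)))"
      by (rule integrable_const_bound[of _ "\<Sum>(c, s)\<leftarrow>cs. norm c"])
         (auto intro!: order_trans[OF abs_Re_le_cmod norm_trig_eval_le])
    have x\<phi>: "integrable M (\<lambda>\<omega>. X \<omega> * ?\<phi>1 (X \<omega>))"
      by (rule Bochner_Integration.integrable_bound[OF integrable_mult_right[OF X, of \<alpha>]])
         (use \<alpha> in \<open>auto simp: abs_mult mult.commute[of \<alpha>] intro!: mult_left_mono abs_Re_stein_trig'_le le\<close>)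
    have "(\<integral>\<omega>. stable_gen \<alpha> \<beta> ?\<phi> (X \<omega>) \<partial>M) = (\<integral>\<omega>. (Re (trig_eval cs (X \<omega>)) - (LBINT y. Re (trig_eval cs y) * p y)) + (X \<omega> * ?\<phi>1 (X \<omega>)) * (1 / \<alpha>) \<partial>M)"
      by (simp add: stable_gen_stein_trig)
    also have "\<dots> = (\<integral>\<omega>. Re (trig_eval cs (X \<omega>)) - (LBINT y. Re (trig_eval cs y) * p y) \<partial>M) + (\<integral>\<omega>. (X \<omega> * ?\<phi>1 (X \<omega>)) * (1 / \<alpha>) \<partial>M)"
      using h x\<phi> by (intro Bochner_Integration.integral_add) auto
    also have "(\<integral>\<omega>. Re (trig_eval cs (X \<omega>)) - (LBINT y. Re (trig_eval cs y) * p y) \<partial>M) = (\<integral>\<omega>. Re (trig_eval cs (X \<omega>)) \<partial>M) - (LBINT y. Re (trig_eval cs y) * p y)"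
      using h by (simp add: prob_space)
    also have "(\<integral>\<omega>. (X \<omega> * ?\<phi>1 (X \<omega>)) * (1 / \<alpha>) \<partial>M) = (\<integral>\<omega>. X \<omega> * ?\<phi>1 (X \<omega>) \<partial>M) * (1 / \<alpha>)"
      by (rule integral_mult_left_zero)
    finally show ?thesis by simp
  qed
  ultimately show ?thesis
    using abs_Re_stein_trig'_le[OF le] abs_Re_stein_trig''_le[OF le]
    by (intro exI[of _ ?\<phi>]) (simp add: D1 D2)
qed

end

section \<open>Approximation of Lipschitz functions\<close>

text \<open>By Euler's formula for the sine, each frequency s splits into s + k and s - k.\<close>

lemma ex_trig_eval_mult_sin:
  "\<exists>ds. \<forall>x. trig_eval ds x = trig_eval cs x * complex_of_real (sin (k * x))"
proof (induction cs)
  case Nil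
  show ?case by (intro exI[of _ "[]"]) simp
next
  case (Cons a cs)
  obtain c s where a: "a = (c, s)" by (cases a)
  obtain ds where ds: "trig_eval ds x = trig_eval cs x * complex_of_real (sin (k * x))" for x
    using Cons.IH by blast
  have "c * iexp (s * x) * complex_of_real (sin (k * x)) = c / (2 * \<i>) * iexp ((s + k) * x) + (- c / (2 * \<i>)) * iexp ((s - k) * x)" for x
  proof -
    have "complex_of_real (sin (k * x)) = (iexp (k * x) - iexp (- (k * x))) / (2 * \<i>)"
      by (simp add: complex_eq_iff Re_exp Im_exp)
    moreover have "iexp ((s + k) * x) = iexp (s * x) * iexp (k * x)" "iexp ((s - k) * x) = iexp (s * x) * iexp (- (k * x))"
      unfolding exp_add[symmetric] by (simp_all add: algebra_simps)
    moreover have "c * A * ((B - B') / (2 * \<i>)) = c / (2 * \<i>) * (A * B) + (- c / (2 * \<i>)) * (A * B')" for A B B' :: complex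
      by (simp add: algebra_simps diff_divide_distrib)
    ultimately show ?thesis by (simp only:)
  qed
  then have "trig_eval ((c / (2 * \<i>), s + k) # (- c / (2 * \<i>), s - k) # ds) x = trig_eval (a # cs) x * complex_of_real (sin (k * x))" for x
    by (simp only: a trig_eval_simps ds ring_distribs add.assoc)
  then show ?case by blast
qed

lemma ex_trig_eval_sin_power: "\<exists>cs. \<forall>x. trig_eval cs x = complex_of_real (sin (k * x) ^ n)"
proof (induction n)
  case 0
  show ?case by (intro exI[of _ "[(1, 0)]"]) simp
next
  case (Suc n)
  then obtain cs where cs: "\<And>x. trig_eval cs x = complex_of_real (sin (k * x) ^ n)" by blast
  obtain ds where "\<And>x. trig_eval ds x = trig_eval cs x * complex_of_real (sin (k * x))"
    using ex_trig_eval_mult_sin by blast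
  then show ?case by (intro exI[of _ ds]) (simp add: cs)
qed

lemma trig_eval_scale: "trig_eval (map (\<lambda>(c, s). (b * c, s)) cs) x = b * trig_eval cs x"
  by (induction cs) (auto simp: algebra_simps)

lemma ex_trig_eval_poly_sin:
  fixes a :: "nat \<Rightarrow> real"
  shows "\<exists>cs. \<forall>x. trig_eval cs x = complex_of_real (\<Sum>i\<le>n. a i * (L * sin (k * x)) ^ i)"
proof (induction n)
  case 0
  show ?case by (intro exI[of _ "[(complex_of_real (a 0), 0)]"]) simp
next
  case (Suc n)
  then obtain cs where cs: "\<And>x. trig_eval cs x = complex_of_real (\<Sum>i\<le>n. a i * (L * sin (k * x)) ^ i)" by blast
  obtain ds where ds: "\<And>x. trig_eval ds x = complex_of_real (sin (k * x) ^ Suc n)"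
    using ex_trig_eval_sin_power by blast
  show ?case
    by (intro exI[of _ "cs @ map (\<lambda>(c, s). (complex_of_real (a (Suc n) * L ^ Suc n) * c, s)) ds"] allI)
       (simp add: cs ds trig_eval_scale power_mult_distrib)
qed

text \<open>The derivative of the sliding average \<open>(1/\<delta>) \<integral>\<^sub>x\<^sup>x\<^sup>+\<^sup>\<delta> h\<close> is a difference quotient of \<open>h\<close>, hence bounded by 1;
  integrating a polynomial approximation of it, scaled by \<open>1 / (1 + e)\<close>, keeps the Lipschitz constant.\<close>

lemma lipschitz_polynomial_approximation:
  fixes h :: "real \<Rightarrow> real"
  assumes h: "1-lipschitz_on UNIV h" and L: "L > 0" and \<epsilon>: "\<epsilon> > 0"
  obtains b :: "nat \<Rightarrow> real" and n where "\<And>x. \<bar>x\<bar> \<le> L \<Longrightarrow> \<bar>(\<Sum>i\<le>n. b i * x ^ i) - h x\<bar> \<le> \<epsilon>"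
    and "\<And>x. \<bar>x\<bar> \<le> L \<Longrightarrow> \<exists>D. ((\<lambda>x. \<Sum>i\<le>n. b i * x ^ i) has_real_derivative D) (at x) \<and> \<bar>D\<bar> \<le> 1"
proof -
  \<comment> \<open>Error budget: \<delta> is spent twice, at x and at 0, which costs half of
    \<epsilon>. A derivative error of 2 e over a distance of at most L costs the other half. The cap
    \<delta> <= 1 keeps x + \<delta> inside the interval on which \<open>H\<close> is an
    antiderivative.\<close>
  define \<delta> where "\<delta> = min 1 (\<epsilon> / 4)"
  define e where "e = \<epsilon> / (4 * L)"
  have \<delta>: "0 < \<delta>" "\<delta> \<le> 1" "\<delta> \<le> \<epsilon> / 4" using \<epsilon> by (auto simp: \<delta>_def)
  have e: "0 < e" "2 * e * L = \<epsilon> / 2" using \<epsilon> L by (auto simp: e_def)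
  have lip: "\<bar>h x - h y\<bar> \<le> \<bar>x - y\<bar>" for x y
    using lipschitz_onD[OF h, of x y] by (simp add: dist_real_def)
  have cont: "continuous_on S h" for S
    using lipschitz_on_continuous_on[OF h] by (rule continuous_on_subset) simp
  obtain H where H': "\<And>x. x \<in> {- L - 2..L + 2} \<Longrightarrow> (H has_vector_derivative h x) (at x within {- L - 2..L + 2})"
    using antiderivative_continuous[OF cont] by blast
  have H: "(H has_real_derivative h x) (at x)" if "- L - 2 < x" "x < L + 2" for x
  proof -
    have "x \<in> interior {- L - 2..L + 2}" using that by simp
    then have "at x within {- L - 2..L + 2} = at x" by (rule at_within_interior)
    moreover have "(H has_vector_derivative h x) (at x within {- L - 2..L + 2})"
      using that by (intro H') auto
    ultimately show ?thesis by (simp only: has_real_derivative_iff_has_vector_derivative)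
  qed
  define v where "v x = (H (x + \<delta>) - H x) / \<delta>" for x
  define u where "u x = (h (x + \<delta>) - h x) / \<delta>" for x
  have v: "(v has_real_derivative u x) (at x)" if "\<bar>x\<bar> \<le> L" for x
  proof -
    have "((\<lambda>x. H (x + \<delta>)) has_real_derivative h (x + \<delta>) * 1) (at x)"
      by (rule DERIV_chain2[OF H]) (use that \<delta> in \<open>auto intro!: derivative_eq_intros\<close>)
    moreover have "(H has_real_derivative h x) (at x)" using that by (intro H) auto
    ultimately show ?thesis unfolding v_def u_def by (intro DERIV_cdivide DERIV_diff) auto
  qed
  have vh: "\<bar>v x - h x\<bar> \<le> \<delta>" if "\<bar>x\<bar> \<le> L" for x
  proof -
    have "\<exists>z>x. z < x + \<delta> \<and> H (x + \<delta>) - H x = (x + \<delta> - x) * h z"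
      by (intro MVT2 H) (use that \<delta> in auto)
    then obtain z where z: "x < z" "z < x + \<delta>" "H (x + \<delta>) - H x = (x + \<delta> - x) * h z"
      by blast
    then have "v x = h z" using \<delta> by (simp add: v_def)
    then show ?thesis using lip[of z x] z by simp
  qed
  have u1: "\<bar>u x\<bar> \<le> 1" for x
    using lip[of "x + \<delta>" x] \<delta> by (simp add: u_def)
  have "continuous_on {- L..L} u"
    unfolding u_def using \<delta> by (intro continuous_intros continuous_on_compose2[OF cont[of UNIV]]) auto
  then obtain q where q: "real_polynomial_function q" "\<And>x. x \<in> {- L..L} \<Longrightarrow> \<bar>u x - q x\<bar> < e"
    using Stone_Weierstrass_real_polynomial_function[of "{- L..L}" u e] e by auto
  then obtain a n where qa: "q = (\<lambda>x. \<Sum>i\<le>n. a i * x ^ i)"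
    unfolding real_polynomial_function_iff_sum by blast
  \<comment> \<open>Termwise integration of q / (1 + e) with constant term h(0), hence the shift of
    the index by one.\<close>
  define b where "b i = (case i of 0 \<Rightarrow> h 0 | Suc j \<Rightarrow> a j / (real (Suc j) * (1 + e)))" for i
  define P where "P x = (\<Sum>i\<le>Suc n. b i * x ^ i)" for x
  have P_eq: "P x = h 0 + (\<Sum>i\<le>n. a i / (real (Suc i) * (1 + e)) * x ^ Suc i)" for x
    unfolding P_def sum.atMost_Suc_shift by (simp add: b_def)
  have P: "(P has_real_derivative q x / (1 + e)) (at x)" for x
  proof -
    have pw: "((\<lambda>x. x ^ Suc i) has_real_derivative real (Suc i) * x ^ i) (at x)" for i
      using DERIV_pow[of "Suc i" x UNIV] by (simp del: of_nat_Suc power_Suc)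
    have "((\<lambda>x. h 0 + (\<Sum>i\<le>n. a i / (real (Suc i) * (1 + e)) * x ^ Suc i)) has_real_derivative
        0 + (\<Sum>i\<le>n. a i / (real (Suc i) * (1 + e)) * (real (Suc i) * x ^ i))) (at x)"
      by (intro DERIV_add DERIV_const DERIV_sum DERIV_cmult pw)
    also have "0 + (\<Sum>i\<le>n. a i / (real (Suc i) * (1 + e)) * (real (Suc i) * x ^ i)) = q x / (1 + e)"
      unfolding qa sum_divide_distrib using e by (auto intro!: sum.cong simp del: of_nat_Suc)
    finally show ?thesis unfolding P_eq[abs_def] .
  qed
  have q1: "\<bar>q x\<bar> \<le> 1 + e" if "\<bar>x\<bar> \<le> L" for x
    using q(2)[of x] u1[of x] that by (auto simp: abs_le_iff)
  \<comment> \<open>One e comes from approximating u by q, the other from the rescaling, because |q|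
    <= 1 + e.\<close>
  have D: "\<bar>q x / (1 + e) - u x\<bar> \<le> 2 * e" if "\<bar>x\<bar> \<le> L" for x
  proof -
    have "q x / (1 + e) - q x = - e * (q x / (1 + e))" using e by (simp add: field_simps)
    then have "\<bar>q x / (1 + e) - q x\<bar> = e * (\<bar>q x\<bar> / (1 + e))" using e by (simp add: abs_mult)
    also have "\<dots> \<le> e * 1" using q1[OF that] e by (intro mult_left_mono) auto
    finally show ?thesis using q(2)[of x] that by (auto simp: abs_le_iff)
  qed
  have "\<bar>P x - h x\<bar> \<le> \<epsilon>" if x: "\<bar>x\<bar> \<le> L" for x
  proof -
    have "norm ((P x - v x) - (P 0 - v 0)) \<le> (2 * e) * norm (x - 0)"
    proof (rule field_differentiable_bound[where S = "{- L..L}" and f' = "\<lambda>x. q x / (1 + e) - u x"])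
      show "((\<lambda>x. P x - v x) has_real_derivative q z / (1 + e) - u z) (at z within {- L..L})" if "z \<in> {- L..L}" for z
        using that by (intro DERIV_subset[OF DERIV_diff[OF P v]]) auto
    qed (use x L D in auto)
    also have "\<dots> \<le> (2 * e) * L" using x e by (intro mult_left_mono) auto
    finally have "\<bar>(P x - v x) - (P 0 - v 0)\<bar> \<le> \<epsilon> / 2" using e by simp
    moreover have "P 0 = h 0" by (simp add: P_eq)
    moreover have "\<bar>v 0 - h 0\<bar> \<le> \<delta>" using L by (intro vh) simp
    ultimately show ?thesis using vh[OF x] \<delta>(3) by linarith
  qed
  moreover have "\<exists>D. (P has_real_derivative D) (at x) \<and> \<bar>D\<bar> \<le> 1" if "\<bar>x\<bar> \<le> L" for x
    using P[of x] q1[OF that] e by (intro exI[of _ "q x / (1 + e)"]) simp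
  ultimately show thesis
    using that[of b "Suc n"] unfolding P_def[abs_def] by blast
qed

lemma lipschitz_trig_approximation:
  fixes h :: "real \<Rightarrow> real"
  assumes h: "1-lipschitz_on UNIV h" and L: "L > 0" and \<epsilon>: "\<epsilon> > 0"
  shows "\<exists>cs. (\<forall>x. \<bar>Re (trig_eval (trig_deriv cs) x)\<bar> \<le> 1) \<and> (\<forall>x. \<bar>Re (trig_eval cs x) - h (L * sin (x / L))\<bar> \<le> \<epsilon>)"
proof -
  obtain b n where b: "\<And>x. \<bar>x\<bar> \<le> L \<Longrightarrow> \<bar>(\<Sum>i\<le>n. b i * x ^ i) - h x\<bar> \<le> \<epsilon>"
    and b': "\<And>x. \<bar>x\<bar> \<le> L \<Longrightarrow> \<exists>D. ((\<lambda>x. \<Sum>i\<le>n. b i * x ^ i) has_real_derivative D) (at x) \<and> \<bar>D\<bar> \<le> 1"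
    using lipschitz_polynomial_approximation[OF assms] by blast
  obtain cs where cs: "\<And>x. trig_eval cs x = complex_of_real (\<Sum>i\<le>n. b i * (L * sin (1 / L * x)) ^ i)"
    using ex_trig_eval_poly_sin by blast
  have range: "\<bar>L * sin (1 / L * x)\<bar> \<le> L" for x
    using L by (simp add: abs_mult)
  have "\<bar>Re (trig_eval (trig_deriv cs) x)\<bar> \<le> 1" for x
  proof -
    obtain D where D: "((\<lambda>x. \<Sum>i\<le>n. b i * x ^ i) has_real_derivative D) (at (L * sin (1 / L * x)))" "\<bar>D\<bar> \<le> 1"
      using b'[OF range] by blast
    \<comment> \<open>The inner derivative is a cosine, so the chain rule does not enlarge the slope
      of the polynomial.\<close>
    have "((\<lambda>x. L * sin (1 / L * x)) has_real_derivative cos (1 / L * x)) (at x)"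
      using L by (auto intro!: derivative_eq_intros)
    from DERIV_chain2[OF D(1) this]
    have "((\<lambda>x. Re (trig_eval cs x)) has_real_derivative D * cos (1 / L * x)) (at x)"
      unfolding cs by simp
    moreover have "((\<lambda>x. Re (trig_eval cs x)) has_real_derivative Re (trig_eval (trig_deriv cs) x)) (at x)"
      unfolding has_real_derivative_iff_has_vector_derivative
      by (rule bounded_linear.has_vector_derivative[OF bounded_linear_Re has_vector_derivative_trig_eval])
    ultimately have "Re (trig_eval (trig_deriv cs) x) = D * cos (1 / L * x)" by (rule DERIV_unique[symmetric])
    then show ?thesis using D(2) mult_mono[of "\<bar>D\<bar>" 1 "\<bar>cos (1 / L * x)\<bar>" 1] by (simp add: abs_mult)
  qed
  moreover have "\<bar>Re (trig_eval cs x) - h (L * sin (x / L))\<bar> \<le> \<epsilon>" for x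
    using b[OF range[of x]] unfolding cs by simp
  ultimately show ?thesis by blast
qed

lemma abs_scaled_sin_minus_le:
  fixes x L :: real
  assumes "L > 0"
  shows "\<bar>L * sin (x / L) - x\<bar> \<le> x\<^sup>2 / L"
proof -
  have "\<bar>sin (x / L) - x / L\<bar> \<le> norm (iexp (x / L) - 1 - \<i> * complex_of_real (x / L))"
    using abs_Im_le_cmod[of "iexp (x / L) - 1 - \<i> * complex_of_real (x / L)"] by (simp add: Im_exp)
  also have "\<dots> \<le> (x / L)\<^sup>2"
    using norm_exp_minus_1_minus_le[of "\<i> * complex_of_real (x / L)"] by (simp add: norm_mult norm_divide power_divide)
  finally have "L * \<bar>sin (x / L) - x / L\<bar> \<le> L * (x / L)\<^sup>2"
    using assms by (intro mult_left_mono) auto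
  moreover have "L * \<bar>sin (x / L) - x / L\<bar> = \<bar>L * sin (x / L) - x\<bar>"
  proof -
    have "L * sin (x / L) - x = L * (sin (x / L) - x / L)" using assms by (simp add: right_diff_distrib)
    then show ?thesis using assms by (simp add: abs_mult)
  qed
  moreover have "L * (x / L)\<^sup>2 = x\<^sup>2 / L"
    using assms by (simp add: power2_eq_square)
  ultimately show ?thesis by simp
qed

text \<open>The substitution \<open>x \<mapsto> L sin (x / L)\<close> is 1-Lipschitz, bounded by \<open>L\<close> and tends to the identity, so it
  turns polynomials on \<open>[-L, L]\<close> into trigonometric polynomials without increasing Lipschitz constants.\<close>

lemma lipschitz_trig_sequence:
  fixes h :: "real \<Rightarrow> real"
  assumes h: "1-lipschitz_on UNIV h"
  obtains cs where "\<And>n x. \<bar>Re (trig_eval (trig_deriv (cs n)) x)\<bar> \<le> 1"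
    and "\<And>x. (\<lambda>n. Re (trig_eval (cs n) x)) \<longlonglongrightarrow> h x"
    and "\<And>n x. \<bar>Re (trig_eval (cs n) x)\<bar> \<le> 1 + \<bar>h 0\<bar> + \<bar>x\<bar>"
proof -
  have lip: "\<bar>h x - h y\<bar> \<le> \<bar>x - y\<bar>" for x y
    using lipschitz_onD[OF h, of x y] by (simp add: dist_real_def)
  have "\<exists>cs. (\<forall>x. \<bar>Re (trig_eval (trig_deriv cs) x)\<bar> \<le> 1) \<and>
      (\<forall>x. \<bar>Re (trig_eval cs x) - h (real (Suc n) * sin (x / real (Suc n)))\<bar> \<le> 1 / real (Suc n))" for n
    using lipschitz_trig_approximation[OF h, of "real (Suc n)" "1 / real (Suc n)"] by simp
  then obtain cs where cs: "\<And>n x. \<bar>Re (trig_eval (trig_deriv (cs n)) x)\<bar> \<le> 1"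
      "\<And>n x. \<bar>Re (trig_eval (cs n) x) - h (real (Suc n) * sin (x / real (Suc n)))\<bar> \<le> 1 / real (Suc n)"
    by metis
  \<comment> \<open>The approximation error 1 / (n + 1) is added to the Lipschitz estimate of h
    between x and the scaled sine. The rate depends on x, so convergence is only claimed pointwise
    and the limit under the integral needs the linear bound below.\<close>
  have close: "\<bar>Re (trig_eval (cs n) x) - h x\<bar> \<le> (1 + x\<^sup>2) * inverse (real (Suc n))" for n x
  proof -
    have "\<bar>h (real (Suc n) * sin (x / real (Suc n))) - h x\<bar> \<le> x\<^sup>2 / real (Suc n)"
      using lip abs_scaled_sin_minus_le[of "real (Suc n)" x] by (rule order_trans) simp
    then have "\<bar>Re (trig_eval (cs n) x) - h x\<bar> \<le> 1 / real (Suc n) + x\<^sup>2 / real (Suc n)"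
      using cs(2)[of n x] by linarith
    then show ?thesis by (simp add: divide_inverse algebra_simps)
  qed
  have lim: "(\<lambda>n. Re (trig_eval (cs n) x)) \<longlonglongrightarrow> h x" for x
  proof (rule Lim_null[THEN iffD2], rule Lim_null_comparison)
    show "(\<lambda>n. (1 + x\<^sup>2) * inverse (real (Suc n))) \<longlonglongrightarrow> 0"
      by (intro tendsto_mult_right_zero LIMSEQ_inverse_real_of_nat)
  qed (use close in \<open>auto intro!: always_eventually\<close>)
  \<comment> \<open>The scaled sine never exceeds |x| in absolute value, so the linear bound is the
    same for all n.\<close>
  have bound: "\<bar>Re (trig_eval (cs n) x)\<bar> \<le> 1 + \<bar>h 0\<bar> + \<bar>x\<bar>" for n x
  proof -
    have "\<bar>real (Suc n) * sin (x / real (Suc n))\<bar> \<le> real (Suc n) * \<bar>x / real (Suc n)\<bar>"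
      unfolding abs_mult using abs_sin_x_le_abs_x[of "x / real (Suc n)"] by (intro mult_mono) auto
    also have "\<dots> = \<bar>x\<bar>" by (simp add: abs_divide)
    finally have "\<bar>h (real (Suc n) * sin (x / real (Suc n))) - h 0\<bar> \<le> \<bar>x\<bar>"
      using lip[of "real (Suc n) * sin (x / real (Suc n))" 0] by linarith
    moreover have "1 / real (Suc n) \<le> 1" by simp
    ultimately show ?thesis using cs(2)[of n x] by linarith
  qed
  show thesis using that[of cs] cs(1) lim bound by blast
qed

section \<open>Passage from trigonometric polynomials to all Lipschitz functions\<close>

theorem theorem1p2:
  fixes \<alpha> \<beta> :: real and \<mu> :: "real measure" and p p' :: "real \<Rightarrow> real"
    and M :: "'a measure" and X :: "'a \<Rightarrow> real"
  assumes "1 < \<alpha>" "\<alpha> < 2" "-1 \<le> \<beta>" "\<beta> \<le> 1"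
    and "is_stable_law \<alpha> 1 \<beta> \<mu>"
    and "p \<in> borel_measurable lborel" "\<forall>y. 0 \<le> p y"
    and "\<mu> = density lborel p"
    and "\<forall>y. (p has_real_derivative p' y) (at y)"
    and "prob_space M" "X \<in> borel_measurable M" "integrable M X"
  shows "integrable lborel (\<lambda>y. \<bar>p' y\<bar>) \<and>
    (let \<eta> = Beta (2 / \<alpha>) (1 - 1 / \<alpha>) * (LINT y|lborel. \<bar>p' y\<bar>) in
     wasserstein (distr M borel X) \<mu>
       \<le> (SUP \<phi>\<in>{\<phi>. C2 \<phi> \<and> (\<forall>x. \<bar>deriv \<phi> x\<bar> \<le> \<alpha>) \<and> (\<forall>x. \<bar>deriv (deriv \<phi>) x\<bar> \<le> \<eta>)}.
            ereal \<bar>(\<integral>\<omega>. stable_gen \<alpha> \<beta> \<phi> (X \<omega>) \<partial>M)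
                   - (1 / \<alpha>) * (\<integral>\<omega>. X \<omega> * deriv \<phi> (X \<omega>) \<partial>M)\<bar>))"
proof -
  note \<alpha> = assms(1,2) and stable = assms(5) and \<mu> = assms(8)
  have p0: "0 \<le> p y" and p': "(p has_real_derivative p' y) (at y)" for y
    using assms(7,9) by auto
  have [measurable]: "p \<in> borel_measurable borel" "X \<in> borel_measurable M" using assms by auto
  interpret M: prob_space M by (rule assms(10))
  interpret \<mu>: real_distribution \<mu> using stable by (simp add: is_stable_law_def)
  note facts = \<alpha> stable p0 \<mu> p'
  have int_p': "integrable lborel p'" by (rule integrable_stable_density_deriv[OF facts])
  have integral_stable_law: "(LINT y|\<mu>. f y) = (LBINT y. p y *\<^sub>R f y)"
    if "f \<in> borel_measurable borel" for f :: "real \<Rightarrow> 'c::{banach, second_countable_topology}"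
    using that p0 unfolding \<mu> by (intro integral_density) auto
  have integrable_stable_law: "integrable \<mu> f \<longleftrightarrow> integrable lborel (\<lambda>y. p y *\<^sub>R f y)"
    if "f \<in> borel_measurable borel" for f :: "real \<Rightarrow> real"
    using that p0 unfolding \<mu> by (intro Bochner_Integration.integrable_density) auto
  \<comment> \<open>The constant 1 is integrable for a probability measure; read through the density
    this says that \<open>p\<close> is integrable.\<close>
  have p_int: "integrable lborel p"
    using integrable_stable_law[of "\<lambda>_. 1"] by simp
  have p_char: "(LBINT y. iexp (t * y) * p y) = exp (stable_exponent \<alpha> \<beta> t)" for t
  proof -
    have "char \<mu> t = (LBINT y. p y *\<^sub>R iexp (t * y))"
      unfolding char_def by (rule integral_stable_law) measurable
    then show ?thesis
      by (simp add: char_stable[OF facts] scaleR_conv_of_real mult.commute)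
  qed
  interpret stable_density \<alpha> \<beta> p p'
    by unfold_locales (fact \<alpha> p0 p_int p_char p' continuous_stable_density_deriv[OF facts] int_p' stable_density_tendsto_0[OF facts])+
  \<comment> \<open>Provides the majorant 1 + |h(0)| + |y| on the side of Z; it follows from |1 -
    exp(\<psi>(t))| <= |\<psi>(t)|, which is of order |t| powr \<alpha>.\<close>
  have moment: "integrable \<mu> (\<lambda>y. y)"
  proof (rule \<mu>.integrable_if_char_powr_bound[OF \<alpha>(1)])
    fix t
    have "norm (1 - char \<mu> t) = norm (exp (stable_exponent \<alpha> \<beta> t) - 1)"
      by (simp add: char_stable[OF facts] norm_minus_commute)
    also have "\<dots> \<le> norm (stable_exponent \<alpha> \<beta> t)"
      by (rule norm_exp_minus_1_le[OF Re_stable_exponent_nonpos])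
    also have "\<dots> \<le> (1 + \<bar>\<beta> * tan (pi * \<alpha> / 2)\<bar>) * \<bar>t\<bar> powr \<alpha>"
      by (rule norm_stable_exponent_le)
    finally show "norm (1 - char \<mu> t) \<le> (1 + \<bar>\<beta> * tan (pi * \<alpha> / 2)\<bar>) * \<bar>t\<bar> powr \<alpha>" .
  qed
  define \<eta> where "\<eta> = Beta (2 / \<alpha>) (1 - 1 / \<alpha>) * (LINT y|lborel. \<bar>p' y\<bar>)"
  let ?\<Phi> = "{\<phi>. C2 \<phi> \<and> (\<forall>x. \<bar>deriv \<phi> x\<bar> \<le> \<alpha>) \<and> (\<forall>x. \<bar>deriv (deriv \<phi>) x\<bar> \<le> \<eta>)}"
  let ?v = "\<lambda>\<phi>. ereal \<bar>(\<integral>\<omega>. stable_gen \<alpha> \<beta> \<phi> (X \<omega>) \<partial>M) - (1 / \<alpha>) * (\<integral>\<omega>. X \<omega> * deriv \<phi> (X \<omega>) \<partial>M)\<bar>"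
  have "ereal \<bar>(\<integral>x. h x \<partial>distr M borel X) - (\<integral>x. h x \<partial>\<mu>)\<bar> \<le> (SUP \<phi>\<in>?\<Phi>. ?v \<phi>)"
    if h: "1-lipschitz_on UNIV h" for h :: "real \<Rightarrow> real"
  proof -
    obtain cs where cs: "\<And>n x. \<bar>Re (trig_eval (trig_deriv (cs n)) x)\<bar> \<le> 1"
      "\<And>x. (\<lambda>n. Re (trig_eval (cs n) x)) \<longlonglongrightarrow> h x"
      "\<And>n x. \<bar>Re (trig_eval (cs n) x)\<bar> \<le> 1 + \<bar>h 0\<bar> + \<bar>x\<bar>"
      using lipschitz_trig_sequence[OF h] by blast
    have [measurable]: "h \<in> borel_measurable borel"
      by (rule borel_measurable_continuous_onI[OF lipschitz_on_continuous_on[OF h]])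
    \<comment> \<open>The comparison with the supremum is made for each n before the limit, so only
      the mean differences have to converge and not the functions \<phi>.\<close>
    have le: "ereal \<bar>(\<integral>\<omega>. Re (trig_eval (cs n) (X \<omega>)) \<partial>M) - (\<integral>y. Re (trig_eval (cs n) y) \<partial>\<mu>)\<bar> \<le> (SUP \<phi>\<in>?\<Phi>. ?v \<phi>)" for n
    proof -
      have "(\<integral>y. Re (trig_eval (cs n) y) \<partial>\<mu>) = (LBINT y. Re (trig_eval (cs n) y) * p y)"
        by (subst integral_stable_law) (auto simp: mult.commute)
      moreover obtain \<phi> where "\<phi> \<in> ?\<Phi>" 
        "(\<integral>\<omega>. stable_gen \<alpha> \<beta> \<phi> (X \<omega>) \<partial>M) - (1 / \<alpha>) * (\<integral>\<omega>. X \<omega> * deriv \<phi> (X \<omega>) \<partial>M)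
          = (\<integral>\<omega>. Re (trig_eval (cs n) (X \<omega>)) \<partial>M) - (LBINT y. Re (trig_eval (cs n) y) * p y)"
        using stein_trig_test_function[OF cs(1) assms(10,12)] unfolding \<eta>_def by blast
      ultimately show ?thesis by (intro SUP_upper2[of \<phi>]) auto
    qed
    have "(\<lambda>n. \<integral>\<omega>. Re (trig_eval (cs n) (X \<omega>)) \<partial>M) \<longlonglongrightarrow> (\<integral>\<omega>. h (X \<omega>) \<partial>M)"
    proof (rule integral_dominated_convergence[where w = "\<lambda>\<omega>. 1 + \<bar>h 0\<bar> + \<bar>X \<omega>\<bar>"])
      show "integrable M (\<lambda>\<omega>. 1 + \<bar>h 0\<bar> + \<bar>X \<omega>\<bar>)"
        using assms(12) by simp
      show "AE \<omega> in M. (\<lambda>n. Re (trig_eval (cs n) (X \<omega>))) \<longlonglongrightarrow> h (X \<omega>)"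
        by (rule AE_I2) (rule cs(2))
      show "AE \<omega> in M. norm (Re (trig_eval (cs n) (X \<omega>))) \<le> 1 + \<bar>h 0\<bar> + \<bar>X \<omega>\<bar>" for n
        unfolding real_norm_def by (rule AE_I2) (rule cs(3))
    qed measurable
    moreover have "(\<lambda>n. \<integral>y. Re (trig_eval (cs n) y) \<partial>\<mu>) \<longlonglongrightarrow> (\<integral>y. h y \<partial>\<mu>)"
    proof (rule integral_dominated_convergence[where w = "\<lambda>y. 1 + \<bar>h 0\<bar> + \<bar>y\<bar>"])
      show "integrable \<mu> (\<lambda>y. 1 + \<bar>h 0\<bar> + \<bar>y\<bar>)"
        using moment by simp
      show "AE y in \<mu>. (\<lambda>n. Re (trig_eval (cs n) (y))) \<longlonglongrightarrow> h (y)"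
        by (rule AE_I2) (rule cs(2))
      show "AE y in \<mu>. norm (Re (trig_eval (cs n) (y))) \<le> 1 + \<bar>h 0\<bar> + \<bar>y\<bar>" for n
        unfolding real_norm_def by (rule AE_I2) (rule cs(3))
    qed measurable
    ultimately have "(\<lambda>n. ereal \<bar>(\<integral>\<omega>. Re (trig_eval (cs n) (X \<omega>)) \<partial>M) - (\<integral>y. Re (trig_eval (cs n) y) \<partial>\<mu>)\<bar>)
       \<longlonglongrightarrow> ereal \<bar>(\<integral>\<omega>. h (X \<omega>) \<partial>M) - (\<integral>y. h y \<partial>\<mu>)\<bar>"
      by (intro tendsto_intros)
    then have "ereal \<bar>(\<integral>\<omega>. h (X \<omega>) \<partial>M) - (\<integral>y. h y \<partial>\<mu>)\<bar> \<le> (SUP \<phi>\<in>?\<Phi>. ?v \<phi>)"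
      by (rule LIMSEQ_le_const2) (use le in blast)
    then show ?thesis by (simp add: integral_distr)
  qed
  then have "wasserstein (distr M borel X) \<mu> \<le> (SUP \<phi>\<in>?\<Phi>. ?v \<phi>)"
    unfolding wasserstein_def by (intro SUP_least) auto
  then show ?thesis
    using integrable_abs[OF int_p'] unfolding \<eta>_def Let_def by blast
qed

end
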